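(* Let $(\mathcal X,d,\mu)$ be an RD-space with $\mu(\mathcal X)=\infty$ and doubling exponent $n$. Let $\epsilon_1\in(0,1]$, $\epsilon_2,\epsilon_3>0$, $\epsilon\in(0,\epsilon_1\wedge\epsilon_2)$, and let $\{S_k\}_{k\in\mathbb Z}$ be an $(\epsilon_1,\epsilon_2,\epsilon_3)$-AOTI. Let $p\in(n/(n+\epsilon),1]$ and $\beta,\gamma\in(n(1/p-1),\epsilon)$. Then there exists a positive constant $C$ such that for all $\ell\in\mathbb Z$ and $f\in(\mathcal G_0^\epsilon(\beta,\gamma))'$, $$\|f-S_\ell(f)\|_{H^p(\mathcal X)}\le C\|G_\ell(f)\|_{L^p(\mathcal X)}.$$
   Context: A triple $(\mathcal X,d,\mu)$, with $(\mathcal X,d)$ a metric space and $\mu$ a Borel regular measure such that every ball $B(x,r)=\{y:d(x,y)<r\}$ has finite positive measure, is a space of homogeneous type if there exist $C_1\ge1$ and $n>0$ with $\mu(B(x,\lambda r))\le C_1\lambda^n\mu(B(x,r))$ for all $x$, $\lambda\ge1$, $r>0$ ($n$ = doubling exponent); it is an RD-space if moreover there are $C_2,C_3>1$ with $\mu(B(x,C_2r))\ge C_3\mu(B(x,r))$ for all $x$ and $0<r<\operatorname{diam}(\mathcal X)$. Write $V_r(x)=\mu(B(x,r))$, $V(x,y)=\mu(B(x,d(x,y)))$, $a\wedge b=\min\{a,b\}$. AOTI: for $\epsilon_1\in(0,1]$, $\epsilon_2,\epsilon_3>0$, an $(\epsilon_1,\epsilon_2,\epsilon_3)$-AOTI is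 a sequence $\{S_k\}_{k\in\mathbb Z}$ of bounded linear integral operators on $L^2(\mathcal X)$ with measurable kernels $S_k(x,y)$ satisfying, for some $C_4>0$ and all $k,x,x',y,y'$: (i) $|S_k(x,y)|\le C_4\frac{1}{V_{2^{-k}}(x)+V(x,y)}\big[\frac{2^{-k}}{2^{-k}+d(x,y)}\big]^{\epsilon_2}$; (ii) $|S_k(x,y)-S_k(x',y)|\le C_4\big[\frac{d(x,x')}{2^{-k}+d(x,y)}\big]^{\epsilon_1}\frac{1}{V_{2^{-k}}(x)+V(x,y)}\big[\frac{2^{-k}}{2^{-k}+d(x,y)}\big]^{\epsilon_2}$ if $d(x,x')\le[2^{-k}+d(x,y)]/2$; (iii) (ii) with $x,y$ interchanged; (iv) $|[S_k(x,y)-S_k(x,y')]-[S_k(x',y)-S_k(x',y')]|\le C_4\big[\frac{d(x,x')}{2^{-k}+d(x,y)}\big]^{\epsilon_1}\big[\frac{d(y,y')}{2^{-k}+d(x,y)}\big]^{\epsilon_1}\frac{1}{V_{2^{-k}}(x)+V(x,y)}\big[\frac{2^{-k}}{2^{-k}+d(x,y)}\big]^{\epsilon_3}$ if $d(x,x'),d(y,y')\le[2^{-k}+d(x,y)]/3$; (v) $\int S_k(x,z)\,d\mu(z)=1=\int S_k(z,y)\,d\mu(z)$. Test functions: for $x\in\mathcal X$, $r>0$, $\beta\in(0,1]$, $\gamma>0$, $\mathcal G(x,r,\beta,\gamma)$ is the set of $f$ with some $C\ge0$ such that $|f(y)|\le C\frac{1}{V_r(x)+V(x,y)}\big(\frac{r}{r+d(x,y)}\big)^\gamma$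 for all $y$ and $|f(z)-f(y)|\le C\big(\frac{d(y,z)}{r+d(x,y)}\big)^\beta\frac{1}{V_r(x)+V(x,y)}\big(\frac{r}{r+d(x,y)}\big)^\gamma$ whenever $d(y,z)\le[r+d(x,y)]/2$; the norm is the infimum of such $C$. Fix $x_1\in\mathcal X$; for $\epsilon\in(0,1]$, $\beta,\gamma\in(0,\epsilon]$, $\mathcal G_0^\epsilon(\beta,\gamma)$ is the closure of $\mathcal G(x_1,1,\epsilon,\epsilon)$ in $\mathcal G(x_1,1,\beta,\gamma)$, and $(\mathcal G_0^\epsilon(\beta,\gamma))'$ its dual. $S_k(f)(x)=\langle f,S_k(x,\cdot)\rangle$. Grand maximal function: $G(f)(x)=\sup\{|\langle f,\varphi\rangle|:\varphi\in\mathcal G_0^\epsilon(\beta,\gamma),\ \|\varphi\|_{\mathcal G(x,r,\beta,\gamma)}\le1\text{ for some }r>0\}$; localized version $G_\ell(f)(x)$: same supremum restricted to $r\in(0,2^{-\ell}]$. $\|f\|_{H^p(\mathcal X)}=\|G(f)\|_{L^p(\mathcal X)}$, and $H^p(\mathcal X)$ is the set of $f\in(\mathcal G_0^\epsilon(\beta,\gamma))'$ for which this is finite. *)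

theory Defs
  imports "HOL-Analysis.Analysis"
begin

definition V :: "'a::metric_space measure \<Rightarrow> real \<Rightarrow> 'a \<Rightarrow> real" where
  "V \<mu> r x = measure \<mu> (ball x r)"

definition Vxy :: "'a::metric_space measure \<Rightarrow> 'a \<Rightarrow> 'a \<Rightarrow> real" where
  "Vxy \<mu> x y = measure \<mu> (ball x (dist x y))"

definition admissible_measure :: "'a::metric_space measure \<Rightarrow> bool" where
  "admissible_measure \<mu> \<longleftrightarrow> sets \<mu> = sets borel \<and>
     (\<forall>x r. r > 0 \<longrightarrow> 0 < emeasure \<mu> (ball x r) \<and> emeasure \<mu> (ball x r) < \<infinity>)"

definition homogeneous_type :: "'a::metric_space measure \<Rightarrow> real \<Rightarrow> bool" where
  "homogeneous_type \<mu> n \<longleftrightarrow> admissible_measure \<mu> \<and> n > 0 \<and>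
     (\<exists>C1\<ge>1. \<forall>x t r. t \<ge> 1 \<longrightarrow> r > 0 \<longrightarrow>
        measure \<mu> (ball x (t * r)) \<le> C1 * t powr n * measure \<mu> (ball x r))"

text \<open>RD-space with doubling exponent n. The condition 0 < r < diam X is written
  as r > 0 and r < dist y z for some y z (i.e. r < sup of distances).\<close>
definition RD_space :: "'a::metric_space measure \<Rightarrow> real \<Rightarrow> bool" where
  "RD_space \<mu> n \<longleftrightarrow> homogeneous_type \<mu> n \<and>
     (\<exists>C2>1. \<exists>C3>1. \<forall>x r. 0 < r \<longrightarrow> (\<exists>y z::'a. r < dist y z) \<longrightarrow>
        measure \<mu> (ball x (C2 * r)) \<ge> C3 * measure \<mu> (ball x r))"

definition AOTI :: "'a::metric_space measure \<Rightarrow> real \<Rightarrow> real \<Rightarrow> real \<Rightarrow>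
    (int \<Rightarrow> 'a \<Rightarrow> 'a \<Rightarrow> real) \<Rightarrow> bool" where
  "AOTI \<mu> \<epsilon>1 \<epsilon>2 \<epsilon>3 S \<longleftrightarrow>
     0 < \<epsilon>1 \<and> \<epsilon>1 \<le> 1 \<and> 0 < \<epsilon>2 \<and> 0 < \<epsilon>3 \<and>
     \<comment> \<open>measurable kernels, bounded integral operators on L^2\<close>
     (\<forall>k. (\<lambda>(x,y). S k x y) \<in> borel_measurable (\<mu> \<Otimes>\<^sub>M \<mu>)) \<and>
     (\<forall>k. \<exists>B. \<forall>g. g \<in> borel_measurable \<mu> \<longrightarrow> integrable \<mu> (\<lambda>y. (g y)\<^sup>2) \<longrightarrow>
         (AE x in \<mu>. integrable \<mu> (\<lambda>y. S k x y * g y)) \<and>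
         integrable \<mu> (\<lambda>x. (LINT y|\<mu>. S k x y * g y)\<^sup>2) \<and>
         (LINT x|\<mu>. (LINT y|\<mu>. S k x y * g y)\<^sup>2) \<le> B * (LINT y|\<mu>. (g y)\<^sup>2)) \<and>
     (\<exists>C4>0.
       \<comment> \<open>(i)\<close>
       (\<forall>k x y. \<bar>S k x y\<bar> \<le> C4 * (1 / (V \<mu> (2 powr (-k)) x + Vxy \<mu> x y))
            * (2 powr (-k) / (2 powr (-k) + dist x y)) powr \<epsilon>2) \<and>
       \<comment> \<open>(ii)\<close>
       (\<forall>k x x' y. dist x x' \<le> (2 powr (-k) + dist x y) / 2 \<longrightarrow>
          \<bar>S k x y - S k x' y\<bar> \<le> C4 * (dist x x' / (2 powr (-k) + dist x y)) powr \<epsilon>1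
            * (1 / (V \<mu> (2 powr (-k)) x + Vxy \<mu> x y))
            * (2 powr (-k) / (2 powr (-k) + dist x y)) powr \<epsilon>2) \<and>
       \<comment> \<open>(iii)\<close>
       (\<forall>k x y y'. dist y y' \<le> (2 powr (-k) + dist x y) / 2 \<longrightarrow>
          \<bar>S k x y - S k x y'\<bar> \<le> C4 * (dist y y' / (2 powr (-k) + dist x y)) powr \<epsilon>1
            * (1 / (V \<mu> (2 powr (-k)) x + Vxy \<mu> x y))
            * (2 powr (-k) / (2 powr (-k) + dist x y)) powr \<epsilon>2) \<and>
       \<comment> \<open>(iv)\<close>
       (\<forall>k x x' y y'. dist x x' \<le> (2 powr (-k) + dist x y) / 3 \<longrightarrow>
           dist y y' \<le> (2 powr (-k) + dist x y) / 3 \<longrightarrow>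
          \<bar>(S k x y - S k x y') - (S k x' y - S k x' y')\<bar> \<le>
            C4 * (dist x x' / (2 powr (-k) + dist x y)) powr \<epsilon>1
            * (dist y y' / (2 powr (-k) + dist x y)) powr \<epsilon>1
            * (1 / (V \<mu> (2 powr (-k)) x + Vxy \<mu> x y))
            * (2 powr (-k) / (2 powr (-k) + dist x y)) powr \<epsilon>3)) \<and>
     \<comment> \<open>(v)\<close>
     (\<forall>k x. (LINT z|\<mu>. S k x z) = 1) \<and>
     (\<forall>k y. (LINT z|\<mu>. S k z y) = 1)"

definition test_bound :: "'a::metric_space measure \<Rightarrow> 'a \<Rightarrow> real \<Rightarrow> real \<Rightarrow> real \<Rightarrow>
    real \<Rightarrow> ('a \<Rightarrow> real) \<Rightarrow> bool" where
  "test_bound \<mu> x r \<beta> \<gamma> C f \<longleftrightarrow> C \<ge> 0 \<and>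
     (\<forall>y. \<bar>f y\<bar> \<le> C * (1 / (V \<mu> r x + Vxy \<mu> x y)) * (r / (r + dist x y)) powr \<gamma>) \<and>
     (\<forall>y z. dist y z \<le> (r + dist x y) / 2 \<longrightarrow>
        \<bar>f z - f y\<bar> \<le> C * (dist y z / (r + dist x y)) powr \<beta>
           * (1 / (V \<mu> r x + Vxy \<mu> x y)) * (r / (r + dist x y)) powr \<gamma>)"

definition Gset :: "'a::metric_space measure \<Rightarrow> 'a \<Rightarrow> real \<Rightarrow> real \<Rightarrow> real \<Rightarrow>
    ('a \<Rightarrow> real) set" where
  "Gset \<mu> x r \<beta> \<gamma> = {f. \<exists>C. test_bound \<mu> x r \<beta> \<gamma> C f}"

definition Gnorm :: "'a::metric_space measure \<Rightarrow> 'a \<Rightarrow> real \<Rightarrow> real \<Rightarrow> real \<Rightarrow>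
    ('a \<Rightarrow> real) \<Rightarrow> real" where
  "Gnorm \<mu> x r \<beta> \<gamma> f = Inf {C. test_bound \<mu> x r \<beta> \<gamma> C f}"

definition G0 :: "'a::metric_space measure \<Rightarrow> 'a \<Rightarrow> real \<Rightarrow> real \<Rightarrow> real \<Rightarrow>
    ('a \<Rightarrow> real) set" where
  "G0 \<mu> x1 \<epsilon> \<beta> \<gamma> = {f \<in> Gset \<mu> x1 1 \<beta> \<gamma>.
     \<forall>e>0. \<exists>g \<in> Gset \<mu> x1 1 \<epsilon> \<epsilon>. Gnorm \<mu> x1 1 \<beta> \<gamma> (\<lambda>y. f y - g y) < e}"

text \<open>The dual (G_0^eps(beta,gamma))': bounded linear functionals on G0
  (represented as total functions; only their values on G0 matter).\<close>
definition G0_dual :: "'a::metric_space measure \<Rightarrow> 'a \<Rightarrow> real \<Rightarrow> real \<Rightarrow> real \<Rightarrow>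
    (('a \<Rightarrow> real) \<Rightarrow> real) set" where
  "G0_dual \<mu> x1 \<epsilon> \<beta> \<gamma> = {f.
     (\<forall>\<phi>\<in>G0 \<mu> x1 \<epsilon> \<beta> \<gamma>. \<forall>\<psi>\<in>G0 \<mu> x1 \<epsilon> \<beta> \<gamma>. f (\<lambda>y. \<phi> y + \<psi> y) = f \<phi> + f \<psi>) \<and>
     (\<forall>\<phi>\<in>G0 \<mu> x1 \<epsilon> \<beta> \<gamma>. \<forall>c. f (\<lambda>y. c * \<phi> y) = c * f \<phi>) \<and>
     (\<exists>B. \<forall>\<phi>\<in>G0 \<mu> x1 \<epsilon> \<beta> \<gamma>. \<bar>f \<phi>\<bar> \<le> B * Gnorm \<mu> x1 1 \<beta> \<gamma> \<phi>)}"

definition S_apply :: "(int \<Rightarrow> 'a \<Rightarrow> 'a \<Rightarrow> real) \<Rightarrow> int \<Rightarrow> (('a \<Rightarrow> real) \<Rightarrow> real) \<Rightarrow>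
    'a \<Rightarrow> real" where
  "S_apply S k f x = f (\<lambda>y. S k x y)"

definition minus_S :: "'a::metric_space measure \<Rightarrow> (int \<Rightarrow> 'a \<Rightarrow> 'a \<Rightarrow> real) \<Rightarrow> int \<Rightarrow>
    (('a \<Rightarrow> real) \<Rightarrow> real) \<Rightarrow> (('a \<Rightarrow> real) \<Rightarrow> real)" where
  "minus_S \<mu> S k f = (\<lambda>\<phi>. f \<phi> - (LINT x|\<mu>. S_apply S k f x * \<phi> x))"

definition grand_max :: "'a::metric_space measure \<Rightarrow> 'a \<Rightarrow> real \<Rightarrow> real \<Rightarrow> real \<Rightarrow>
    (('a \<Rightarrow> real) \<Rightarrow> real) \<Rightarrow> 'a \<Rightarrow> ennreal" where
  "grand_max \<mu> x1 \<epsilon> \<beta> \<gamma> f x = Sup {ennreal \<bar>f \<phi>\<bar> | \<phi>. \<phi> \<in> G0 \<mu> x1 \<epsilon> \<beta> \<gamma> \<and>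
      (\<exists>r>0. \<phi> \<in> Gset \<mu> x r \<beta> \<gamma> \<and> Gnorm \<mu> x r \<beta> \<gamma> \<phi> \<le> 1)}"

definition grand_max_loc :: "'a::metric_space measure \<Rightarrow> 'a \<Rightarrow> real \<Rightarrow> real \<Rightarrow> real \<Rightarrow>
    int \<Rightarrow> (('a \<Rightarrow> real) \<Rightarrow> real) \<Rightarrow> 'a \<Rightarrow> ennreal" where
  "grand_max_loc \<mu> x1 \<epsilon> \<beta> \<gamma> l f x = Sup {ennreal \<bar>f \<phi>\<bar> | \<phi>. \<phi> \<in> G0 \<mu> x1 \<epsilon> \<beta> \<gamma> \<and>
      (\<exists>r. 0 < r \<and> r \<le> 2 powr (-l) \<and> \<phi> \<in> Gset \<mu> x r \<beta> \<gamma> \<and> Gnorm \<mu> x r \<beta> \<gamma> \<phi> \<le> 1)}"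

definition enn_powr :: "ennreal \<Rightarrow> real \<Rightarrow> ennreal" where
  "enn_powr a q = (if a = \<infinity> then \<infinity> else ennreal (enn2real a powr q))"

definition Lp_norm :: "'a measure \<Rightarrow> real \<Rightarrow> ('a \<Rightarrow> ennreal) \<Rightarrow> ennreal" where
  "Lp_norm \<mu> p g = enn_powr (\<integral>\<^sup>+ x. enn_powr (g x) p \<partial>\<mu>) (1 / p)"

definition Hp_norm :: "'a::metric_space measure \<Rightarrow> 'a \<Rightarrow> real \<Rightarrow> real \<Rightarrow> real \<Rightarrow> real \<Rightarrow>
    (('a \<Rightarrow> real) \<Rightarrow> real) \<Rightarrow> ennreal" where
  "Hp_norm \<mu> x1 \<epsilon> \<beta> \<gamma> p f = Lp_norm \<mu> p (grand_max \<mu> x1 \<epsilon> \<beta> \<gamma> f)"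

end

theory Submission
  imports Defs
begin

text \<open>Put \<open>\<delta> = 2 powr (- l)\<close>, and let \<open>\<phi>\<close> be a normalized test function at \<open>x\<close> of scale \<open>r\<close>. If
  \<open>r \<le> \<delta>\<close>, then \<open>\<langle>f, \<phi>\<rangle>\<close> is controlled by the localized maximal function at \<open>x\<close>, and
  \<open>\<langle>S\<^sub>l f, \<phi>\<rangle>\<close> by its infima over \<open>\<delta>\<close>-balls. If \<open>r > \<delta>\<close>, then \<open>\<langle>f - S\<^sub>l f, \<phi>\<rangle> = \<langle>f, \<psi>\<rangle>\<close> with
  \<open>\<psi> = \<phi> - S\<^sub>l\<^sup>* \<phi>\<close>, which is smaller than \<open>\<phi>\<close> by the factor \<open>(\<delta> / r) powr \<beta>\<close> because \<open>S\<^sub>l\<close> preserves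
  constants. A partition of unity at scale \<open>\<delta>\<close> cuts \<open>\<psi>\<close> into multiples of normalized test functions of
  scale \<open>\<delta>\<close>. Both cases bound \<open>\<langle>f - S\<^sub>l f, \<phi>\<rangle>\<close> by a sum over a \<open>\<delta>\<close>-net of infima of the localized
  maximal function. Since \<open>p \<le> 1\<close>, the \<open>p\<close>-th power may be taken term by term, and the supremum over
  \<open>r\<close> may be replaced by the sum over the dyadic scales \<open>2 ^ j * \<delta>\<close>. The integral of this sum converges
  exactly because \<open>\<beta>, \<gamma> > n * (1 / p - 1)\<close>, so that no maximal theorem is needed.\<close>

subsection \<open>Kernels on spaces of homogeneous type\<close>

text \<open>Two points need care because \<open>f\<close> is only a bounded functional. First,
  \<langle>S_l f, \<phi>\<rangle> = \<langle>f, S_l' \<phi>\<rangle>, with S_l' the transpose,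
  interchanges \<open>f\<close> with an integral. It is proved by Riemann sums for integrable \<phi>
  of bounded support. General test functions are limits of such \<phi>, and the integral follows
  this limit because finiteness of the right-hand side makes S_l f integrable against
  \<open>W \<gamma> 1 x1\<close>; if the right-hand side is infinite, there is nothing to show.
  Second, linearity of \<open>f\<close> handles only finitely many pieces, so \<psi> is truncated
  before it is cut up, at the price of an arbitrarily small error.

  The exponents have separate tasks. The p-th power of a term of scale 2^j \<delta> is integrable in
  x because \<gamma> p > n (1 - p). Its integral carries the (1 - p)-th power of the volume at that
  scale, which grows at most like 2^(j n (1 - p)); the gain 2^(-j \<beta> p) beats this because
  \<beta> p > n (1 - p). What remains is a sum over the net of volumes of \<delta>-balls times p-th
  powers of infima, which bounded overlap turns into the integral of the p-th power of the maximal
  function.\<close>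

lemma dyadic_bracket:
  fixes t :: real
  assumes "t \<ge> 1"
  obtains m :: nat where "2 ^ m \<le> t" "t < 2 ^ Suc m"
proof -
  obtain N :: nat where N: "t < 2 ^ N"
    using real_arch_pow[of 2 t] by auto
  define k where "k = (LEAST k. t < 2 ^ k)"
  have k: "t < 2 ^ k" unfolding k_def using N by (rule LeastI)
  have "k \<noteq> 0" using k assms by (cases k) auto
  then obtain m where m: "k = Suc m" by (cases k) auto
  have "\<not> t < 2 ^ m" using not_less_Least[of m "\<lambda>k. t < 2 ^ k"] m k_def by auto
  then show ?thesis using that[of m] k m by auto
qed

text \<open>Divided by \<open>a + b\<close>, both terms lie in [0, 1], where
  \<open>t \<le> t powr p\<close>.\<close>

lemma powr_add_le:
  fixes a b p :: real
  assumes "0 \<le> a" "0 \<le> b" "0 < p" "p \<le> 1"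
  shows "(a + b) powr p \<le> a powr p + b powr p"
proof (cases "a + b = 0")
  case True
  then show ?thesis using assms by simp
next
  case False
  define s where "s = a + b"
  have s: "s > 0" using False assms by (simp add: s_def)
  have le: "t / s \<le> (t / s) powr p" if "0 \<le> t" "t \<le> s" for t
    using powr_mono'[of p 1 "t / s"] that s assms by simp
  have "1 = a / s + b / s" using s by (simp add: s_def flip: add_divide_distrib)
  also have "\<dots> \<le> (a / s) powr p + (b / s) powr p"
    by (intro add_mono le) (use assms s_def in auto)
  also have "\<dots> = (a powr p + b powr p) / s powr p"
    using assms s by (simp add: powr_divide add_divide_distrib)
  finally have "s powr p \<le> a powr p + b powr p" using s by (simp add: field_simps)
  then show ?thesis by (simp add: s_def)
qed

text \<open>With \<open>C1\<close> and \<open>n\<close> fixed as parameters, later constants depend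
  on the space only through them, and are uniform in centres and scales.\<close>

locale doubling_space =
  fixes \<mu> :: "'a::metric_space measure" and n C1 :: real
  assumes sets_eq: "sets \<mu> = sets borel"
    and ball_pos: "\<And>x r. r > 0 \<Longrightarrow> 0 < emeasure \<mu> (ball x r)"
    and ball_finite: "\<And>x r. r > 0 \<Longrightarrow> emeasure \<mu> (ball x r) < \<infinity>"
    and n_pos: "0 < n" and C1_ge: "1 \<le> C1"
    and doubling: "\<And>x t r. t \<ge> 1 \<Longrightarrow> r > 0 \<Longrightarrow>
      measure \<mu> (ball x (t * r)) \<le> C1 * t powr n * measure \<mu> (ball x r)"
begin

lemma space_eq [simp]: "space \<mu> = UNIV"
  using sets_eq_imp_space_eq[OF sets_eq] by simp

lemma ball_sets [measurable]: "ball x r \<in> sets \<mu>"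
  by (simp add: sets_eq)

lemma measurable_borel [simp]: "borel_measurable \<mu> = borel_measurable borel"
  using measurable_cong_sets[OF sets_eq refl] .

lemma V_pos: "r > 0 \<Longrightarrow> V \<mu> r x > 0"
  using ball_pos[of r x] ball_finite[of r x] by (simp add: V_def measure_def enn2real_positive_iff)

lemma emeasure_ball: "r > 0 \<Longrightarrow> emeasure \<mu> (ball x r) = ennreal (V \<mu> r x)"
  unfolding V_def using ball_finite[of r x] by (intro emeasure_eq_ennreal_measure) auto

lemma V_nonneg [simp]: "0 \<le> V \<mu> r x"
  by (simp add: V_def)

lemma ball_fmeasurable: "ball x r \<in> fmeasurable \<mu>"
proof (cases "r > 0")
  case True
  then show ?thesis using ball_finite[of r x] by (intro fmeasurableI) auto
next
  case False
  then have "ball x r = {}" by simp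
  then show ?thesis by (simp only: fmeasurable.empty_sets)
qed

text \<open>The triangle inequality puts \<open>ball x s\<close> inside
  \<open>ball x' (A * r)\<close>, and doubling pays \<open>C1 * A powr n\<close> for shrinking the
  radius to \<open>r\<close>. The factors \<open>C1 * a powr n\<close> with numerical
  \<open>a\<close> below come from here.\<close>

lemma V_shift:
  assumes "r > 0" "A \<ge> 1" "dist x x' + s \<le> A * r"
  shows "V \<mu> s x \<le> C1 * A powr n * V \<mu> r x'"
proof -
  have "ball x s \<subseteq> ball x' (A * r)"
  proof
    fix y assume "y \<in> ball x s"
    then have "dist x y < s" by simp
    moreover have "dist x' y \<le> dist x x' + dist x y" by (metis dist_triangle2 dist_commute)
    ultimately show "y \<in> ball x' (A * r)" using assms by auto
  qed
  then have "V \<mu> s x \<le> measure \<mu> (ball x' (A * r))"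
    unfolding V_def by (intro measure_mono_fmeasurable) (auto intro: ball_fmeasurable)
  also have "\<dots> \<le> C1 * A powr n * V \<mu> r x'"
    unfolding V_def using doubling assms by auto
  finally show ?thesis .
qed

lemma V_mono: "r \<le> s \<Longrightarrow> V \<mu> r x \<le> V \<mu> s x"
  unfolding V_def by (intro measure_mono_fmeasurable) (auto intro: ball_fmeasurable)

text \<open>\<open>W\<close> is comparable with the kernel of the test function spaces, and \<open>W g r x\<close> depends on \<open>y\<close>
  only through the distance to \<open>x\<close>, which gives measurability.\<close>

definition W :: "real \<Rightarrow> real \<Rightarrow> 'a \<Rightarrow> 'a \<Rightarrow> real" where
  "W g r x y = 1 / V \<mu> (r + dist x y) x * (r / (r + dist x y)) powr g"

lemma W_pos: "r > 0 \<Longrightarrow> W g r x y > 0"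
  unfolding W_def using V_pos[of "r + dist x y" x]
  by (smt (verit) divide_pos_pos mult_pos_pos powr_gt_zero zero_le_dist)

lemma W_nonneg [simp]: "0 \<le> W g r x y"
  unfolding W_def by simp

lemma rd_pos: "r > 0 \<Longrightarrow> r + dist x y > 0"
  by (simp add: add_pos_nonneg)

lemma ratio_le1: "r > 0 \<Longrightarrow> r / (r + dist x y) \<le> 1"
  using rd_pos[of r x y] by (simp add: divide_le_eq)

lemma W_split:
  assumes "r > 0"
  shows "W g r x y = W h r x y * (r / (r + dist x y)) powr (g - h)"
  unfolding W_def using assms rd_pos[OF assms, of x y] by (simp flip: powr_add)

lemma W_antimono_exp:
  assumes "r > 0" "h \<le> g"
  shows "W g r x y \<le> W h r x y"
proof -
  have "(r / (r + dist x y)) powr (g - h) \<le> 1"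
    using assms ratio_le1[of r x y] rd_pos[of r x y] by (intro powr_le1) auto
  then show ?thesis
    unfolding W_split[OF assms(1), of g x y h] using W_nonneg mult_left_le by blast
qed

text \<open>The two numbered hypotheses control the two factors of \<open>W\<close>. The first
  compares the balls of radius \<open>r + dist x y\<close> at \<open>x\<close> and
  \<open>r' + dist x' y'\<close> at \<open>x'\<close>, which costs \<open>C1 * A powr n\<close>. The
  second compares the decay ratios, which costs \<open>A powr g\<close>.\<close>

lemma W_compare:
  assumes "r > 0" "r' > 0" "g \<ge> 0" "A \<ge> 1"
    and 1: "dist x x' + (r' + dist x' y') \<le> A * (r + dist x y)"
    and 2: "r * (r' + dist x' y') \<le> A * r' * (r + dist x y)"
  shows "W g r x y \<le> C1 * A powr (n + g) * W g r' x' y'"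
proof -
  define T where "T = r + dist x y"
  define T' where "T' = r' + dist x' y'"
  have T: "T > 0" "T' > 0" using assms rd_pos T_def T'_def by auto
  have "V \<mu> T' x' \<le> C1 * A powr n * V \<mu> T x"
    using assms T by (intro V_shift) (auto simp: T_def T'_def dist_commute)
  then have a: "1 / V \<mu> T x \<le> C1 * A powr n * (1 / V \<mu> T' x')"
    using V_pos[OF T(1), of x] V_pos[OF T(2), of x'] by (simp add: field_simps)
  have "r / T \<le> A * (r' / T')"
    using 2 T by (simp add: T_def[symmetric] T'_def[symmetric] field_simps)
  then have "(r / T) powr g \<le> (A * (r' / T')) powr g"
    using assms T by (intro powr_mono2) auto
  also have "\<dots> = A powr g * (r' / T') powr g"
    using assms T by (intro powr_mult)
  finally have b: "(r / T) powr g \<le> A powr g * (r' / T') powr g" .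
  have "1 / V \<mu> T x * (r / T) powr g
    \<le> (C1 * A powr n * (1 / V \<mu> T' x')) * (A powr g * (r' / T') powr g)"
    using C1_ge by (intro mult_mono a b) auto
  then show ?thesis
    unfolding W_def T_def[symmetric] T'_def[symmetric] by (simp add: powr_add mult_ac)
qed

lemma W_sym:
  assumes "r > 0" "g \<ge> 0"
  shows "W g r x y \<le> C1 * 2 powr (n + g) * W g r y x"
proof (rule W_compare)
  show "r * (r + dist y x) \<le> 2 * r * (r + dist x y)"
    using assms by (simp add: dist_commute)
qed (use assms in \<open>auto simp: dist_commute\<close>)

lemma W_le_V: 
  assumes "r > 0" "g \<ge> 0"
  shows "W g r x y \<le> 1 / V \<mu> r x"
proof -
  have "W g r x y \<le> W 0 r x y" using W_antimono_exp assms by auto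
  also have "\<dots> = 1 / V \<mu> (r + dist x y) x" using assms rd_pos[of r x y] by (simp add: W_def)
  also have "\<dots> \<le> 1 / V \<mu> r x"
    using V_mono[of r "r + dist x y" x] V_pos[OF assms(1), of x] by (simp add: frac_le)
  finally show ?thesis .
qed

lemma W_measurable [measurable]: "W g r x \<in> borel_measurable borel"
proof -
  have "mono (\<lambda>t. V \<mu> t x)" by (simp add: mono_def V_mono)
  then have [measurable]: "(\<lambda>t. V \<mu> t x) \<in> borel_measurable borel" by (rule borel_measurable_mono)
  have [measurable]: "dist x \<in> borel_measurable borel" 
    by (intro borel_measurable_continuous_onI continuous_intros)
  have "(\<lambda>y. V \<mu> (r + dist x y) x) \<in> borel_measurable borel"
    by (rule measurable_compose[of "\<lambda>y. r + dist x y" _ borel]) auto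
  then show ?thesis unfolding W_def[abs_def] by measurable
qed

text \<open>Split into the annuli where \<open>r + dist x y\<close> lies between
  \<open>2 ^ m * r\<close> and \<open>2 ^ Suc m * r\<close>. There \<open>W\<close> to the power
  \<open>p\<close> is at most \<open>c m\<close>, and the annulus lies in a ball of volume
  comparable to that of radius \<open>2 ^ m * r\<close>. Volume times \<open>c m\<close> is thus the
  volume to the power 1 - p times 2^(-m g p). Since volumes grow by at most 2^n per step up to the
  factor \<open>C1\<close>, the sum is dominated by a geometric series of ratio \<open>q\<close>,
  and the hypothesis on \<open>g\<close> says \<open>q < 1\<close>.\<close>

lemma nn_integral_W_powr:
  assumes p: "0 < p" "p \<le> 1" and g: "n * (1 - p) < g * p"
  obtains C where "C > 0"
    "\<And>r x. r > 0 \<Longrightarrow> (\<integral>\<^sup>+ y. ennreal (W g r x y powr p) \<partial>\<mu>) \<le> ennreal (C * V \<mu> r x powr (1 - p))"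
proof -
  define q where "q = 2 powr (n * (1 - p) - g * p)"
  have q: "0 < q" "q < 1" using g powr_less_mono[of "n * (1 - p) - g * p" 0 2] by (auto simp: q_def)
  define K where "K = C1 * 2 powr n * C1 powr (1 - p)"
  have K: "K > 0" using C1_ge by (simp add: K_def)
  have g0: "g \<ge> 0"
  proof -
    have "0 \<le> n * (1 - p)" using p n_pos by auto
    then show ?thesis using g p by (smt (verit) mult_neg_pos)
  qed
  have main: "(\<integral>\<^sup>+ y. ennreal (W g r x y powr p) \<partial>\<mu>) \<le> ennreal (K / (1 - q) * V \<mu> r x powr (1 - p))"
    if r: "r > 0" for r x
  proof -
    define c where "c m = V \<mu> (2 ^ m * r) x powr (- p) * ((1 / 2 ^ m) powr (g * p))" for m :: nat
    have c0: "c m \<ge> 0" for m by (simp add: c_def)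
    have pt: "ennreal (W g r x y powr p)
      \<le> (\<Sum>m. ennreal (c m) * indicator (ball x (2 ^ Suc m * r)) y)" for y
    proof -
      define T where "T = r + dist x y"
      have T: "T > 0" "r \<le> T" using r rd_pos by (auto simp: T_def)
      obtain m where m: "2 ^ m \<le> T / r" "T / r < 2 ^ Suc m"
        using dyadic_bracket[of "T / r"] T r by (auto simp: field_simps)
      have m1: "2 ^ m * r \<le> T" "T < 2 ^ Suc m * r" using m r by (auto simp: field_simps)
      have y: "y \<in> ball x (2 ^ Suc m * r)" using m1 r by (auto simp: T_def)
      have Vm: "V \<mu> (2 ^ m * r) x > 0" using r by (intro V_pos) auto
      have "1 / V \<mu> T x \<le> 1 / V \<mu> (2 ^ m * r) x"
        using V_mono[OF m1(1), of x] Vm by (simp add: frac_le)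
      moreover have "r / T \<le> 1 / 2 ^ m" using m1 T r by (simp add: field_simps)
      then have "(r / T) powr g \<le> (1 / 2 ^ m) powr g"
        using g0 T r by (intro powr_mono2) auto
      ultimately have "W g r x y \<le> (1 / V \<mu> (2 ^ m * r) x) * (1 / 2 ^ m) powr g"
        unfolding W_def T_def[symmetric] by (intro mult_mono) auto
      then have "W g r x y powr p \<le> ((1 / V \<mu> (2 ^ m * r) x) * (1 / 2 ^ m) powr g) powr p"
        using p by (intro powr_mono2) auto
      also have "\<dots> = c m"
        unfolding c_def by (simp add: powr_mult powr_powr powr_divide powr_minus field_simps)
      finally have "ennreal (W g r x y powr p) \<le> ennreal (c m) * indicator (ball x (2 ^ Suc m * r)) y"
        using y by (simp add: ennreal_leI)
      also have "\<dots> \<le> (\<Sum>m. ennreal (c m) * indicator (ball x (2 ^ Suc m * r)) y)"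
        using sum_le_suminf[of "\<lambda>m. ennreal (c m) * indicator (ball x (2 ^ Suc m * r)) y" "{m}"]
        by (auto simp del: mem_ball sum_mult_indicator power_Suc)
      finally show ?thesis .
    qed
    have cV: "c m * V \<mu> (2 ^ Suc m * r) x \<le> K * V \<mu> r x powr (1 - p) * q ^ m" for m
    proof -
      define v where "v = V \<mu> (2 ^ m * r) x"
      have v: "v > 0" using r by (auto simp: v_def intro: V_pos)
      have "V \<mu> (2 ^ Suc m * r) x \<le> C1 * 2 powr n * v"
        unfolding v_def using r by (intro V_shift) auto
      then have "c m * V \<mu> (2 ^ Suc m * r) x \<le> c m * (C1 * 2 powr n * v)"
        using c0 by (intro mult_left_mono) auto
      also have "\<dots> = C1 * 2 powr n * (v powr (1 - p)) * (1 / 2 ^ m) powr (g * p)"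
        unfolding c_def v_def[symmetric] using v by (simp add: powr_diff powr_minus field_simps)
      also have "\<dots> \<le> C1 * 2 powr n * ((C1 * (2 ^ m) powr n * V \<mu> r x) powr (1 - p)) * (1 / 2 ^ m)
        powr (g * p)"
      proof -
        have "v \<le> C1 * (2 ^ m) powr n * V \<mu> r x"
          unfolding v_def using r by (intro V_shift) auto
        then have "v powr (1 - p) \<le> (C1 * (2 ^ m) powr n * V \<mu> r x) powr (1 - p)"
          using v p by (intro powr_mono2) auto
        then show ?thesis using C1_ge by (intro mult_right_mono mult_left_mono) auto
      qed
      also have "\<dots> = K * V \<mu> r x powr (1 - p) * (((2 ^ m) powr n) powr (1 - p) * (1 / 2 ^ m) powr
        (g * p))"
        using C1_ge V_nonneg by (simp add: K_def powr_mult mult_ac)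
      also have "((2 ^ m) powr n) powr (1 - p) * (1 / 2 ^ m) powr (g * p) = q ^ m"
      proof -
        have "(2::real) ^ m = 2 powr m" by (simp add: powr_realpow)
        then have "((2 ^ m) powr n) powr (1 - p) * (1 / 2 ^ m) powr (g * p)
            = 2 powr (m * n * (1 - p)) * 2 powr (- (m * (g * p)))"
          by (simp add: powr_powr powr_divide powr_minus field_simps)
        also have "\<dots> = (2 powr (n * (1 - p) - g * p)) powr m"
          by (simp add: powr_powr algebra_simps flip: powr_add)
        also have "\<dots> = q ^ m" using q by (simp add: q_def powr_realpow)
        finally show ?thesis .
      qed
      finally show ?thesis .
    qed
    have "(\<integral>\<^sup>+ y. ennreal (W g r x y powr p) \<partial>\<mu>)
        \<le> (\<integral>\<^sup>+ y. (\<Sum>m. ennreal (c m) * indicator (ball x (2 ^ Suc m * r)) y) \<partial>\<mu>)"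
      by (intro nn_integral_mono pt)
    also have "\<dots> = (\<Sum>m. \<integral>\<^sup>+ y. ennreal (c m) * indicator (ball x (2 ^ Suc m * r)) y \<partial>\<mu>)"
      by (intro nn_integral_suminf borel_measurable_times_ennreal borel_measurable_indicator
        ball_sets) auto
    also have "\<dots> = (\<Sum>m. ennreal (c m * V \<mu> (2 ^ Suc m * r) x))"
      using r c0 by (intro suminf_cong) (simp add: nn_integral_cmult_indicator emeasure_ball
        ennreal_mult del: power_Suc)
    also have "\<dots> \<le> (\<Sum>m. ennreal (K * V \<mu> r x powr (1 - p) * q ^ m))"
      by (intro suminf_le ennreal_leI cV) auto
    also have "\<dots> = ennreal (\<Sum>m. K * V \<mu> r x powr (1 - p) * q ^ m)"
      using q K by (intro suminf_ennreal2 summable_mult summable_geometric mult_nonneg_nonneg) auto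
    also have "(\<Sum>m. K * V \<mu> r x powr (1 - p) * q ^ m) = K / (1 - q) * V \<mu> r x powr (1 - p)"
      using q by (subst suminf_mult) (auto simp: suminf_geometric summable_geometric)
    finally show ?thesis .
  qed
  show ?thesis
    by (rule that[of "K / (1 - q)"]) (use main K q in auto)
qed

lemma integral_W:
  assumes "g > 0"
  obtains C where "C > 0" "\<And>r x. r > 0 \<Longrightarrow> integrable \<mu> (W g r x) \<and> (LINT y|\<mu>. W g r x y) \<le> C"
proof -
  obtain C where C: "C > 0"
    "\<And>r x. r > 0 \<Longrightarrow> (\<integral>\<^sup>+ y. ennreal (W g r x y powr 1) \<partial>\<mu>) \<le> ennreal (C * V \<mu> r x powr (1 - 1))"
    using nn_integral_W_powr[of 1 g] assms by auto
  have "integrable \<mu> (W g r x) \<and> (LINT y|\<mu>. W g r x y) \<le> C" if r: "r > 0" for r x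
  proof -
    have b: "(\<integral>\<^sup>+ y. ennreal (W g r x y) \<partial>\<mu>) \<le> ennreal C"
      using C(2)[OF r, of x] V_pos[OF r, of x] by simp
    then have i: "integrable \<mu> (W g r x)"
      by (intro integrableI_bounded) (auto intro: le_less_trans)
    moreover have "(LINT y|\<mu>. W g r x y) \<le> C"
    proof -
      have "ennreal (LINT y|\<mu>. W g r x y) \<le> ennreal C"
        using b nn_integral_eq_integral[OF i] by simp
      then show ?thesis using C(1) by (simp add: ennreal_le_iff)
    qed
    ultimately show ?thesis by simp
  qed
  then show ?thesis using that C(1) by blast
qed

end

subsection \<open>Test functions\<close>

definition cutoff :: "'a::metric_space \<Rightarrow> real \<Rightarrow> 'a \<Rightarrow> real" where
  "cutoff x \<rho> y = max 0 (min 1 (2 - dist x y / \<rho>))"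

lemma cutoff_range: "0 \<le> cutoff x \<rho> y" "cutoff x \<rho> y \<le> 1"
  by (auto simp: cutoff_def)

lemma cutoff_eq_0: "\<rho> > 0 \<Longrightarrow> 2 * \<rho> \<le> dist x y \<Longrightarrow> cutoff x \<rho> y = 0"
  by (simp add: cutoff_def field_simps)

lemma cutoff_eq_1: "\<rho> > 0 \<Longrightarrow> dist x y \<le> \<rho> \<Longrightarrow> cutoff x \<rho> y = 1"
  by (simp add: cutoff_def field_simps)

lemma cutoff_lipschitz:
  assumes "\<rho> > 0"
  shows "\<bar>cutoff x \<rho> y - cutoff x \<rho> z\<bar> \<le> dist y z / \<rho>"
proof -
  have "\<bar>dist x y / \<rho> - dist x z / \<rho>\<bar> \<le> dist y z / \<rho>"
  proof -
    have "\<bar>dist x y - dist x z\<bar> \<le> dist y z"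
      by (metis abs_dist_diff_le dist_commute)
    then show ?thesis
      using assms by (simp add: divide_right_mono flip: diff_divide_distrib)
  qed
  then show ?thesis unfolding cutoff_def by linarith
qed

context doubling_space
begin

text \<open>This is \<open>test_bound\<close> up to constants, with \<open>W\<close> as kernel. The
  sign of \<open>C\<close> need not be recorded: for \<open>r > 0\<close> it follows from the size
  bound at the centre (\<open>tb_const_nonneg\<close>).\<close>

definition tb :: "'a \<Rightarrow> real \<Rightarrow> real \<Rightarrow> real \<Rightarrow> real \<Rightarrow> ('a \<Rightarrow> real) \<Rightarrow> bool" where
  "tb x r b g C f \<longleftrightarrow> (\<forall>y. \<bar>f y\<bar> \<le> C * W g r x y) \<and>
     (\<forall>y z. dist y z \<le> (r + dist x y) / 2 \<longrightarrow>
        \<bar>f z - f y\<bar> \<le> C * (dist y z / (r + dist x y)) powr b * W g r x y)"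

lemma tbI:
  assumes "\<And>y. \<bar>f y\<bar> \<le> C * W g r x y"
    "\<And>y z. dist y z \<le> (r + dist x y) / 2 \<Longrightarrow>
      \<bar>f z - f y\<bar> \<le> C * (dist y z / (r + dist x y)) powr b * W g r x y"
  shows "tb x r b g C f"
  using assms by (simp add: tb_def)

lemma tb_size: "tb x r b g C f \<Longrightarrow> \<bar>f y\<bar> \<le> C * W g r x y"
  by (simp add: tb_def)

lemma tb_reg: "tb x r b g C f \<Longrightarrow> dist y z \<le> (r + dist x y) / 2 \<Longrightarrow>
    \<bar>f z - f y\<bar> \<le> C * (dist y z / (r + dist x y)) powr b * W g r x y"
  by (simp add: tb_def)

lemma tb_const_nonneg:
  assumes "r > 0" "tb x r b g C f"
  shows "C \<ge> 0"
proof -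
  have "0 \<le> C * W g r x x" using tb_size[OF assms(2), of x] by linarith
  then show ?thesis using W_pos[OF assms(1), of g x x] by (simp add: zero_le_mult_iff)
qed

text \<open>The larger of \<open>r\<close> and \<open>dist x y\<close> is at least half of their
  sum, so by doubling the larger of the two volumes controls the volume of radius
  \<open>r + dist x y\<close>.\<close>

lemma kernel_le_W:
  assumes "r > 0"
  shows "1 / (V \<mu> r x + Vxy \<mu> x y) * (r / (r + dist x y)) powr g \<le> C1 * 2 powr n * W g r x y"
proof -
  define T where "T = r + dist x y"
  have T: "T > 0" using assms rd_pos T_def by auto
  have "V \<mu> T x \<le> C1 * 2 powr n * (V \<mu> r x + V \<mu> (dist x y) x)"
  proof (cases "dist x y \<le> r")
    case True
    then have "V \<mu> T x \<le> C1 * 2 powr n * V \<mu> r x"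
      using assms by (intro V_shift) (auto simp: T_def)
    also have "\<dots> \<le> C1 * 2 powr n * (V \<mu> r x + V \<mu> (dist x y) x)"
      using C1_ge by (intro mult_left_mono) auto
    finally show ?thesis .
  next
    case False
    then have "V \<mu> T x \<le> C1 * 2 powr n * V \<mu> (dist x y) x"
      using assms by (intro V_shift) (auto simp: T_def)
    also have "\<dots> \<le> C1 * 2 powr n * (V \<mu> r x + V \<mu> (dist x y) x)"
      using C1_ge by (intro mult_left_mono) auto
    finally show ?thesis .
  qed
  then have "1 / (V \<mu> r x + V \<mu> (dist x y) x) \<le> C1 * 2 powr n * (1 / V \<mu> T x)"
    using V_pos[OF T, of x] V_pos[OF assms, of x] V_nonneg[of "dist x y" x]
    by (simp add: divide_simps add_pos_nonneg)
  then have "1 / (V \<mu> r x + V \<mu> (dist x y) x) * (r / T) powr g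
    \<le> C1 * 2 powr n * (1 / V \<mu> T x) * (r / T) powr g"
    by (rule mult_right_mono) simp
  moreover have "Vxy \<mu> x y = V \<mu> (dist x y) x" by (simp add: Vxy_def V_def)
  ultimately show ?thesis unfolding W_def T_def by (simp add: mult_ac)
qed

lemma W_le_kernel:
  assumes "r > 0"
  shows "W g r x y \<le> 2 * (1 / (V \<mu> r x + Vxy \<mu> x y) * (r / (r + dist x y)) powr g)"
proof -
  define T where "T = r + dist x y"
  have T: "T > 0" using assms rd_pos T_def by auto
  have "V \<mu> r x \<le> V \<mu> T x" "V \<mu> (dist x y) x \<le> V \<mu> T x"
    using assms by (auto intro!: V_mono simp: T_def)
  then have "1 / V \<mu> T x \<le> 2 * (1 / (V \<mu> r x + V \<mu> (dist x y) x))"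
    using V_pos[OF T, of x] V_pos[OF assms, of x] V_nonneg[of "dist x y" x]
    by (simp add: divide_simps add_pos_nonneg)
  then have "1 / V \<mu> T x * (r / T) powr g \<le> 2 * (1 / (V \<mu> r x + V \<mu> (dist x y) x)) * (r / T) powr g"
    by (rule mult_right_mono) simp
  moreover have "Vxy \<mu> x y = V \<mu> (dist x y) x" by (simp add: Vxy_def V_def)
  ultimately show ?thesis unfolding W_def T_def by (simp add: mult_ac)
qed

lemma tb_of_test_bound:
  assumes "r > 0" "test_bound \<mu> x r b g C f"
  shows "tb x r b g (C1 * 2 powr n * C) f"
proof (rule tbI)
  have C: "C \<ge> 0" using assms(2) by (simp add: test_bound_def)
  fix y
  have "\<bar>f y\<bar> \<le> C * (1 / (V \<mu> r x + Vxy \<mu> x y) * (r / (r + dist x y)) powr g)"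
    using assms(2) by (simp add: test_bound_def mult_ac)
  also have "\<dots> \<le> C * (C1 * 2 powr n * W g r x y)"
    using C by (intro mult_left_mono kernel_le_W assms)
  finally show "\<bar>f y\<bar> \<le> C1 * 2 powr n * C * W g r x y" by (simp add: mult_ac)
next
  have C: "C \<ge> 0" using assms(2) by (simp add: test_bound_def)
  fix y z assume "dist y z \<le> (r + dist x y) / 2"
  then have "\<bar>f z - f y\<bar> \<le> C * (dist y z / (r + dist x y)) powr b *
      (1 / (V \<mu> r x + Vxy \<mu> x y) * (r / (r + dist x y)) powr g)"
    using assms(2) by (simp add: test_bound_def mult.assoc)
  also have "\<dots> \<le> C * (dist y z / (r + dist x y)) powr b * (C1 * 2 powr n * W g r x y)"
    using C by (intro mult_left_mono kernel_le_W assms) auto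
  finally show "\<bar>f z - f y\<bar> \<le> C1 * 2 powr n * C * (dist y z / (r + dist x y)) powr b * W g r x y"
    by (simp add: mult_ac)
qed

lemma test_bound_of_tb:
  assumes "r > 0" "tb x r b g C f"
  shows "test_bound \<mu> x r b g (2 * C) f"
proof -
  have C: "C \<ge> 0" using tb_const_nonneg assms by blast
  have "\<bar>f y\<bar> \<le> 2 * C * (1 / (V \<mu> r x + Vxy \<mu> x y)) * (r / (r + dist x y)) powr g" for y
  proof -
    have "\<bar>f y\<bar> \<le> C * (2 * (1 / (V \<mu> r x + Vxy \<mu> x y) * (r / (r + dist x y)) powr g))"
      by (rule order_trans[OF tb_size[OF assms(2)] mult_left_mono[OF W_le_kernel[OF assms(1)] C]])
    then show ?thesis by (simp add: mult_ac)
  qed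
  moreover have "\<bar>f z - f y\<bar> \<le> 2 * C * (dist y z / (r + dist x y)) powr b
           * (1 / (V \<mu> r x + Vxy \<mu> x y)) * (r / (r + dist x y)) powr g"
    if "dist y z \<le> (r + dist x y) / 2" for y z
  proof -
    have "\<bar>f z - f y\<bar> \<le> C * (dist y z / (r + dist x y)) powr b *
        (2 * (1 / (V \<mu> r x + Vxy \<mu> x y) * (r / (r + dist x y)) powr g))"
      by (rule order_trans[OF tb_reg[OF assms(2) that] mult_left_mono[OF W_le_kernel[OF assms(1)]]])
        (use C in auto)
    then show ?thesis by (simp add: mult_ac)
  qed
  ultimately show ?thesis using C unfolding test_bound_def by auto
qed

lemma tb_mono:
  assumes "tb x r b g C f" "C \<le> C'"
  shows "tb x r b g C' f"
proof (rule tbI)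
  show "\<bar>f y\<bar> \<le> C' * W g r x y" for y
    using tb_size[OF assms(1), of y] mult_right_mono[OF assms(2) W_nonneg[of g r x y]] by linarith
  show "\<bar>f z - f y\<bar> \<le> C' * (dist y z / (r + dist x y)) powr b * W g r x y"
    if "dist y z \<le> (r + dist x y) / 2" for y z
    by (rule order_trans[OF tb_reg[OF assms(1) that]]) (intro mult_right_mono assms(2); simp)
qed

lemma tb_add:
  assumes "tb x r b g C f" "tb x r b g C' h"
  shows "tb x r b g (C + C') (\<lambda>y. f y + h y)"
proof (rule tbI)
  show "\<bar>f y + h y\<bar> \<le> (C + C') * W g r x y" for y
    using tb_size[OF assms(1), of y] tb_size[OF assms(2), of y] by (simp add: distrib_right)
  show "\<bar>f z + h z - (f y + h y)\<bar> \<le> (C + C') * (dist y z / (r + dist x y)) powr b * W g r x y"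
    if "dist y z \<le> (r + dist x y) / 2" for y z
    using tb_reg[OF assms(1) that] tb_reg[OF assms(2) that] by (simp add: distrib_right)
qed

lemma tb_scale:
  assumes "tb x r b g C f"
  shows "tb x r b g (\<bar>c\<bar> * C) (\<lambda>y. c * f y)"
proof (rule tbI)
  show "\<bar>c * f y\<bar> \<le> \<bar>c\<bar> * C * W g r x y" for y
    using mult_left_mono[OF tb_size[OF assms(1), of y] abs_ge_zero[of c]]
      by (simp add: abs_mult mult.assoc)
  show "\<bar>c * f z - c * f y\<bar> \<le> \<bar>c\<bar> * C * (dist y z / (r + dist x y)) powr b * W g r x y"
    if "dist y z \<le> (r + dist x y) / 2" for y z
    using mult_left_mono[OF tb_reg[OF assms(1) that] abs_ge_zero[of c]]
    by (simp add: abs_mult mult.assoc flip: right_diff_distrib)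
qed

lemma tb_diff:
  assumes "tb x r b g C f" "tb x r b g C' h"
  shows "tb x r b g (C + C') (\<lambda>y. f y - h y)"
  using tb_add[OF assms(1) tb_scale[OF assms(2), of "- 1"]] by simp

lemma tb_antimono_exp:
  assumes "r > 0" "tb x r b g C f" "b' \<le> b" "g' \<le> g"
  shows "tb x r b' g' C f"
proof (rule tbI)
  have C: "C \<ge> 0" using tb_const_nonneg assms by blast
  show "\<bar>f y\<bar> \<le> C * W g' r x y" for y
    using tb_size[OF assms(2), of y] mult_left_mono[OF W_antimono_exp[OF assms(1,4), of x y] C]
      by linarith
  fix y z assume d: "dist y z \<le> (r + dist x y) / 2"
  have T: "r + dist x y > 0" by (rule rd_pos[OF assms(1)])
  have "(dist y z / (r + dist x y)) powr b \<le> (dist y z / (r + dist x y)) powr b'"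
    using d T by (intro powr_mono' assms) (auto simp: field_simps)
  then have "C * (dist y z / (r + dist x y)) powr b * W g r x y
      \<le> C * (dist y z / (r + dist x y)) powr b' * W g' r x y"
    using C by (intro mult_mono W_antimono_exp assms) auto
  then show "\<bar>f z - f y\<bar> \<le> C * (dist y z / (r + dist x y)) powr b' * W g' r x y"
    using tb_reg[OF assms(2) d] by linarith
qed

lemma tb_continuous:
  assumes "r > 0" "b > 0" "tb x r b g C f"
  shows "continuous_on UNIV f"
proof (rule continuous_at_imp_continuous_on, rule ballI)
  fix y
  define T where "T = r + dist x y"
  have T: "T > 0" using assms rd_pos T_def by auto
  have "((\<lambda>z. C * (dist y z / T) powr b * W g r x y) \<longlongrightarrow> C * (dist y y / T) powr b * W g r x y) (at y)"
    using assms T by (intro tendsto_intros tendsto_powr') auto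
  then have lim: "((\<lambda>z. C * (dist y z / T) powr b * W g r x y) \<longlongrightarrow> 0) (at y)"
    using assms by simp
  have "((\<lambda>z. f z - f y) \<longlongrightarrow> 0) (at y)"
  proof (rule Lim_null_comparison[OF _ lim])
    have "\<forall>\<^sub>F z in at y. dist y z \<le> T / 2"
      using T by (auto simp: eventually_at dist_commute intro!: exI[of _ "T / 2"])
    then show "\<forall>\<^sub>F z in at y. norm (f z - f y) \<le> C * (dist y z / T) powr b * W g r x y"
      by eventually_elim (use tb_reg[OF assms(3)] in \<open>auto simp: T_def\<close>)
  qed
  then show "isCont f y" by (simp add: isCont_def LIM_zero_iff)
qed

lemma tb_measurable:
  assumes "r > 0" "b > 0" "tb x r b g C f"
  shows "f \<in> borel_measurable borel"
  by (rule borel_measurable_continuous_onI[OF tb_continuous[OF assms]])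

lemma tb_bounded:
  assumes "r > 0" "g \<ge> 0" "tb x r b g C f"
  shows "\<bar>f y\<bar> \<le> C / V \<mu> r x"
  using tb_size[OF assms(3), of y] mult_left_mono[OF W_le_V[OF assms(1,2), of x y]
    tb_const_nonneg[OF assms(1,3)]]
  by simp

lemma W_nearby:
  assumes "r > 0" "g \<ge> 0" "dist y z \<le> (r + dist x y) / 2"
  shows "W g r x z \<le> C1 * 2 powr (n + g) * W g r x y"
proof (rule W_compare)
  have "dist x y \<le> dist x z + dist y z" by (metis dist_triangle2 dist_commute)
  then have *: "r + dist x y \<le> 2 * (r + dist x z)" using assms by argo
  then show "dist x x + (r + dist x y) \<le> 2 * (r + dist x z)" by simp
  show "r * (r + dist x y) \<le> 2 * r * (r + dist x z)" using * assms by simp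
qed (use assms in auto)

text \<open>Price of moving a test function to another centre and scale, all ratios being at most
  \<open>a\<close>. The first factor compares the kernels (\<open>W_change\<close>),
  \<open>4 * a\<close> compares the scaled distances, and the last factor pays for pairs that are
  close relative to the new scale but not relative to the old one.\<close>

definition chg_const :: "real \<Rightarrow> real \<Rightarrow> real" where
  "chg_const a g = C1 * (3 * a\<^sup>2) powr (n + g) * (4 * a) * (1 + C1 * 2 powr (n + g))"

lemma chg_const_pos: "a \<ge> 1 \<Longrightarrow> chg_const a g > 0"
  unfolding chg_const_def using C1_ge by (intro mult_pos_pos add_pos_nonneg) auto

text \<open>\<open>3 * a\<^sup>2\<close> serves both hypotheses of \<open>W_compare\<close>: the
  first needs \<open>3 * a\<close>, the second \<open>2 * a\<^sup>2\<close>.\<close>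

lemma W_change:
  assumes "r > 0" "r' > 0" "a \<ge> 1" "r \<le> a * r'" "r' \<le> a * r" "dist x x' \<le> a * r" "dist x x' \<le> a * r'"
    and "g \<ge> 0"
  shows "W g r x y \<le> C1 * (3 * a\<^sup>2) powr (n + g) * W g r' x' y"
proof (rule W_compare)
  define T where "T = r + dist x y"
  define T' where "T' = r' + dist x' y"
  have "dist x' y \<le> dist x x' + dist x y" by (metis dist_triangle2 dist_commute)
  then have "T' \<le> 2 * (a * r) + dist x y" using assms by (auto simp: T'_def)
  also have "dist x y \<le> 2 * (a * dist x y)"
    using mult_mono[of 1 "2 * a" "dist x y" "dist x y"] assms by simp
  finally have T': "T' \<le> 2 * a * T" by (simp add: T_def algebra_simps)
  have T: "T \<ge> r" "T > 0" "T' > 0" using assms rd_pos T_def T'_def by auto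
  have a2: "a \<le> a\<^sup>2" using assms by (simp add: power2_eq_square)
  have "a * r \<le> a * T" using T assms by (intro mult_left_mono) auto
  then have "dist x x' + T' \<le> 3 * a * T" using T' assms(6) by linarith
  also have "\<dots> \<le> 3 * a\<^sup>2 * T" using a2 T by (intro mult_right_mono) auto
  finally show "dist x x' + (r' + dist x' y) \<le> 3 * a\<^sup>2 * (r + dist x y)" by (simp add: T_def T'_def)
  have "r * T' \<le> (a * r') * (2 * a * T)" using T' T assms by (intro mult_mono) auto
  also have "\<dots> = 2 * (a\<^sup>2 * r' * T)" by (simp add: power2_eq_square)
  also have "\<dots> \<le> 3 * (a\<^sup>2 * r' * T)" using assms T by (intro mult_right_mono) auto
  finally show "r * (r' + dist x' y) \<le> 3 * a\<^sup>2 * r' * (r + dist x y)" by (simp add: T_def T'_def)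
  show "1 \<le> 3 * a\<^sup>2" using a2 assms by linarith
qed (use assms in auto)

lemma tb_change:
  assumes r: "r > 0" "r' > 0" "a \<ge> 1" "r \<le> a * r'" "r' \<le> a * r" "dist x x' \<le> a * r" "dist x x' \<le> a * r'"
    and bg: "0 < b" "b \<le> 1" "g \<ge> 0" and f: "tb x r b g C f"
  shows "tb x' r' b g (chg_const a g * C) f"
proof -
  define A where "A = C1 * (3 * a\<^sup>2) powr (n + g)"
  define K where "K = C1 * 2 powr (n + g)"
  have A: "A \<ge> 0" and K: "K \<ge> 0" using C1_ge by (auto simp: A_def K_def)
  have chg_const: "chg_const a g = A * (4 * a) * (1 + K)" by (simp add: chg_const_def A_def K_def)
  have C: "C \<ge> 0" using tb_const_nonneg r f by blast
  have WA: "W g r x y \<le> A * W g r' x' y" for y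
    unfolding A_def using W_change r bg by blast
  have size: "\<bar>f y\<bar> \<le> A * C * W g r' x' y" for y
    using tb_size[OF f, of y] mult_left_mono[OF WA[of y] C] by (simp add: mult_ac)
  show ?thesis
  proof (rule tbI)
    have "A * C \<le> chg_const a g * C"
    proof -
      have "1 * 1 \<le> (4 * a) * (1 + K)" using r K by (intro mult_mono) auto
      then have "A * 1 \<le> A * ((4 * a) * (1 + K))" using A by (intro mult_left_mono) auto
      then show ?thesis unfolding chg_const using C by (intro mult_right_mono) (auto simp: mult_ac)
    qed
    then show "\<bar>f y\<bar> \<le> chg_const a g * C * W g r' x' y" for y
      using size[of y] mult_right_mono[OF _ W_nonneg[of g r' x' y]] by (smt (verit))
  next
    fix y z assume d: "dist y z \<le> (r' + dist x' y) / 2"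
    define T where "T = r + dist x y"
    define T' where "T' = r' + dist x' y"
    define w where "w = W g r' x' y"
    have w: "w \<ge> 0" by (simp add: w_def)
    have T: "T > 0" "T' > 0" using r rd_pos T_def T'_def by auto
    have T'T: "T' \<le> 2 * a * T"
    proof -
      have "dist x' y \<le> dist x x' + dist x y" by (metis dist_triangle2 dist_commute)
      then have "T' \<le> 2 * (a * r) + dist x y" using r by (auto simp: T'_def)
      also have "dist x y \<le> 2 * (a * dist x y)"
        using mult_mono[of 1 "2 * a" "dist x y" "dist x y"] r by simp
      finally show ?thesis by (simp add: T_def algebra_simps)
    qed
    define \<rho> where "\<rho> = (dist y z / T') powr b"
    have \<rho>: "\<rho> \<ge> 0" by (simp add: \<rho>_def)
    have pb: "(4 * a) powr b \<le> 4 * a"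
      using powr_mono[of b 1 "4 * a"] r bg by simp
    have "\<bar>f z - f y\<bar> \<le> A * (4 * a) * (1 + K) * C * \<rho> * w"
    proof (cases "dist y z \<le> T / 2")
      case True
      have "dist y z / T \<le> 2 * a * (dist y z / T')"
      proof -
        have "dist y z * T' \<le> dist y z * (2 * a * T)"
          by (intro mult_left_mono T'T) simp
        then show ?thesis using T by (simp add: field_simps)
      qed
      also have "\<dots> \<le> 4 * a * (dist y z / T')" using r T by (intro mult_right_mono) auto
      finally have "(dist y z / T) powr b \<le> (4 * a * (dist y z / T')) powr b"
        using T bg by (intro powr_mono2) auto
      also have "\<dots> = (4 * a) powr b * \<rho>"
        unfolding \<rho>_def by (rule powr_mult)
      also have "\<dots> \<le> 4 * a * \<rho>" using pb \<rho> by (rule mult_right_mono)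
      finally have 1: "(dist y z / T) powr b \<le> 4 * a * \<rho>" .
      have "\<bar>f z - f y\<bar> \<le> C * (dist y z / T) powr b * W g r x y"
        using tb_reg[OF f] True unfolding T_def by blast
      also have "\<dots> \<le> C * (4 * a * \<rho>) * (A * w)"
        using C 1 WA[of y] r \<rho> by (intro mult_mono) (auto simp: w_def)
      also have "\<dots> = (A * (4 * a) * C * \<rho> * w) * 1" by (simp add: mult_ac)
      also have "\<dots> \<le> (A * (4 * a) * C * \<rho> * w) * (1 + K)"
        using A C \<rho> w r K by (intro mult_left_mono mult_nonneg_nonneg) auto
      finally show ?thesis by (simp add: mult_ac)
    next
      \<comment> \<open>Here the old regularity condition says nothing about the pair. But then the
        distance is at least a fixed fraction of \<open>T'\<close>, so the factor
        \<open>\<rho>\<close> is bounded below and the size bounds at \<open>y\<close> and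
        \<open>z\<close> suffice.\<close>
      case False
      then have "2 * a * T \<le> 2 * a * (2 * dist y z)" using r by (intro mult_left_mono) auto
      then have "T' \<le> 4 * a * dist y z" using T'T by linarith
      then have "1 \<le> 4 * a * (dist y z / T')" using T by (simp add: field_simps)
      then have "1 \<le> (4 * a * (dist y z / T')) powr b" using bg by (simp add: ge_one_powr_ge_zero)
      also have "\<dots> = (4 * a) powr b * \<rho>"
        unfolding \<rho>_def by (rule powr_mult)
      also have "\<dots> \<le> 4 * a * \<rho>" using pb \<rho> by (rule mult_right_mono)
      finally have 1: "1 \<le> 4 * a * \<rho>" .
      have "W g r' x' z \<le> K * w" unfolding K_def w_def using r bg d by (intro W_nearby)
      then have "A * C * W g r' x' z \<le> A * C * (K * w)" using A C by (intro mult_left_mono) auto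
      then have "\<bar>f z - f y\<bar> \<le> A * C * (1 + K) * w"
        using size[of z] size[of y] unfolding w_def[symmetric] by (simp add: algebra_simps)
      also have "\<dots> \<le> A * C * (1 + K) * w * (4 * a * \<rho>)"
        using mult_left_mono[OF 1, of "A * C * (1 + K) * w"] A C K w by simp
      finally show ?thesis by (simp add: mult_ac)
    qed
    then show "\<bar>f z - f y\<bar> \<le> chg_const a g * C * (dist y z / (r' + dist x' y)) powr b * W g r' x' y"
      by (simp add: chg_const \<rho>_def T'_def w_def)
  qed
qed

section \<open>Localization of test functions by Lipschitz factors\<close>

text \<open>The cutoff is Lipschitz at scale \<open>\<rho>\<close>, whereas regularity is measured
  relative to \<open>r + dist x y\<close>. The two fit because the cutoff can only change between
  admissible \<open>y\<close> and \<open>z\<close> if \<open>r + dist x y \<le> 6 * \<rho>\<close>.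
  A Lipschitz bound is stronger than exponent \<open>b\<close> as the ratio of distances is at most
  1. The factor is 7 = 1 + 6.\<close>

lemma tb_cutoff:
  assumes r: "0 < r" "r \<le> \<rho>" and b: "0 < b" "b \<le> 1" and f: "tb x r b g C f"
  shows "tb x r b g (7 * C) (\<lambda>y. f y * cutoff x \<rho> y)"
proof (rule tbI)
  have C: "C \<ge> 0" using tb_const_nonneg r f by blast
  note c = cutoff_range[of x \<rho>]
  show "\<bar>f y * cutoff x \<rho> y\<bar> \<le> 7 * C * W g r x y" for y
  proof -
    have "\<bar>f y * cutoff x \<rho> y\<bar> \<le> \<bar>f y\<bar> * 1"
      unfolding abs_mult using c[of y] by (intro mult_left_mono) auto
    also have "\<dots> \<le> C * W g r x y" using tb_size[OF f] by simp
    also have "\<dots> \<le> 7 * C * W g r x y" using C by (intro mult_right_mono) auto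
    finally show ?thesis .
  qed
  fix y z assume d: "dist y z \<le> (r + dist x y) / 2"
  define T where "T = r + dist x y"
  have T: "T > 0" using r rd_pos T_def by auto
  define w where "w = W g r x y"
  define q where "q = (dist y z / T) powr b"
  have w: "w \<ge> 0" "q \<ge> 0" by (auto simp: w_def q_def)
  have "\<bar>cutoff x \<rho> z - cutoff x \<rho> y\<bar> \<le> 6 * q"
  proof (cases "dist x y \<ge> 2 * \<rho> \<and> dist x z \<ge> 2 * \<rho>")
    case True
    then show ?thesis using cutoff_eq_0[of \<rho> x y] cutoff_eq_0[of \<rho> x z] r w by auto
  next
    case False
    have "dist x y \<le> dist x z + dist y z" by (metis dist_triangle2 dist_commute)
    then have "T \<le> 6 * \<rho>" using False d r unfolding T_def by argo
    then have "dist y z * T \<le> dist y z * (6 * \<rho>)" by (intro mult_left_mono) auto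
    then have "dist y z / \<rho> \<le> 6 * (dist y z / T)" using T r by (simp add: field_simps)
    also have "dist y z / T \<le> q"
      using powr_mono'[of b 1 "dist y z / T"] d T b unfolding q_def T_def by (simp add: field_simps)
    finally have "dist y z / \<rho> \<le> 6 * q" by simp
    then show ?thesis using cutoff_lipschitz[of \<rho> x z y] r by (simp add: dist_commute)
  qed
  then have "\<bar>f y\<bar> * \<bar>cutoff x \<rho> z - cutoff x \<rho> y\<bar> \<le> (C * w) * (6 * q)"
    using tb_size[OF f, of y] C w unfolding w_def by (intro mult_mono) auto
  moreover have "\<bar>f z - f y\<bar> * \<bar>cutoff x \<rho> z\<bar> \<le> (C * q * w) * 1"
    using tb_reg[OF f d] c[of z] C w unfolding w_def q_def T_def by (intro mult_mono) auto
  moreover have "\<bar>f z * cutoff x \<rho> z - f y * cutoff x \<rho> y\<bar>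
     \<le> \<bar>f z - f y\<bar> * \<bar>cutoff x \<rho> z\<bar> + \<bar>f y\<bar> * \<bar>cutoff x \<rho> z - cutoff x \<rho> y\<bar>"
  proof -
    have "f z * cutoff x \<rho> z - f y * cutoff x \<rho> y
      = (f z - f y) * cutoff x \<rho> z + f y * (cutoff x \<rho> z - cutoff x \<rho> y)" by (simp add: algebra_simps)
    then show ?thesis by (metis abs_mult abs_triangle_ineq)
  qed
  ultimately have "\<bar>f z * cutoff x \<rho> z - f y * cutoff x \<rho> y\<bar> \<le> 7 * C * q * w"
    by (simp add: algebra_simps)
  then show "\<bar>f z * cutoff x \<rho> z - f y * cutoff x \<rho> y\<bar>
      \<le> 7 * C * (dist y z / (r + dist x y)) powr b * W g r x y"
    by (simp add: q_def w_def T_def)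
qed

lemma tb_bump:
  assumes \<delta>: "\<delta> > 0" and b: "0 < b" "b \<le> 1" and g: "g \<ge> 0" and M: "M \<ge> 0" and L: "L \<ge> 0"
    and a: "\<And>y. \<bar>a y\<bar> \<le> 1" "\<And>y. 2 * \<delta> \<le> dist c y \<Longrightarrow> a y = 0"
      "\<And>y z. \<bar>a y - a z\<bar> \<le> L * (dist y z / \<delta>)"
    and \<psi>: "\<And>y. dist c y < 3 * \<delta> \<Longrightarrow> \<bar>\<psi> y\<bar> \<le> M"
      "\<And>y z. dist c y < 3 * \<delta> \<Longrightarrow> dist y z \<le> \<delta> / 2 \<Longrightarrow> \<bar>\<psi> z - \<psi> y\<bar> \<le> M * (dist y z / \<delta>) powr b"
  shows "tb c \<delta> b g (32 * C1 * 9 powr n * 8 powr g * (1 + L) * M * V \<mu> \<delta> c) (\<lambda>y. \<psi> y * a y)"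
proof -
  define F where "F y = \<psi> y * a y" for y
  have F0: "F y = 0" if "2 * \<delta> \<le> dist c y" for y using a(2) that by (simp add: F_def)
  have FM: "\<bar>F y\<bar> \<le> M" for y
  proof (cases "dist c y < 2 * \<delta>")
    case True
    then have "\<bar>\<psi> y\<bar> * \<bar>a y\<bar> \<le> M * 1" using \<psi>(1)[of y] a(1)[of y] M \<delta> by (intro mult_mono) auto
    then show ?thesis by (simp add: F_def abs_mult)
  qed (use F0[of y] M in simp)
  define q where "q y z = (dist y z / \<delta>) powr b" for y z :: 'a
  have q: "q y z \<ge> 0" "q y z = q z y" for y z by (auto simp: q_def dist_commute)
  have small: "\<bar>F z - F y\<bar> \<le> (1 + L) * M * q y z"
    if d: "dist y z \<le> \<delta> / 2" and y: "dist c y < 2 * \<delta>" for y z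
  proof -
    have "dist y z / \<delta> \<le> q y z"
      using powr_mono'[of b 1 "dist y z / \<delta>"] d \<delta> b by (simp add: q_def field_simps)
    then have "\<bar>a z - a y\<bar> \<le> L * q y z" using a(3)[of z y] mult_left_mono[OF _ L] 
      by (smt (verit) dist_commute)
    then have "\<bar>\<psi> y\<bar> * \<bar>a z - a y\<bar> \<le> M * (L * q y z)"
      using \<psi>(1)[of y] y M \<delta> by (intro mult_mono) auto
    moreover have "\<bar>\<psi> z - \<psi> y\<bar> * \<bar>a z\<bar> \<le> (M * q y z) * 1"
      using \<psi>(2)[of y z] a(1)[of z] d y \<delta> M q unfolding q_def by (intro mult_mono) auto
    moreover have "F z - F y = (\<psi> z - \<psi> y) * a z + \<psi> y * (a z - a y)"
      by (simp add: F_def algebra_simps)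
    then have "\<bar>F z - F y\<bar> \<le> \<bar>\<psi> z - \<psi> y\<bar> * \<bar>a z\<bar> + \<bar>\<psi> y\<bar> * \<bar>a z - a y\<bar>"
      by (metis abs_mult abs_triangle_ineq)
    ultimately show ?thesis by (simp add: algebra_simps)
  qed
  have Fq: "\<bar>F z - F y\<bar> \<le> 4 * (1 + L) * M * q y z" for y z
  proof (cases "dist y z \<le> \<delta> / 2")
    case True
    have "\<bar>F z - F y\<bar> \<le> (1 + L) * M * q y z"
    proof (cases "dist c y < 2 * \<delta>")
      case True
      then show ?thesis using small \<open>dist y z \<le> \<delta> / 2\<close> by blast
    next
      case False
      show ?thesis
      proof (cases "dist c z < 2 * \<delta>")
        case True
        then show ?thesis using small[of z y] \<open>dist y z \<le> \<delta> / 2\<close> q(2)[of y z]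
          by (simp add: dist_commute abs_minus_commute)
      next
        case False
        then show ?thesis using F0[of y] F0[of z] \<open>\<not> dist c y < 2 * \<delta>\<close> L M q by simp
      qed
    qed
    also have "\<dots> \<le> 4 * ((1 + L) * M * q y z)" using L M q[of y z] by simp
    finally show ?thesis by (simp only: mult.assoc)
  next
    case False
    then have "1 \<le> 2 * (dist y z / \<delta>)" using \<delta> by (simp add: field_simps)
    then have "1 \<le> (2 * (dist y z / \<delta>)) powr b" using b by (simp add: ge_one_powr_ge_zero)
    also have "\<dots> = 2 powr b * q y z" unfolding q_def by (rule powr_mult)
    also have "\<dots> \<le> 2 * q y z" using powr_mono[of b 1 2] b q by (intro mult_right_mono) auto
    finally have "1 \<le> 2 * q y z" .
    then have "2 * M * 1 \<le> 2 * M * (2 * q y z)" using M by (intro mult_left_mono) auto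
    also have "\<dots> = 1 * (4 * M * q y z)" by simp
    also have "\<dots> \<le> (1 + L) * (4 * M * q y z)" using L M q by (intro mult_right_mono) auto
    finally have "\<bar>F z - F y\<bar> \<le> (1 + L) * (4 * M * q y z)"
      using FM[of y] FM[of z] by linarith
    then show ?thesis by (simp only: mult_ac)
  qed
  define K where "K = C1 * 9 powr n * 8 powr g * V \<mu> \<delta> c"
  have K: "K \<ge> 0" using C1_ge by (simp add: K_def)
  have KW: "1 \<le> K * W g \<delta> c y" if y: "dist c y \<le> 7 * \<delta>" for y
  proof -
    define T where "T = \<delta> + dist c y"
    have T: "T > 0" "T \<le> 8 * \<delta>" using y \<delta> rd_pos by (auto simp: T_def)
    have "V \<mu> T c \<le> C1 * 9 powr n * V \<mu> \<delta> c"
      using T \<delta> by (intro V_shift) (auto simp: dist_commute)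
    then have 1: "1 \<le> C1 * 9 powr n * V \<mu> \<delta> c * (1 / V \<mu> T c)"
      using V_pos[OF T(1), of c] by (simp add: field_simps)
    have "1 \<le> 8 * (\<delta> / T)" using T by (simp add: field_simps)
    then have "1 \<le> (8 * (\<delta> / T)) powr g" using g by (simp add: ge_one_powr_ge_zero)
    also have "\<dots> = 8 powr g * (\<delta> / T) powr g" by (rule powr_mult)
    finally have "1 * 1 \<le> (C1 * 9 powr n * V \<mu> \<delta> c * (1 / V \<mu> T c)) * (8 powr g * (\<delta> / T) powr g)"
      using 1 by (intro mult_mono) auto
    then show ?thesis by (simp add: K_def W_def T_def mult_ac)
  qed
  define Q where "Q = 32 * C1 * 9 powr n * 8 powr g * (1 + L) * M * V \<mu> \<delta> c"
  have Q: "Q = 32 * (1 + L) * M * K" by (simp add: Q_def K_def mult_ac)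
  have MQ: "M \<le> Q * W g \<delta> c y" if "dist c y \<le> 7 * \<delta>" for y
  proof -
    have "1 * M \<le> (32 * (1 + L)) * M" using L M by (intro mult_right_mono) auto
    also have "\<dots> * 1 \<le> (32 * (1 + L)) * M * (K * W g \<delta> c y)"
      using KW[OF that] L M by (intro mult_left_mono) auto
    finally show ?thesis by (simp add: Q mult_ac)
  qed
  have "tb c \<delta> b g Q F"
  proof (rule tbI)
    fix y
    show "\<bar>F y\<bar> \<le> Q * W g \<delta> c y"
    proof (cases "dist c y < 2 * \<delta>")
      case True
      then have "dist c y \<le> 7 * \<delta>" using \<delta> by argo
      then show ?thesis using MQ FM[of y] order_trans by blast
    next
      case False
      then show ?thesis using F0[of y] L M K by (simp add: Q)
    qed
  next
    fix y z assume d: "dist y z \<le> (\<delta> + dist c y) / 2"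
    define T where "T = \<delta> + dist c y"
    have T: "T > 0" using \<delta> rd_pos by (auto simp: T_def)
    show "\<bar>F z - F y\<bar> \<le> Q * (dist y z / (\<delta> + dist c y)) powr b * W g \<delta> c y"
    proof (cases "dist c y < 2 * \<delta> \<or> dist c z < 2 * \<delta>")
      case True
      \<comment> \<open>If only \<open>z\<close> is in the support,
        \<open>dist y z \<le> (\<delta> + dist c y) / 2\<close> still forces
        \<open>dist c y \<le> 5 * \<delta>\<close>. So \<open>\<delta> + dist c y\<close> is
        comparable to \<delta> whenever the difference can be nonzero.\<close>
      then have y: "dist c y \<le> 7 * \<delta>"
      proof
        assume "dist c y < 2 * \<delta>"
        then show ?thesis using \<delta> by argo
      next
        assume "dist c z < 2 * \<delta>"
        moreover have "dist c y \<le> dist c z + dist y z" by (metis dist_triangle2 dist_commute)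
        ultimately show ?thesis using d \<delta> by argo
      qed
      then have "dist y z * T \<le> dist y z * (8 * \<delta>)" by (intro mult_left_mono) (auto simp: T_def)
      then have "dist y z / \<delta> \<le> 8 * (dist y z / T)" using T \<delta> by (simp add: field_simps)
      then have "q y z \<le> (8 * (dist y z / T)) powr b" unfolding q_def using \<delta> b
        by (intro powr_mono2) auto
      also have "\<dots> = 8 powr b * (dist y z / T) powr b" by (rule powr_mult)
      also have "\<dots> \<le> 8 * (dist y z / T) powr b" using powr_mono[of b 1 8] b
        by (intro mult_right_mono) auto
      finally have "4 * (1 + L) * M * q y z \<le> 4 * (1 + L) * M * (8 * (dist y z / T) powr b)"
        using L M by (intro mult_left_mono) auto
      then have "\<bar>F z - F y\<bar> \<le> 32 * (1 + L) * M * (dist y z / T) powr b * 1"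
        using Fq[where z=z and y=y] by (simp add: algebra_simps)
      also have "\<dots> \<le> 32 * (1 + L) * M * (dist y z / T) powr b * (K * W g \<delta> c y)"
        using KW[OF y] L M by (intro mult_left_mono) auto
      finally show ?thesis by (simp add: Q T_def mult_ac)
    next
      case False
      then show ?thesis using F0[of y] F0[of z] L M K by (simp add: Q)
    qed
  qed
  then show ?thesis by (simp add: Q_def F_def[abs_def])
qed

text \<open>This makes the elements of the dual continuous for uniform convergence on bounded subsets of
  \<open>\<G>(x1, 1, \<epsilon>, \<epsilon>)\<close>. It replaces the second difference condition (iv) on \<open>S\<close>, which is too weak here
  because \<open>\<epsilon>3\<close> may be smaller than \<open>\<gamma>\<close>.\<close>

lemma interpolation:
  assumes b: "0 < b" "b < e'" and g: "0 < g" "g < e'" and e: "e > 0" and B: "B \<ge> 0"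
  shows "\<exists>s>0. \<forall>f. tb x 1 e' e' B f \<longrightarrow> (\<forall>y. \<bar>f y\<bar> \<le> s) \<longrightarrow> tb x 1 b g e f"
proof -
  \<comment> \<open>A gain by the factor \<open>m\<close> turns \<open>B\<close> into
    \<open>e\<close>. The surplus decay gains it where \<open>1 + dist x y \<ge> R\<close>, the
    surplus regularity gains it for relative distances at most \<open>k\<close>. In the remaining
    region the kernel is at least \<open>w\<close> and the relative distance exceeds
    \<open>k\<close>, so a uniform bound \<open>s\<close> is enough.\<close>
  define m where "m = max 1 (B / e)"
  have m: "m \<ge> 1" "B / m \<le> e" using e by (auto simp: m_def max_def field_simps)
  define R where "R = m powr (1 / (e' - g))"
  define k where "k = (1 / m) powr (1 / (e' - b))"
  have R: "R > 0" "B * R powr (g - e') \<le> e"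
  proof -
    have "1 / (e' - g) * (g - e') = - 1" using g by (simp add: field_simps)
    then have "R powr (g - e') = m powr (- 1)" by (simp only: R_def powr_powr)
    then show "B * R powr (g - e') \<le> e" using m by (simp add: powr_minus divide_inverse)
  qed (use m in \<open>simp add: R_def\<close>)
  have k: "k > 0" "k \<le> 1" "B * k powr (e' - b) \<le> e"
  proof -
    have "k powr (e' - b) = 1 / m" using b m by (simp add: k_def powr_powr)
    then show "B * k powr (e' - b) \<le> e" using m by simp
    show "k \<le> 1" unfolding k_def using m b by (intro powr_le1) auto
  qed (use m in \<open>simp add: k_def\<close>)
  define w where "w = 1 / V \<mu> R x * (1 / R) powr g"
  have w: "w > 0" using R V_pos[OF R(1), of x] by (simp add: w_def)
  define s where "s = e * w * k powr b / 2"
  have s: "s > 0" using e w k by (simp add: s_def)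
  have kb: "k powr b \<le> 1" using k b by (intro powr_le1) auto
  have "tb x 1 b g e f" if f: "tb x 1 e' e' B f" "\<And>y. \<bar>f y\<bar> \<le> s" for f
  proof (rule tbI)
    have far: "B * W e' 1 x y \<le> e * W g 1 x y" if "R \<le> 1 + dist x y" for y
    proof -
      define T where "T = 1 + dist x y"
      have "W e' 1 x y = W g 1 x y * (1 / T) powr (e' - g)" unfolding T_def by (rule W_split) simp
      also have "(1 / T) powr (e' - g) \<le> (1 / R) powr (e' - g)"
        using that R g by (intro powr_mono2) (auto simp: T_def frac_le)
      also have "(1 / R) powr (e' - g) = R powr (g - e')"
        using R by (simp add: powr_divide powr_diff)
      finally have "B * W e' 1 x y \<le> B * (W g 1 x y * R powr (g - e'))"
        using B by (simp add: mult_left_mono)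
      also have "\<dots> \<le> e * W g 1 x y" using mult_right_mono[OF R(2) W_nonneg[of g 1 x y]]
        by (simp add: mult_ac)
      finally show ?thesis .
    qed
    have near: "w \<le> W g 1 x y" if "1 + dist x y < R" for y
    proof -
      define T where "T = 1 + dist x y"
      have T: "T > 0" "T \<le> R" using that rd_pos[of 1 x y] by (auto simp: T_def)
      have "1 / V \<mu> R x \<le> 1 / V \<mu> T x" using V_mono[OF T(2)] V_pos[OF T(1)] by (simp add: frac_le)
      moreover have "(1 / R) powr g \<le> (1 / T) powr g"
        using T R g by (intro powr_mono2) (auto simp: frac_le)
      ultimately show ?thesis unfolding w_def W_def T_def[symmetric] by (intro mult_mono) auto
    qed
    fix y
    show "\<bar>f y\<bar> \<le> e * W g 1 x y"
    proof (cases "1 + dist x y < R")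
      case True
      have "s \<le> e * w" using kb e w by (simp add: s_def mult_left_le)
      also have "\<dots> \<le> e * W g 1 x y" using near[OF True] e by simp
      finally show ?thesis using f(2)[of y] by linarith
    next
      case False
      then show ?thesis using far[of y] tb_size[OF f(1), of y] by linarith
    qed
    fix z assume d: "dist y z \<le> (1 + dist x y) / 2"
    define T where "T = 1 + dist x y"
    define t where "t = dist y z / T"
    have T: "T > 0" using rd_pos[of 1 x y] by (auto simp: T_def)
    have t: "0 \<le> t" "t \<le> 1" using d T by (auto simp: t_def T_def field_simps)
    have reg: "\<bar>f z - f y\<bar> \<le> B * t powr e' * W e' 1 x y" using tb_reg[OF f(1) d]
      by (simp add: t_def T_def)
    have "\<bar>f z - f y\<bar> \<le> e * t powr b * W g 1 x y"
    proof (cases "t \<le> k")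
      case True
      have "t powr e' = t powr b * t powr (e' - b)" by (simp flip: powr_add)
      also have "\<dots> \<le> t powr b * k powr (e' - b)"
        using True t b by (intro mult_left_mono powr_mono2) auto
      finally have "B * t powr e' * W e' 1 x y \<le> B * (t powr b * k powr (e' - b)) * W g 1 x y"
        using B g by (intro mult_mono mult_left_mono W_antimono_exp) auto
      also have "\<dots> = (B * k powr (e' - b)) * (t powr b * W g 1 x y)" by simp
      also have "\<dots> \<le> e * (t powr b * W g 1 x y)" by (intro mult_right_mono k) auto
      finally show ?thesis using reg by (simp add: mult.assoc)
    next
      case False
      show ?thesis
      proof (cases "1 + dist x y < R")
        case True
        have "k powr b \<le> t powr b" using False k b by (intro powr_mono2) auto
        then have "e * w * k powr b \<le> e * W g 1 x y * t powr b"
          using near[OF True] e w by (intro mult_mono) auto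
        then show ?thesis using f(2)[of z] f(2)[of y] by (simp add: s_def mult_ac)
      next
        case False
        then have "t powr e' * (B * W e' 1 x y) \<le> t powr b * (e * W g 1 x y)"
          using t b B e by (intro mult_mono[OF _ far] powr_mono') auto
        then show ?thesis using reg by (simp add: mult_ac)
      qed
    qed
    then show "\<bar>f z - f y\<bar> \<le> e * (dist y z / (1 + dist x y)) powr b * W g 1 x y"
      by (simp add: t_def T_def)
  qed
  then show ?thesis using s by blast
qed

end

subsection \<open>Separated nets and partitions of unity\<close>

definition separated :: "real \<Rightarrow> 'a::metric_space set \<Rightarrow> bool" where
  "separated d A \<longleftrightarrow> (\<forall>x\<in>A. \<forall>y\<in>A. x \<noteq> y \<longrightarrow> d \<le> dist x y)"

lemma maximal_separated_exists:
  assumes "d > 0"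
  obtains A :: "'a::metric_space set" where "separated d A" "\<And>y. \<exists>x\<in>A. dist x y < d"
proof -
  have "\<exists>M\<in>Collect (separated d). \<forall>X\<in>Collect (separated d). M \<subseteq> X \<longrightarrow> X = (M :: 'a set)"
  proof (rule subset_Zorn_nonempty)
    show "Collect (separated d) \<noteq> ({} :: 'a set set)"
      by (auto simp: separated_def intro: exI[of _ "{}"])
  next
    fix \<C> :: "'a set set" assume C: "\<C> \<noteq> {}" "subset.chain (Collect (separated d)) \<C>"
    have "d \<le> dist x y" if "x \<in> X" "y \<in> Y" "x \<noteq> y" "X \<in> \<C>" "Y \<in> \<C>" for x y X Y
    proof -
      have "X \<subseteq> Y \<or> Y \<subseteq> X" using C that by (meson subset_chain_def)
      then show ?thesis using C that unfolding subset_chain_def separated_def by blast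
    qed
    then show "\<Union>\<C> \<in> Collect (separated d)" by (auto simp: separated_def)
  qed
  then obtain A :: "'a set" where A: "separated d A" "\<And>X. separated d X \<Longrightarrow> A \<subseteq> X \<Longrightarrow> X = A" by auto
  have "\<exists>x\<in>A. dist x y < d" for y
  proof (rule ccontr)
    assume *: "\<not> (\<exists>x\<in>A. dist x y < d)"
    then have "separated d (insert y A)"
      using A(1) by (auto simp: separated_def dist_commute not_less)
    then have "y \<in> A" using A(2)[of "insert y A"] by auto
    then show False using * assms by auto
  qed
  then show ?thesis using that A by blast
qed

text \<open>For finite \<open>F\<close> the cutoffs cannot sum to 1 everywhere. The maximum with 1
  keeps the quotient Lipschitz away from \<open>F\<close>, and it changes nothing within
  \<open>d\<close> of \<open>F\<close>, where the sum is at least 1.\<close>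

definition pou :: "'a::metric_space set \<Rightarrow> real \<Rightarrow> 'a \<Rightarrow> 'a \<Rightarrow> real" where
  "pou F d i y = cutoff i d y / max 1 (\<Sum>j\<in>F. cutoff j d y)"

lemma pou_range: "0 \<le> pou F d i y" "pou F d i y \<le> 1"
  using cutoff_range[of i d y] by (auto simp: pou_def divide_le_eq)

lemma pou_eq_0: "d > 0 \<Longrightarrow> 2 * d \<le> dist i y \<Longrightarrow> pou F d i y = 0"
  by (simp add: pou_def cutoff_eq_0)

lemma pou_sum:
  assumes "finite F" "d > 0" "i \<in> F" "dist i y < d"
  shows "(\<Sum>j\<in>F. pou F d j y) = 1"
proof -
  have "1 = cutoff i d y" using assms by (simp add: cutoff_eq_1)
  also have "\<dots> \<le> (\<Sum>j\<in>F. cutoff j d y)"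
    using assms cutoff_range by (intro member_le_sum) auto
  finally have "1 \<le> (\<Sum>j\<in>F. cutoff j d y)" .
  then show ?thesis by (simp add: pou_def flip: sum_divide_distrib)
qed

context doubling_space
begin

text \<open>Packing: the balls of radius \<open>d / 2\<close> around the points of \<open>F\<close>
  are disjoint, lie in one ball of radius \<open>R\<close>, and each carries a fixed fraction of its
  volume.\<close>

lemma card_separated_le:
  fixes F :: "'a set"
  assumes "separated d F" "finite F" "d > 0" "k > 0" "F \<subseteq> ball y (k * d)"
  shows "real (card F) \<le> C1 * (4 * k + 1) powr n"
proof -
  define R where "R = (k + 1 / 2) * d"
  have R: "R > 0" using assms by (simp add: R_def)
  have disj: "disjoint_family_on (\<lambda>x. ball x (d / 2)) F"
  proof -
    have "ball x (d / 2) \<inter> ball x' (d / 2) = {}" if "x \<in> F" "x' \<in> F" "x \<noteq> x'" for x x'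
    proof -
      have "d \<le> dist x x'" using that assms(1) by (auto simp: separated_def)
      then show ?thesis
        by (intro disjoint_ballI) simp
    qed
    then show ?thesis by (auto simp: disjoint_family_on_def)
  qed
  have "(\<Sum>x\<in>F. V \<mu> (d / 2) x) = measure \<mu> (\<Union>x\<in>F. ball x (d / 2))"
    unfolding V_def using assms disj ball_finite[of "d / 2"]
    by (intro measure_finite_Union[symmetric]) (auto simp: less_top)
  also have "\<dots> \<le> V \<mu> R y"
    unfolding V_def
  proof (rule measure_mono_fmeasurable)
    show "(\<Union>x\<in>F. ball x (d / 2)) \<subseteq> ball y R"
    proof clarsimp
      fix x z assume "x \<in> F" "dist x z * 2 < d"
      moreover have "dist y z \<le> dist y x + dist x z" by (rule dist_triangle)
      ultimately show "dist y z < R" using assms(5) by (fastforce simp: R_def algebra_simps)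
    qed
  qed (use assms ball_fmeasurable in auto)
  finally have 1: "(\<Sum>x\<in>F. V \<mu> (d / 2) x) \<le> V \<mu> R y" .
  \<comment> \<open>The distance of the centres plus \<open>R\<close> is at most
    \<open>(2 * k + 1 / 2) * d\<close>, that is \<open>4 * k + 1\<close> times the small radius
    \<open>d / 2\<close>.\<close>
  define K where "K = C1 * (4 * k + 1) powr n"
  have K: "K > 0" using C1_ge assms by (simp add: K_def)
  have "V \<mu> R y / K \<le> V \<mu> (d / 2) x" if "x \<in> F" for x
  proof -
    have "V \<mu> R y \<le> K * V \<mu> (d / 2) x"
      unfolding K_def using assms that by (intro V_shift) (auto simp: R_def algebra_simps)
    then show ?thesis using K by (simp add: field_simps)
  qed
  then have "(\<Sum>x\<in>F. V \<mu> R y / K) \<le> (\<Sum>x\<in>F. V \<mu> (d / 2) x)" by (rule sum_mono)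
  then have "real (card F) * (V \<mu> R y / K) \<le> V \<mu> R y" using 1 by simp
  then have "real (card F) \<le> K" using V_pos[OF R, of y] K by (simp add: field_simps)
  then show ?thesis by (simp add: K_def)
qed

lemma separated_ball:
  fixes A :: "'a set"
  assumes "separated d A" "d > 0" "k > 0"
  shows "finite (A \<inter> ball y (k * d))" "real (card (A \<inter> ball y (k * d))) \<le> C1 * (4 * k + 1) powr n"
proof -
  have sep: "separated d G" if "G \<subseteq> A" for G using that assms(1) by (auto simp: separated_def)
  have *: "card G \<le> nat \<lfloor>C1 * (4 * k + 1) powr n\<rfloor>" if "G \<subseteq> A \<inter> ball y (k * d)" "finite G" for G
    using card_separated_le[of d G k y] sep[of G] that assms by (simp add: le_nat_floor)
  show fin: "finite (A \<inter> ball y (k * d))"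
    using finite_if_finite_subsets_card_bdd[of "A \<inter> ball y (k * d)"] * by blast
  show "real (card (A \<inter> ball y (k * d))) \<le> C1 * (4 * k + 1) powr n"
    using card_separated_le[of d _ k y] sep fin assms by (simp add: separated_def)
qed

lemma separated_countable:
  fixes A :: "'a set"
  assumes "separated d A" "d > 0"
  shows "countable A"
proof -
  obtain y :: 'a where True by blast
  have eq: "A = (\<Union>m. A \<inter> ball y (real (Suc m) * d))"
  proof -
    have "\<exists>m. dist y x < real (Suc m) * d" for x
    proof -
      obtain m where "dist y x / d < real m" using reals_Archimedean2 by blast
      then have "dist y x < real m * d" using assms by (simp add: field_simps)
      also have "\<dots> \<le> real (Suc m) * d" using assms by simp
      finally show ?thesis by blast
    qed
    then show ?thesis by auto
  qed
  have "countable (\<Union>m. A \<inter> ball y (real (Suc m) * d))"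
    using separated_ball(1)[OF assms] by (intro countable_UN countableI_type countable_finite) simp
  then show ?thesis by (simp only: eq[symmetric])
qed

lemma separated_bounded_finite:
  fixes A :: "'a set"
  assumes "separated d A" "d > 0"
  shows "finite (A \<inter> ball y R)"
proof (cases "R > 0")
  case True
  then show ?thesis using separated_ball(1)[OF assms, of "R / d" y] assms(2) by simp
next
  case False
  then have "ball y R = {}" by simp
  then show ?thesis by (simp only: Int_empty_right finite.emptyI)
qed

text \<open>\<open>C1 * 9 powr n\<close> bounds the number of net points within \<open>2 * d\<close>
  of a point (\<open>separated_ball\<close> with k = 2). The numerator of \<open>pou\<close>
  contributes 1; the denominator contributes twice this number, because only cutoffs centred near
  one of the two points change.\<close>

definition pou_lip :: real where
  "pou_lip = 1 + 2 * (C1 * 9 powr n)"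

lemma pou_lip_pos: "pou_lip > 0"
  using C1_ge by (simp add: pou_lip_def add_pos_nonneg)

text \<open>The bound is uniform in \<open>F\<close>, which matters because in the decomposition
  \<open>F\<close> grows with the truncation radius.\<close>

lemma pou_lipschitz:
  fixes A :: "'a set"
  assumes "separated d A" "d > 0" "finite F" "F \<subseteq> A"
  shows "\<bar>pou F d i y - pou F d i z\<bar> \<le> pou_lip * (dist y z / d)"
proof -
  define N where "N = C1 * 9 powr n"
  define q where "q = dist y z / d"
  have q: "q \<ge> 0" using assms by (simp add: q_def)
  define H where "H y = (\<Sum>j\<in>F. cutoff j d y)" for y
  have card: "real (card (F \<inter> ball x (2 * d))) \<le> N" for x
  proof -
    have "card (F \<inter> ball x (2 * d)) \<le> card (A \<inter> ball x (2 * d))"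
      using assms separated_ball(1)[of d A 2 x] by (intro card_mono) auto
    then show ?thesis using separated_ball(2)[of d A 2 x] assms by (simp add: N_def)
  qed
  have "\<bar>H y - H z\<bar> \<le> (\<Sum>j\<in>F. \<bar>cutoff j d y - cutoff j d z\<bar>)"
    unfolding H_def sum_subtractf[symmetric] by (rule sum_abs)
  also have "\<dots> = (\<Sum>j\<in>F \<inter> (ball y (2 * d) \<union> ball z (2 * d)). \<bar>cutoff j d y - cutoff j d z\<bar>)"
  proof (rule sum.mono_neutral_right)
    show "\<forall>j\<in>F - F \<inter> (ball y (2 * d) \<union> ball z (2 * d)). \<bar>cutoff j d y - cutoff j d z\<bar> = 0"
    proof
      fix j assume "j \<in> F - F \<inter> (ball y (2 * d) \<union> ball z (2 * d))"
      then have "2 * d \<le> dist j y" "2 * d \<le> dist j z" by (auto simp: dist_commute)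
      then show "\<bar>cutoff j d y - cutoff j d z\<bar> = 0" using assms(2) by (simp add: cutoff_eq_0)
    qed
  qed (use assms in auto)
  also have "\<dots> \<le> (\<Sum>j\<in>F \<inter> (ball y (2 * d) \<union> ball z (2 * d)). q)"
    unfolding q_def using assms by (intro sum_mono cutoff_lipschitz)
  also have "\<dots> = real (card (F \<inter> ball y (2 * d) \<union> F \<inter> ball z (2 * d))) * q"
    by (simp add: Int_Un_distrib)
  also have "\<dots> \<le> (2 * N) * q"
  proof (intro mult_right_mono q)
    have "card (F \<inter> ball y (2 * d) \<union> F \<inter> ball z (2 * d))
        \<le> card (F \<inter> ball y (2 * d)) + card (F \<inter> ball z (2 * d))"
      by (rule card_Un_le)
    then show "real (card (F \<inter> ball y (2 * d) \<union> F \<inter> ball z (2 * d))) \<le> 2 * N"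
      using card[of y] card[of z] by linarith
  qed
  finally have HH: "\<bar>H y - H z\<bar> \<le> 2 * N * q" .
  define M where "M y = max 1 (H y)" for y
  have M: "M y \<ge> 1" for y by (simp add: M_def)
  have MM: "\<bar>M z - M y\<bar> \<le> 2 * N * q" using HH by (auto simp: M_def)
  define c where "c = cutoff i d"
  have c: "0 \<le> c y" "c y \<le> 1" for y using cutoff_range by (auto simp: c_def)
  have "pou F d i y - pou F d i z = c y / M y - c z / M z"
    by (simp add: pou_def c_def M_def H_def)
  also have "\<dots> = (c y - c z) / M z + (c y / M y) * ((M z - M y) / M z)"
    using M[of y] M[of z] by (simp add: field_simps)
  finally have "\<bar>pou F d i y - pou F d i z\<bar> \<le> \<bar>(c y - c z) / M z\<bar> + \<bar>(c y / M y) * ((M z - M y) / M z)\<bar>"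
    by (metis abs_triangle_ineq)
  also have "\<bar>(c y - c z) / M z\<bar> \<le> q"
  proof -
    have "\<bar>(c y - c z) / M z\<bar> \<le> \<bar>c y - c z\<bar>"
      using M[of z] mult_left_mono[of 1 "M z" "\<bar>c y - c z\<bar>"] by (simp add: divide_le_eq)
    also have "\<dots> \<le> q" unfolding c_def q_def using assms by (intro cutoff_lipschitz)
    finally show ?thesis .
  qed
  also have "\<bar>(c y / M y) * ((M z - M y) / M z)\<bar> \<le> 1 * (2 * N * q)"
    unfolding abs_mult
  proof (rule mult_mono)
    show "\<bar>c y / M y\<bar> \<le> 1" using c[of y] M[of y] by (simp add: divide_le_eq)
    have "\<bar>(M z - M y) / M z\<bar> \<le> \<bar>M z - M y\<bar>"
      using M[of z] mult_left_mono[of 1 "M z" "\<bar>M z - M y\<bar>"] by (simp add: divide_le_eq)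
    then show "\<bar>(M z - M y) / M z\<bar> \<le> 2 * N * q" using MM by linarith
  qed auto
  finally show ?thesis by (simp add: pou_lip_def N_def q_def algebra_simps)
qed

text \<open>Integrand estimate for \<open>conv s f y - f y\<close>. The gain
  \<open>(\<delta> / r) powr \<beta>\<close> and the factor \<open>W \<gamma> r x y\<close> are
  pulled out, and what is left depends on \<open>z\<close> through two kernels whose integrals are
  bounded uniformly. For \<open>y\<close>, \<open>z\<close> close, regularity gives
  \<open>(D / T) powr \<beta>\<close>, and \<open>(\<delta> / U) powr \<beta>\<close> is borrowed
  from the kernel, which is why its exponent drops to \<open>e2 - \<beta>\<close>. For
  \<open>y\<close>, \<open>z\<close> far apart, \<open>U\<close> is at least \<open>T / 2\<close>,
  so the kernel itself is small.\<close>

lemma W_mult_diff_le: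
  assumes \<beta>: "0 < \<beta>" "\<beta> < e2" "\<beta> \<le> 1" and \<gamma>: "0 \<le> \<gamma>" "\<gamma> \<le> e2" and \<delta>: "0 < \<delta>" "\<delta> \<le> r"
    and f: "tb x r \<beta> \<gamma> C f"
  shows "W e2 \<delta> y z * \<bar>f z - f y\<bar> \<le> (2 + C1 * 4 powr n * 2 powr e2) * C * (\<delta> / r) powr \<beta> * W \<gamma> r x y *
    (W (e2 - \<beta>) \<delta> y z + W \<gamma> r x z)"
proof -
  define T where "T = r + dist x y"
  define D where "D = dist y z"
  define U where "U = \<delta> + D"
  define \<kappa> where "\<kappa> = (\<delta> / r) powr \<beta>"
  define w where "w = W \<gamma> r x y"
  define u where "u = W (e2 - \<beta>) \<delta> y z"
  define v where "v = W \<gamma> r x z"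
  define K where "K = C1 * 4 powr n * 2 powr e2"
  have r: "r > 0" using \<delta> by simp
  have C: "C \<ge> 0" using tb_const_nonneg[OF r f] .
  have D: "D \<ge> 0" by (simp add: D_def)
  have pos: "w \<ge> 0" "u \<ge> 0" "v \<ge> 0" "\<kappa> \<ge> 0" "K \<ge> 0"
    using C1_ge by (auto simp: w_def u_def v_def \<kappa>_def K_def)
  have T: "T > 0" "T \<ge> r" "U > 0" "U \<ge> \<delta>" "U \<ge> D" using r \<delta> rd_pos[OF r] D by (auto simp: T_def U_def)
  have split: "W e2 \<delta> y z = u * (\<delta> / U) powr \<beta>"
    using W_split[OF \<delta>(1), of e2 y z "e2 - \<beta>"] by (simp add: u_def U_def D_def)
  have goal: "W e2 \<delta> y z * \<bar>f z - f y\<bar> \<le> C * \<kappa> * w * (2 * u + K * v)"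
  proof (cases "D \<le> T / 2")
    case True
    have "\<bar>f z - f y\<bar> \<le> C * (D / T) powr \<beta> * w"
      using tb_reg[OF f, of y z] True by (simp add: D_def T_def w_def)
    also have "\<dots> \<le> C * (D / r) powr \<beta> * w"
      using C T D r \<beta> pos by (intro mult_right_mono mult_left_mono powr_mono2) (auto simp: frac_le)
    finally have "W e2 \<delta> y z * \<bar>f z - f y\<bar> \<le> (u * (\<delta> / U) powr \<beta>) * (C * (D / r) powr \<beta> * w)"
      unfolding split using pos by (intro mult_left_mono) auto
    also have "\<dots> = C * w * u * ((\<delta> / U) * (D / r)) powr \<beta>"
      by (subst powr_mult) (simp add: mult_ac)
    also have "\<dots> \<le> C * w * u * (\<delta> / r) powr \<beta>"
    proof -
      have "(\<delta> / U) * (D / r) = (D / U) * (\<delta> / r)" by simp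
      also have "\<dots> \<le> 1 * (\<delta> / r)" using T D \<delta> r by (intro mult_right_mono) auto
      finally show ?thesis using C pos \<beta> T D \<delta> r by (intro mult_left_mono powr_mono2) auto
    qed
    also have "\<dots> = C * \<kappa> * w * u" by (simp add: \<kappa>_def mult_ac)
    also have "\<dots> \<le> C * \<kappa> * w * (2 * u + K * v)" using C pos by (intro mult_left_mono) auto
    finally show ?thesis .
  next
    case False
    have \<delta>U: "\<delta> / U \<le> 2 * (\<delta> / T)"
    proof -
      have "T \<le> 2 * U" using False T by simp
      then have "\<delta> * T \<le> \<delta> * (2 * U)" using \<delta> by (intro mult_left_mono) auto
      then show ?thesis using T by (simp add: field_simps)
    qed
    have A: "W e2 \<delta> y z * \<bar>f y\<bar> \<le> C * \<kappa> * w * (2 * u)"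
    proof -
      have "\<delta> / U \<le> 2 * (\<delta> / r)" using \<delta>U T \<delta> r by (smt (verit) frac_le)
      then have "(\<delta> / U) powr \<beta> \<le> (2 * (\<delta> / r)) powr \<beta>" using T \<delta> \<beta> by (intro powr_mono2) auto
      also have "\<dots> = 2 powr \<beta> * \<kappa>" unfolding \<kappa>_def by (rule powr_mult)
      finally have 1: "(\<delta> / U) powr \<beta> \<le> 2 powr \<beta> * \<kappa>" .
      have "(\<delta> / U) powr \<beta> \<le> 2 * \<kappa>"
      proof -
        have "2 powr \<beta> \<le> (2::real) powr 1" using \<beta> by (intro powr_mono) auto
        then have "2 powr \<beta> * \<kappa> \<le> 2 * \<kappa>" using pos by (intro mult_right_mono) auto
        then show ?thesis using 1 by linarith
      qed
      then have "W e2 \<delta> y z * \<bar>f y\<bar> \<le> (u * (2 * \<kappa>)) * (C * w)"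
        unfolding split using tb_size[OF f, of y] pos C
          by (intro mult_mono mult_left_mono) (auto simp: w_def)
      then show ?thesis by (simp add: mult_ac)
    qed
    \<comment> \<open>Here the decay in \<open>y\<close> must come from the kernel, since
      \<open>f z\<close> only decays in \<open>z\<close>. Its exponent \<open>e2\<close> is large
      enough to give both the gain (as \<beta> < e2) and the decay of order \<gamma> (as \<gamma>
      \<le> e2).\<close>
    have B: "W e2 \<delta> y z * \<bar>f z\<bar> \<le> C * \<kappa> * w * (K * v)"
    proof -
      have "V \<mu> T x \<le> C1 * 4 powr n * V \<mu> U y"
        using False T r by (intro V_shift) (auto simp: T_def dist_commute U_def)
      then have 1: "1 / V \<mu> U y \<le> C1 * 4 powr n * (1 / V \<mu> T x)"
        using V_pos[OF T(1), of x] V_pos[OF T(3), of y] by (simp add: field_simps)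
      have "(\<delta> / U) powr e2 \<le> (2 * ((\<delta> / r) * (r / T))) powr e2"
        using \<delta>U T \<delta> \<beta> r by (intro powr_mono2) auto
      also have "\<dots> = 2 powr e2 * ((\<delta> / r) powr e2 * (r / T) powr e2)"
        by (simp only: powr_mult)
      also have "\<dots> \<le> 2 powr e2 * (\<kappa> * (r / T) powr \<gamma>)"
        unfolding \<kappa>_def using T \<delta> r \<beta> \<gamma> by (intro mult_left_mono mult_mono powr_mono') auto
      finally have "1 / V \<mu> U y * (\<delta> / U) powr e2
          \<le> (C1 * 4 powr n * (1 / V \<mu> T x)) * (2 powr e2 * (\<kappa> * (r / T) powr \<gamma>))"
        using 1 C1_ge by (intro mult_mono) auto
      then have "W e2 \<delta> y z \<le> K * \<kappa> * w"
        by (simp add: W_def K_def w_def T_def U_def D_def mult_ac)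
      moreover have "\<bar>f z\<bar> \<le> C * v" using tb_size[OF f] by (simp add: v_def)
      ultimately have "W e2 \<delta> y z * \<bar>f z\<bar> \<le> (K * \<kappa> * w) * (C * v)"
        using pos C by (intro mult_mono) auto
      then show ?thesis by (simp add: mult_ac)
    qed
    have "W e2 \<delta> y z * \<bar>f z - f y\<bar> \<le> W e2 \<delta> y z * (\<bar>f z\<bar> + \<bar>f y\<bar>)"
      by (intro mult_left_mono) auto
    then show ?thesis using A B by (simp add: algebra_simps)
  qed
  also have "\<dots> \<le> C * \<kappa> * w * ((2 + K) * (u + v))"
  proof (intro mult_left_mono)
    have "0 \<le> K * u" "0 \<le> 2 * v" using pos by auto
    then show "2 * u + K * v \<le> (2 + K) * (u + v)" by (simp add: algebra_simps)
  qed (use C pos in auto)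
  finally show ?thesis by (simp add: K_def \<kappa>_def w_def u_def v_def mult_ac)
qed

end

subsection \<open>The dual of the space of test functions\<close>

lemma cutoff_measurable [measurable]: "cutoff x \<rho> \<in> borel_measurable borel"
  unfolding cutoff_def[abs_def] divide_inverse
  by (intro borel_measurable_continuous_onI continuous_intros)

lemma pou_measurable [measurable]: "pou F d i \<in> borel_measurable borel"
  unfolding pou_def[abs_def] by measurable

text \<open>The bound on \<open>h\<close> is asked only where \<phi> does not vanish, because the
  kernels \<open>s z\<close> are uniformly bounded only for \<open>z\<close> in bounded
  sets.\<close>

lemma integral_mult_bound:
  fixes h \<phi> :: "'b \<Rightarrow> real"
  assumes \<phi>: "integrable M \<phi>" and h: "h \<in> borel_measurable M"
    and K: "\<And>z. \<phi> z \<noteq> 0 \<Longrightarrow> \<bar>h z\<bar> \<le> K"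
  shows "integrable M (\<lambda>z. h z * \<phi> z)" "\<bar>LINT z|M. h z * \<phi> z\<bar> \<le> K * (LINT z|M. \<bar>\<phi> z\<bar>)"
proof -
  have le: "\<bar>h z * \<phi> z\<bar> \<le> K * \<bar>\<phi> z\<bar>" for z
    using K[of z] by (cases "\<phi> z = 0") (auto simp: abs_mult intro: mult_right_mono)
  have i: "integrable M (\<lambda>z. K * \<bar>\<phi> z\<bar>)" using \<phi> by auto
  show 1: "integrable M (\<lambda>z. h z * \<phi> z)"
    by (rule Bochner_Integration.integrable_bound[OF i])
      (use h \<phi> le abs_ge_self order_trans in \<open>auto intro!: AE_I2 simp del: abs_mult\<close>, blast intro:
        order_trans)
  have "\<bar>LINT z|M. h z * \<phi> z\<bar> \<le> (LINT z|M. \<bar>h z * \<phi> z\<bar>)" by (rule integral_abs_bound)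
  also have "\<dots> \<le> (LINT z|M. K * \<bar>\<phi> z\<bar>)" using 1 i le by (intro integral_mono) auto
  finally show "\<bar>LINT z|M. h z * \<phi> z\<bar> \<le> K * (LINT z|M. \<bar>\<phi> z\<bar>)" by simp
qed

lemma Gnorm_le: "test_bound \<mu> x r b g C f \<Longrightarrow> Gnorm \<mu> x r b g f \<le> C"
  unfolding Gnorm_def by (rule cInf_lower) (auto intro!: bdd_belowI[of _ 0] simp: test_bound_def)

lemma Gnorm_nonneg: "f \<in> Gset \<mu> x r b g \<Longrightarrow> 0 \<le> Gnorm \<mu> x r b g f"
  unfolding Gnorm_def Gset_def by (rule cInf_greatest) (auto simp: test_bound_def)

lemma test_bound_of_Gnorm_less:
  assumes "f \<in> Gset \<mu> x r b g" "Gnorm \<mu> x r b g f < c"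
  shows "test_bound \<mu> x r b g c f"
proof -
  have "{C. test_bound \<mu> x r b g C f} \<noteq> {}" using assms(1) by (auto simp: Gset_def)
  from cInf_lessD[OF this] obtain C where C: "test_bound \<mu> x r b g C f" "C < c"
    using assms(2) by (auto simp: Gnorm_def)
  have nn: "0 \<le> V \<mu> r x + Vxy \<mu> x y" for y by (simp add: V_def Vxy_def)
  have "\<bar>f y\<bar> \<le> c * (1 / (V \<mu> r x + Vxy \<mu> x y)) * (r / (r + dist x y)) powr g" for y
  proof -
    have "\<bar>f y\<bar> \<le> C * (1 / (V \<mu> r x + Vxy \<mu> x y)) * (r / (r + dist x y)) powr g"
      using C(1) by (simp add: test_bound_def)
    also have "\<dots> \<le> c * (1 / (V \<mu> r x + Vxy \<mu> x y)) * (r / (r + dist x y)) powr g"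
      using C nn[of y] by (intro mult_right_mono) auto
    finally show ?thesis .
  qed
  moreover have "\<bar>f z - f y\<bar> \<le> c * (dist y z / (r + dist x y)) powr b
           * (1 / (V \<mu> r x + Vxy \<mu> x y)) * (r / (r + dist x y)) powr g"
    if "dist y z \<le> (r + dist x y) / 2" for y z
  proof -
    have "\<bar>f z - f y\<bar> \<le> C * (dist y z / (r + dist x y)) powr b
           * (1 / (V \<mu> r x + Vxy \<mu> x y)) * (r / (r + dist x y)) powr g"
      using C(1) that by (simp add: test_bound_def)
    also have "\<dots> \<le> c * (dist y z / (r + dist x y)) powr b
           * (1 / (V \<mu> r x + Vxy \<mu> x y)) * (r / (r + dist x y)) powr g"
      using C nn[of y] by (intro mult_right_mono) auto
    finally show ?thesis .
  qed
  moreover have "0 \<le> c" using C by (auto simp: test_bound_def)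
  ultimately show ?thesis unfolding test_bound_def by blast
qed

context doubling_space
begin

lemma Gset_iff:
  assumes "r > 0"
  shows "f \<in> Gset \<mu> x r b g \<longleftrightarrow> (\<exists>C. tb x r b g C f)"
proof
  assume "f \<in> Gset \<mu> x r b g"
  then obtain C where "test_bound \<mu> x r b g C f" by (auto simp: Gset_def)
  from tb_of_test_bound[OF assms this] show "\<exists>C. tb x r b g C f" by blast
next
  assume "\<exists>C. tb x r b g C f"
  then obtain C where "tb x r b g C f" by blast
  from test_bound_of_tb[OF assms this] show "f \<in> Gset \<mu> x r b g" by (auto simp: Gset_def)
qed

lemma tb_sum:
  assumes "finite F" "\<And>i. i \<in> F \<Longrightarrow> tb x r b g (C i) (h i)"
  shows "tb x r b g (\<Sum>i\<in>F. C i) (\<lambda>y. \<Sum>i\<in>F. h i y)"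
  using assms
proof (induction F rule: finite_induct)
  case empty
  then show ?case by (simp add: tb_def)
next
  case (insert i F)
  then show ?case using tb_add[of x r b g "C i" "h i" "sum C F"] by simp
qed

lemma comparable_scales:
  fixes r r' R :: real
  assumes "r > 0" "r' > 0"
  obtains a where "a \<ge> 1" "r \<le> a * r'" "r' \<le> a * r" "R \<le> a * r" "R \<le> a * r'"
proof -
  define a where "a = 1 + r / r' + r' / r + \<bar>R\<bar> / r + \<bar>R\<bar> / r'"
  have "0 \<le> r / r'" "0 \<le> r' / r" "0 \<le> \<bar>R\<bar> / r" "0 \<le> \<bar>R\<bar> / r'" using assms by auto
  then have "1 \<le> a" "r / r' \<le> a" "r' / r \<le> a" "\<bar>R\<bar> / r \<le> a" "\<bar>R\<bar> / r' \<le> a" by (auto simp: a_def)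
  then show ?thesis using assms by (intro that[of a]) (auto simp: divide_le_eq)
qed

lemma W_recenter:
  assumes "r > 0" "r' > 0" "g \<ge> 0"
  obtains K where "K > 0" "\<And>y. W g r x y \<le> K * W g r' x' y"
proof -
  obtain a where a: "a \<ge> 1" "r \<le> a * r'" "r' \<le> a * r" "dist x x' \<le> a * r" "dist x x' \<le> a * r'"
    by (rule comparable_scales[OF assms(1,2)])
  have "C1 * (3 * a\<^sup>2) powr (n + g) > 0" using C1_ge a by simp
  moreover have "W g r x y \<le> C1 * (3 * a\<^sup>2) powr (n + g) * W g r' x' y" for y
    using assms a by (intro W_change) auto
  ultimately show ?thesis using that by blast
qed

lemma tb_recenter:
  assumes r: "r > 0" "r' > 0" and bg: "0 < b" "b \<le> 1" "0 \<le> g"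
  obtains K where "K > 0"
    "\<And>x x' C h. dist x x' \<le> R \<Longrightarrow> tb x r b g C h \<Longrightarrow> tb x' r' b g (K * C) h"
proof -
  obtain a where a: "a \<ge> 1" "r \<le> a * r'" "r' \<le> a * r" "R \<le> a * r" "R \<le> a * r'"
    by (rule comparable_scales[OF r])
  have "tb x' r' b g (chg_const a g * C) h" if "dist x x' \<le> R" "tb x r b g C h" for x x' C h
    by (rule tb_change[of r r' a]) (use that r bg a in auto)
  then show ?thesis using that[of "chg_const a g"] chg_const_pos[OF a(1)] by blast
qed

text \<open>Both test conditions bound absolute values of linear expressions in the function, so
  they pass under an integral against \<phi>.\<close>

lemma tb_integral:
  assumes \<phi>: "integrable \<mu> \<phi>" and meas: "\<And>y. (\<lambda>z. h z y) \<in> borel_measurable borel"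
    and h: "\<And>z. \<phi> z \<noteq> 0 \<Longrightarrow> tb x r b g B (h z)"
  shows "tb x r b g (B * (LINT z|\<mu>. \<bar>\<phi> z\<bar>)) (\<lambda>y. LINT z|\<mu>. h z y * \<phi> z)"
proof (rule tbI)
  fix y
  show "\<bar>LINT z|\<mu>. h z y * \<phi> z\<bar> \<le> B * (LINT z|\<mu>. \<bar>\<phi> z\<bar>) * W g r x y"
    using integral_mult_bound(2)[OF \<phi>, of "\<lambda>z. h z y" "B * W g r x y"] meas tb_size[OF h]
    by (simp add: mult_ac)
  fix y' assume d: "dist y y' \<le> (r + dist x y) / 2"
  have i: "integrable \<mu> (\<lambda>z. h z v * \<phi> z)" for v
    using integral_mult_bound(1)[OF \<phi>, of "\<lambda>z. h z v"] meas tb_size[OF h] by auto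
  have "(LINT z|\<mu>. h z y' * \<phi> z) - (LINT z|\<mu>. h z y * \<phi> z) = (LINT z|\<mu>. (h z y' - h z y) * \<phi> z)"
    using i by (simp add: left_diff_distrib)
  also have "\<bar>\<dots>\<bar> \<le> (B * (dist y y' / (r + dist x y)) powr b * W g r x y) * (LINT z|\<mu>. \<bar>\<phi> z\<bar>)"
    using meas tb_reg[OF h d] by (intro integral_mult_bound(2)[OF \<phi>]) auto
  finally show "\<bar>(LINT z|\<mu>. h z y' * \<phi> z) - (LINT z|\<mu>. h z y * \<phi> z)\<bar>
      \<le> B * (LINT z|\<mu>. \<bar>\<phi> z\<bar>) * (dist y y' / (r + dist x y)) powr b * W g r x y"
    by (simp add: mult_ac)
qed

end

text \<open>\<open>C4\<close> is the constant of the kernel bounds in \<open>W\<close> form and in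
  both variables, so it will be a multiple of the constant of the AOTI.\<close>

locale hardy_setting = doubling_space \<mu> n C1
  for \<mu> :: "'a::metric_space measure" and n C1 +
  fixes \<epsilon>1 \<epsilon>2 \<epsilon> \<beta> \<gamma> p C4 :: real and x1 :: 'a
  assumes eps1: "\<epsilon>1 \<le> 1" and eps: "0 < \<epsilon>" "\<epsilon> < \<epsilon>1" "\<epsilon> < \<epsilon>2"
    and p: "0 < p" "p \<le> 1"
    and beta: "n * (1 / p - 1) < \<beta>" "\<beta> < \<epsilon>"
    and gamma: "n * (1 / p - 1) < \<gamma>" "\<gamma> < \<epsilon>"
    and C4: "0 < C4"
begin

lemma bg_pos: "0 < \<beta>" "0 < \<gamma>"
proof -
  have "0 \<le> n * (1 / p - 1)" using n_pos p by (simp add: field_simps)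
  then show "0 < \<beta>" "0 < \<gamma>" using beta gamma by auto
qed

lemma le1: "\<epsilon> \<le> 1" "\<beta> \<le> 1"
  using eps eps1 beta by auto

text \<open>One kernel \<open>S l\<close> with \<delta> in place of \<open>2 powr (- l)\<close>.
  Rows are what \<open>f\<close> is applied to, columns are what \<open>conv\<close> integrates; the
  normalization of the columns makes \<open>conv s\<close> preserve constants.\<close>

definition kern :: "real \<Rightarrow> ('a \<Rightarrow> 'a \<Rightarrow> real) \<Rightarrow> bool" where
  "kern \<delta> s \<longleftrightarrow> 0 < \<delta> \<and> (\<forall>x. tb x \<delta> \<epsilon>1 \<epsilon>2 C4 (s x)) \<and>
     (\<forall>y. tb y \<delta> \<epsilon>1 \<epsilon>2 C4 (\<lambda>x. s x y)) \<and> (\<forall>y. (LINT z|\<mu>. s z y) = 1)"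

definition smooth :: "('a \<Rightarrow> real) \<Rightarrow> bool" where
  "smooth g \<longleftrightarrow> (\<exists>B. tb x1 1 \<epsilon> \<epsilon> B g)"

text \<open>The transpose of the operator: \<open>S_apply\<close> pairs \<open>f\<close> with the
  second variable of the kernel, so moving it to \<phi> integrates the first.\<close>

definition conv :: "('a \<Rightarrow> 'a \<Rightarrow> real) \<Rightarrow> ('a \<Rightarrow> real) \<Rightarrow> 'a \<Rightarrow> real" where
  "conv s \<phi> y = (LINT z|\<mu>. s z y * \<phi> z)"

abbreviation remainder :: "(('a \<Rightarrow> real) \<Rightarrow> real) \<Rightarrow> ('a \<Rightarrow> 'a \<Rightarrow> real) \<Rightarrow> ('a \<Rightarrow> real) \<Rightarrow> real" where
  "remainder f s \<phi> \<equiv> f \<phi> - (LINT z|\<mu>. f (s z) * \<phi> z)"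
abbreviation "test \<equiv> G0 \<mu> x1 \<epsilon> \<beta> \<gamma>"
abbreviation "dual \<equiv> G0_dual \<mu> x1 \<epsilon> \<beta> \<gamma>"

lemma smooth_iff_Gset: "smooth g \<longleftrightarrow> g \<in> Gset \<mu> x1 1 \<epsilon> \<epsilon>"
  by (simp add: smooth_def Gset_iff)

lemma smooth_diff: "smooth g \<Longrightarrow> smooth h \<Longrightarrow> smooth (\<lambda>y. g y - h y)"
  unfolding smooth_def using tb_diff by blast

lemma smooth_scale: "smooth g \<Longrightarrow> smooth (\<lambda>y. c * g y)"
  unfolding smooth_def using tb_scale by blast

lemma smooth_sum:
  assumes "finite F" "\<And>i. i \<in> F \<Longrightarrow> smooth (h i)"
  shows "smooth (\<lambda>y. \<Sum>i\<in>F. h i y)"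
proof -
  obtain C where "\<And>i. i \<in> F \<Longrightarrow> tb x1 1 \<epsilon> \<epsilon> (C i) (h i)"
    using assms(2) unfolding smooth_def by metis
  then show ?thesis unfolding smooth_def using tb_sum[OF assms(1)] by blast
qed

lemma smooth_of_tb:
  assumes "r > 0" "\<epsilon> \<le> b" "\<epsilon> \<le> g" "tb x r b g C h"
  shows "smooth h"
proof -
  obtain K where "K > 0" "\<And>x' y C h. dist x' y \<le> dist x x1 \<Longrightarrow> tb x' r \<epsilon> \<epsilon> C h \<Longrightarrow> tb y 1 \<epsilon> \<epsilon> (K * C) h"
    by (rule tb_recenter[of r 1 \<epsilon> \<epsilon> "dist x x1"]) (use assms(1) eps le1 in auto)
  moreover have "tb x r \<epsilon> \<epsilon> C h" using tb_antimono_exp assms by blast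
  ultimately show ?thesis unfolding smooth_def using order_refl by blast
qed

lemma smooth_measurable: "smooth h \<Longrightarrow> h \<in> borel_measurable borel"
  unfolding smooth_def using tb_measurable[of 1 \<epsilon> x1 \<epsilon>] eps by auto

lemma smooth_tb:
  assumes "smooth g"
  obtains C where "tb x1 1 \<beta> \<gamma> C g"
proof -
  obtain B where "tb x1 1 \<epsilon> \<epsilon> B g" using assms by (auto simp: smooth_def)
  then have "tb x1 1 \<beta> \<gamma> B g" by (rule tb_antimono_exp[rotated]) (use beta gamma in auto)
  then show ?thesis by (rule that)
qed

lemma test_iff:
  "\<phi> \<in> test \<longleftrightarrow> (\<exists>C. tb x1 1 \<beta> \<gamma> C \<phi>) \<and> (\<forall>e>0. \<exists>g. smooth g \<and> tb x1 1 \<beta> \<gamma> e (\<lambda>y. \<phi> y - g y))"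
    (is "_ \<longleftrightarrow> ?A \<and> ?B")
proof
  assume \<phi>: "\<phi> \<in> test"
  then have A: ?A
    by (simp add: G0_def Gset_iff)
  have "\<exists>g. smooth g \<and> tb x1 1 \<beta> \<gamma> e (\<lambda>y. \<phi> y - g y)" if e: "e > 0" for e
  proof -
    define e' where "e' = e / (C1 * 2 powr n)"
    have e': "e' > 0" using e C1_ge by (simp add: e'_def)
    obtain g where g: "g \<in> Gset \<mu> x1 1 \<epsilon> \<epsilon>" "Gnorm \<mu> x1 1 \<beta> \<gamma> (\<lambda>y. \<phi> y - g y) < e'"
      using \<phi> e' unfolding G0_def by blast
    have sg: "smooth g" using g by (simp add: smooth_iff_Gset)
    have "\<exists>C. tb x1 1 \<beta> \<gamma> C g"
      using smooth_tb[OF sg] by blast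
    then have "\<exists>C. tb x1 1 \<beta> \<gamma> C (\<lambda>y. \<phi> y - g y)" using A tb_diff by blast
    then have "(\<lambda>y. \<phi> y - g y) \<in> Gset \<mu> x1 1 \<beta> \<gamma>"
      by (simp add: Gset_iff)
    then have "test_bound \<mu> x1 1 \<beta> \<gamma> e' (\<lambda>y. \<phi> y - g y)"
      using g by (intro test_bound_of_Gnorm_less)
    then have "tb x1 1 \<beta> \<gamma> (C1 * 2 powr n * e') (\<lambda>y. \<phi> y - g y)"
      by (intro tb_of_test_bound) auto
    moreover have "C1 * 2 powr n * e' = e" using C1_ge by (simp add: e'_def)
    ultimately show ?thesis using sg by auto
  qed
  then show "?A \<and> ?B" using A by blast
next
  assume *: "?A \<and> ?B"
  then have "\<phi> \<in> Gset \<mu> x1 1 \<beta> \<gamma>" by (simp add: Gset_iff)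
  moreover have "\<exists>g\<in>Gset \<mu> x1 1 \<epsilon> \<epsilon>. Gnorm \<mu> x1 1 \<beta> \<gamma> (\<lambda>y. \<phi> y - g y) < e" if e: "e > 0" for e
  proof -
    obtain g where g: "smooth g" "tb x1 1 \<beta> \<gamma> (e / 4) (\<lambda>y. \<phi> y - g y)"
      using * e by (metis zero_less_divide_iff zero_less_numeral)
    have "Gnorm \<mu> x1 1 \<beta> \<gamma> (\<lambda>y. \<phi> y - g y) \<le> 2 * (e / 4)"
      using g(2) by (intro Gnorm_le test_bound_of_tb) auto
    then have "Gnorm \<mu> x1 1 \<beta> \<gamma> (\<lambda>y. \<phi> y - g y) < e" using e by simp
    then show ?thesis using g(1) unfolding smooth_iff_Gset by blast
  qed
  ultimately show "\<phi> \<in> test" by (auto simp: G0_def)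
qed

lemma smooth_test: "smooth g \<Longrightarrow> g \<in> test"
proof -
  assume g: "smooth g"
  have "tb x1 1 \<beta> \<gamma> e (\<lambda>y. g y - g y)" if "e > 0" for e
    using that W_nonneg[of \<gamma> 1 x1] by (intro tbI) auto
  then show ?thesis unfolding test_iff using g smooth_tb[OF g] by metis
qed

lemma test_diff_smooth:
  assumes "\<phi> \<in> test" "smooth g"
  shows "(\<lambda>y. \<phi> y - g y) \<in> test"
  unfolding test_iff
proof (intro conjI allI impI)
  obtain C C' where "tb x1 1 \<beta> \<gamma> C \<phi>" "tb x1 1 \<beta> \<gamma> C' g"
    using assms smooth_tb unfolding test_iff by metis
  then show "\<exists>C. tb x1 1 \<beta> \<gamma> C (\<lambda>y. \<phi> y - g y)" using tb_diff by blast
  fix e :: real assume "e > 0"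
  then obtain h where h: "smooth h" "tb x1 1 \<beta> \<gamma> e (\<lambda>y. \<phi> y - h y)" using assms(1)
    unfolding test_iff by blast
  then show "\<exists>h. smooth h \<and> tb x1 1 \<beta> \<gamma> e (\<lambda>y. \<phi> y - g y - h y)"
    using smooth_diff[OF h(1) assms(2)] by (intro exI[of _ "\<lambda>y. h y - g y"]) auto
qed

lemma dual_add:
  assumes "f \<in> dual" "\<phi> \<in> test" "\<psi> \<in> test"
  shows "f (\<lambda>y. \<phi> y + \<psi> y) = f \<phi> + f \<psi>"
  using assms by (simp add: G0_dual_def)

lemma dual_scale:
  assumes "f \<in> dual" "\<phi> \<in> test"
  shows "f (\<lambda>y. c * \<phi> y) = c * f \<phi>"
  using assms by (simp add: G0_dual_def)

lemma dual_diff: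
  assumes f: "f \<in> dual" and \<phi>: "\<phi> \<in> test" and g: "smooth g"
  shows "f (\<lambda>y. \<phi> y - g y) = f \<phi> - f g"
  using dual_add[OF f test_diff_smooth[OF \<phi> g] smooth_test[OF g]] by simp

lemma dual_sum:
  assumes f: "f \<in> dual" and "finite F" "\<And>i. i \<in> F \<Longrightarrow> smooth (h i)"
  shows "f (\<lambda>y. \<Sum>i\<in>F. h i y) = (\<Sum>i\<in>F. f (h i))"
  using assms(2,3)
proof (induction F rule: finite_induct)
  case empty
  have "smooth (\<lambda>y. 0)" unfolding smooth_def tb_def by (intro exI[of _ 0]) auto
  then show ?case using dual_scale[OF f smooth_test, of "\<lambda>y. 0" 0] by simp
next
  case (insert i F)
  then have "smooth (h i)" "smooth (\<lambda>y. \<Sum>i\<in>F. h i y)" by (auto intro: smooth_sum)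
  then show ?case using insert dual_add[OF f smooth_test smooth_test, of "h i"] by simp
qed

lemma dual_bound:
  assumes f: "f \<in> dual"
  obtains B where "B > 0" "\<And>\<phi> C. \<phi> \<in> test \<Longrightarrow> tb x1 1 \<beta> \<gamma> C \<phi> \<Longrightarrow> \<bar>f \<phi>\<bar> \<le> B * C"
proof -
  obtain B0 where B0: "\<And>\<phi>. \<phi> \<in> test \<Longrightarrow> \<bar>f \<phi>\<bar> \<le> B0 * Gnorm \<mu> x1 1 \<beta> \<gamma> \<phi>"
    using f unfolding G0_dual_def by blast
  have "\<bar>f \<phi>\<bar> \<le> (2 * (\<bar>B0\<bar> + 1)) * C" if \<phi>: "\<phi> \<in> test" "tb x1 1 \<beta> \<gamma> C \<phi>" for \<phi> C
  proof -
    have "0 \<le> Gnorm \<mu> x1 1 \<beta> \<gamma> \<phi>" using \<phi>(1) by (intro Gnorm_nonneg) (simp add: G0_def)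
    moreover have "Gnorm \<mu> x1 1 \<beta> \<gamma> \<phi> \<le> 2 * C"
      using \<phi>(2) by (intro Gnorm_le test_bound_of_tb) auto
    ultimately have "B0 * Gnorm \<mu> x1 1 \<beta> \<gamma> \<phi> \<le> (\<bar>B0\<bar> + 1) * (2 * C)"
      by (intro mult_mono) auto
    then show ?thesis using B0[OF \<phi>(1)] by (simp add: algebra_simps)
  qed
  then show ?thesis using that[of "2 * (\<bar>B0\<bar> + 1)"] by auto
qed

lemma dual_continuous:
  assumes f: "f \<in> dual" and "B \<ge> 0" "e > 0"
  obtains s where "s > 0" "\<And>g. tb x1 1 \<epsilon> \<epsilon> B g \<Longrightarrow> (\<And>y. \<bar>g y\<bar> \<le> s) \<Longrightarrow> \<bar>f g\<bar> \<le> e"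
proof -
  obtain K where K: "K > 0" "\<And>\<phi> C. \<phi> \<in> test \<Longrightarrow> tb x1 1 \<beta> \<gamma> C \<phi> \<Longrightarrow> \<bar>f \<phi>\<bar> \<le> K * C"
    using dual_bound[OF f] by metis
  obtain s where s: "s > 0" "\<And>g. tb x1 1 \<epsilon> \<epsilon> B g \<Longrightarrow> (\<forall>y. \<bar>g y\<bar> \<le> s) \<Longrightarrow> tb x1 1 \<beta> \<gamma> (e / K) g"
    using interpolation[of \<beta> \<epsilon> \<gamma> "e / K" B x1] bg_pos beta gamma K assms by auto
  have "\<bar>f g\<bar> \<le> e" if g: "tb x1 1 \<epsilon> \<epsilon> B g" "\<And>y. \<bar>g y\<bar> \<le> s" for g
  proof -
    have "g \<in> test" using g(1) by (intro smooth_test) (auto simp: smooth_def)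
    then show ?thesis using K(2)[OF _ s(2)[OF g(1)]] g(2) K(1) by auto
  qed
  then show ?thesis using that s(1) by blast
qed

section \<open>Kernel rows as a continuous family of test functions, and the interchange of
  \<open>f\<close> with the integral\<close>

lemma kernD:
  assumes "kern \<delta> s"
  shows "0 < \<delta>" "\<And>x. tb x \<delta> \<epsilon>1 \<epsilon>2 C4 (s x)" "\<And>y. tb y \<delta> \<epsilon>1 \<epsilon>2 C4 (\<lambda>x. s x y)" "\<And>y. (LINT z|\<mu>. s z
    y) = 1"
  using assms by (auto simp: kern_def)

lemma kern_smooth: "kern \<delta> s \<Longrightarrow> smooth (s z)"
  using smooth_of_tb[of \<delta> \<epsilon>1 \<epsilon>2] kernD(1,2) eps by (meson less_imp_le)

lemma kern_measurable: "kern \<delta> s \<Longrightarrow> (\<lambda>z. s z y) \<in> borel_measurable borel"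
  using tb_measurable[of \<delta> \<epsilon>1] kernD(1,3) eps by (meson less_trans)

lemma kern_uniform:
  assumes s: "kern \<delta> s"
  obtains B where "B \<ge> 0" "\<And>z. dist x1 z \<le> R \<Longrightarrow> tb x1 1 \<epsilon> \<epsilon> B (s z)"
proof -
  obtain K where K: "K > 0"
     "\<And>x x' C h. dist x x' \<le> R \<Longrightarrow> tb x \<delta> \<epsilon> \<epsilon> C h \<Longrightarrow> tb x' 1 \<epsilon> \<epsilon> (K * C) h"
    using tb_recenter[of \<delta> 1 \<epsilon> \<epsilon> R] kernD[OF s] eps le1 by auto
  have "tb x1 1 \<epsilon> \<epsilon> (K * C4) (s z)" if "dist x1 z \<le> R" for z
  proof (rule K(2))
    show "tb z \<delta> \<epsilon> \<epsilon> C4 (s z)"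
      using tb_antimono_exp[OF kernD(1,2)[OF s]] eps by auto
  qed (use that in \<open>simp add: dist_commute\<close>)
  then show ?thesis using that[of "K * C4"] K C4 by auto
qed

lemma kern_equicontinuous:
  assumes s: "kern \<delta> s" and s0: "s0 > 0" and R: "R \<ge> 0"
  obtains h where "h > 0" "\<And>z z' y. dist x1 z \<le> R \<Longrightarrow> dist z z' < h \<Longrightarrow> \<bar>s z y - s z' y\<bar> \<le> s0"
proof -
  have \<delta>: "\<delta> > 0" using kernD[OF s] by simp
  \<comment> \<open>\<open>Q\<close> bounds \<open>W \<epsilon>2 \<delta> y z\<close> for all
    \<open>y\<close> and all \<open>z\<close> within \<open>R\<close> of \<open>x1\<close>: swap the
    centres, bound by the inverse volume at \<open>z\<close>, and compare that volume with the one
    at \<open>x1\<close>.\<close>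
  define Q where "Q = C1 * 2 powr (n + \<epsilon>2) * (C1 * (1 + R / \<delta>) powr n / V \<mu> \<delta> x1)"
  have "0 < 1 + R / \<delta>" using R \<delta> by (intro add_pos_nonneg) auto
  then have Q: "Q > 0" unfolding Q_def using C1_ge V_pos[OF \<delta>, of x1]
    by (intro mult_pos_pos divide_pos_pos) auto
  \<comment> \<open>The power makes \<open>C4 * t powr \<epsilon>1 * Q\<close> at most
    \<open>s0\<close>; the bound 1/2 keeps \<open>dist z z'\<close> in the range of the regularity
    condition.\<close>
  define t where "t = min (1 / 2) ((s0 / (C4 * Q)) powr (1 / \<epsilon>1))"
  have t: "0 < t" "t \<le> 1 / 2" "t powr \<epsilon>1 \<le> s0 / (C4 * Q)"
  proof -
    have pos: "0 < s0 / (C4 * Q)" using s0 C4 Q by simp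
    show "0 < t" "t \<le> 1 / 2" using pos by (auto simp: t_def)
    have "t powr \<epsilon>1 \<le> ((s0 / (C4 * Q)) powr (1 / \<epsilon>1)) powr \<epsilon>1"
      using eps \<open>0 < t\<close> by (intro powr_mono2) (auto simp: t_def)
    also have "\<dots> = s0 / (C4 * Q)" using pos eps s0 C4 Q by (simp add: powr_powr)
    finally show "t powr \<epsilon>1 \<le> s0 / (C4 * Q)" .
  qed
  have "\<bar>s z y - s z' y\<bar> \<le> s0" if z: "dist x1 z \<le> R" "dist z z' < \<delta> * t" for z z' y
  proof -
    have "\<delta> * t \<le> \<delta> * (1 / 2)" using t \<delta> by (intro mult_left_mono) auto
    then have d: "dist z z' \<le> (\<delta> + dist y z) / 2" using z zero_le_dist[of y z] by argo
    have "dist z z' / (\<delta> + dist y z) \<le> dist z z' / \<delta>" using \<delta>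
      by (intro divide_left_mono mult_pos_pos add_pos_nonneg) auto
    also have "\<dots> \<le> t" using z \<delta> by (simp add: field_simps)
    finally have "(dist z z' / (\<delta> + dist y z)) powr \<epsilon>1 \<le> t powr \<epsilon>1"
      using \<delta> eps by (intro powr_mono2) auto
    then have 1: "(dist z z' / (\<delta> + dist y z)) powr \<epsilon>1 \<le> s0 / (C4 * Q)" using t by linarith
    have "W \<epsilon>2 \<delta> y z \<le> C1 * 2 powr (n + \<epsilon>2) * W \<epsilon>2 \<delta> z y" using \<delta> eps by (intro W_sym) auto
    also have "\<dots> \<le> C1 * 2 powr (n + \<epsilon>2) * (1 / V \<mu> \<delta> z)"
      using \<delta> eps C1_ge by (intro mult_left_mono W_le_V) auto
    also have "\<dots> \<le> Q"
    proof -
      have "V \<mu> \<delta> x1 \<le> C1 * (1 + R / \<delta>) powr n * V \<mu> \<delta> z"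
        using z R \<delta> by (intro V_shift) (auto simp: field_simps)
      then have "1 / V \<mu> \<delta> z \<le> C1 * (1 + R / \<delta>) powr n / V \<mu> \<delta> x1"
        using V_pos[OF \<delta>, of x1] V_pos[OF \<delta>, of z] by (simp add: field_simps)
      then show ?thesis unfolding Q_def using C1_ge by (intro mult_left_mono) auto
    qed
    finally have 2: "W \<epsilon>2 \<delta> y z \<le> Q" .
    have "\<bar>s z' y - s z y\<bar> \<le> C4 * (dist z z' / (\<delta> + dist y z)) powr \<epsilon>1 * W \<epsilon>2 \<delta> y z"
      using tb_reg[OF kernD(3)[OF s] d] .
    also have "\<dots> \<le> C4 * (s0 / (C4 * Q)) * Q"
      using 1 2 C4 Q s0 by (intro mult_mono) auto
    also have "\<dots> = s0" using C4 Q by simp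
    finally show ?thesis by (simp add: abs_minus_commute)
  qed
  then show ?thesis using that[of "\<delta> * t"] t \<delta> by auto
qed

text \<open>This supplies the measurability of \<open>\<lambda>z. f (s z)\<close>. For nearby points
  the difference of two rows is bounded in the smooth class and uniformly small, so
  \<open>dual_continuous\<close> applies.\<close>

lemma dual_kern_continuous:
  assumes f: "f \<in> dual" and s: "kern \<delta> s"
  shows "continuous_on UNIV (\<lambda>z. f (s z))"
proof (rule continuous_at_imp_continuous_on, rule ballI)
  fix z
  obtain B where B: "B \<ge> 0" "\<And>v. dist x1 v \<le> dist x1 z + 1 \<Longrightarrow> tb x1 1 \<epsilon> \<epsilon> B (s v)"
    using kern_uniform[OF s] by metis
  show "isCont (\<lambda>z. f (s z)) z"
    unfolding continuous_at_eps_delta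
  proof (intro allI impI)
    fix e :: real assume e: "e > 0"
    obtain s0 where s0: "s0 > 0" "\<And>g. tb x1 1 \<epsilon> \<epsilon> (B + B) g \<Longrightarrow> (\<And>y. \<bar>g y\<bar> \<le> s0) \<Longrightarrow> \<bar>f g\<bar> \<le> e / 2"
      using dual_continuous[OF f, of "B + B" "e / 2"] B e by auto
    obtain h where h: "h > 0" "\<And>v y. dist z v < h \<Longrightarrow> \<bar>s z y - s v y\<bar> \<le> s0"
      by (rule kern_equicontinuous[OF s s0(1), of "dist x1 z"]) auto
    have "dist (f (s v)) (f (s z)) < e" if v: "dist v z < min h 1" for v
    proof -
      have zv: "dist z v < h" "dist x1 v \<le> dist x1 z + 1"
        using v dist_triangle[of x1 v z] by (auto simp: dist_commute)
      have "\<bar>f (\<lambda>y. s z y - s v y)\<bar> \<le> e / 2"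
        using zv h(2)[OF zv(1)] B(2)[of z] B(2)[of v] by (intro s0 tb_diff) auto
      then show ?thesis
        using dual_diff[OF f smooth_test[OF kern_smooth[OF s]] kern_smooth[OF s], of z v] e
        by (simp add: dist_real_def abs_minus_commute)
    qed
    then show "\<exists>d>0. \<forall>v. dist v z < d \<longrightarrow> dist (f (s v)) (f (s z)) < e"
      using h by (intro exI[of _ "min h 1"]) auto
  qed
qed

text \<open>A Fubini theorem for \<open>f\<close>, by Riemann sums: a fine partition of unity
  \<open>\<eta>\<close> gives weights \<open>c i\<close>, and \<open>conv s \<phi>\<close> is
  compared with the finite sum of \<open>c i * s i y\<close>, to which linearity applies. The error
  \<open>\<rho>\<close> is bounded in the smooth class and uniformly small, hence
  \<open>f \<rho>\<close> is small by \<open>dual_continuous\<close>; mere boundedness of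
  \<open>f\<close> on smooth functions would not give this.\<close>

lemma dual_conv:
  assumes f: "f \<in> dual" and s: "kern \<delta> s" and \<phi>: "integrable \<mu> \<phi>"
    and supp: "\<And>z. R \<le> dist x1 z \<Longrightarrow> \<phi> z = 0"
  shows "smooth (conv s \<phi>)" "integrable \<mu> (\<lambda>z. f (s z) * \<phi> z)"
    "f (conv s \<phi>) = (LINT z|\<mu>. f (s z) * \<phi> z)"
proof -
  define F where "F z = f (s z)" for z
  define I where "I = (LINT z|\<mu>. \<bar>\<phi> z\<bar>)"
  have I: "I \<ge> 0" by (simp add: I_def)
  \<comment> \<open>The extra 1 leaves room for the net points close to the support of
    \<phi>.\<close>
  define R' where "R' = \<bar>R\<bar> + 1"
  have suppR: "dist x1 z < R'" if "\<phi> z \<noteq> 0" for z using supp[of z] that by (force simp: R'_def)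
  obtain B where B: "B \<ge> 0" "\<And>z. dist x1 z \<le> R' \<Longrightarrow> tb x1 1 \<epsilon> \<epsilon> B (s z)"
    using kern_uniform[OF s] by metis
  have m: "(\<lambda>z. s z y) \<in> borel_measurable borel" for y by (rule kern_measurable[OF s])
  have mF: "F \<in> borel_measurable borel"
    unfolding F_def[abs_def] by (intro borel_measurable_continuous_onI dual_kern_continuous[OF f s])
  have tbc: "tb x1 1 \<epsilon> \<epsilon> (B * I) (conv s \<phi>)"
    unfolding conv_def[abs_def] I_def using suppR by (intro tb_integral \<phi> m B) (simp add: less_imp_le)
  then show sm: "smooth (conv s \<phi>)" by (auto simp: smooth_def)
  obtain K where K: "\<And>\<phi> C. \<phi> \<in> test \<Longrightarrow> tb x1 1 \<beta> \<gamma> C \<phi> \<Longrightarrow> \<bar>f \<phi>\<bar> \<le> K * C"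
    using dual_bound[OF f] by metis
  have FK: "\<bar>F z\<bar> \<le> K * B" if "\<phi> z \<noteq> 0" for z
    unfolding F_def using suppR[OF that] beta gamma
    by (intro K smooth_test kern_smooth[OF s] tb_antimono_exp[OF _ B(2)]) auto
  have iF: "integrable \<mu> (\<lambda>z. F z * \<phi> z)"
    using integral_mult_bound(1)[OF \<phi>, of F] mF FK by auto
  then show "integrable \<mu> (\<lambda>z. f (s z) * \<phi> z)" by (simp add: F_def)
  have main: "\<bar>f (conv s \<phi>) - (LINT z|\<mu>. F z * \<phi> z)\<bar> \<le> e * (1 + I)" if e: "e > 0" for e
  proof -
    \<comment> \<open>\<open>B'\<close> dominates both the bound \<open>2 * B\<close> for
      differences of rows and the bound \<open>2 * B * I\<close> for \<open>\<rho>\<close>, so one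
      \<open>s0\<close> serves both. Likewise \<open>s1\<close> is small before and after
      integration against \<phi>.\<close>
    define B' where "B' = 2 * B * (1 + I)"
    have B': "B' \<ge> 0" "2 * B \<le> B'" "2 * B * I \<le> B'" using B I by (auto simp: B'_def algebra_simps)
    obtain s0 where s0: "s0 > 0" "\<And>g. tb x1 1 \<epsilon> \<epsilon> B' g \<Longrightarrow> (\<And>y. \<bar>g y\<bar> \<le> s0) \<Longrightarrow> \<bar>f g\<bar> \<le> e"
      using dual_continuous[OF f B'(1) e] by metis
    define s1 where "s1 = s0 / (1 + I)"
    have s1: "s1 > 0" "s1 \<le> s0" "s1 * I \<le> s0" using s0 I by (auto simp: s1_def field_simps)
    obtain h where h: "h > 0" "\<And>z z' y. dist x1 z \<le> R' \<Longrightarrow> dist z z' < h \<Longrightarrow> \<bar>s z y - s z' y\<bar> \<le> s1"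
      using kern_equicontinuous[OF s s1(1), of R'] by (auto simp: R'_def)
    define d where "d = min h 1 / 2"
    have d: "d > 0" "2 * d \<le> h" "2 * d \<le> 1" using h by (auto simp: d_def)
    obtain A :: "'a set" where A: "separated d A" "\<And>y. \<exists>x\<in>A. dist x y < d"
      using maximal_separated_exists[OF d(1)] by metis
    define G where "G = A \<inter> ball x1 R'"
    have G: "finite G" unfolding G_def by (rule separated_bounded_finite[OF A(1) d(1)])
    define \<eta> where "\<eta> i = pou G d i" for i
    have \<eta>m: "\<eta> i \<in> borel_measurable borel" for i unfolding \<eta>_def by (rule pou_measurable)
    have \<eta>0: "0 \<le> \<eta> i z" for i z unfolding \<eta>_def by (rule pou_range)
    have \<eta>near: "dist z i < h" if "\<eta> i z \<noteq> 0" for i z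
    proof -
      have "\<not> 2 * d \<le> dist i z" using that pou_eq_0[of d i z G] d by (auto simp: \<eta>_def)
      then show ?thesis using d by (simp add: dist_commute)
    qed
    have \<eta>1: "(\<Sum>i\<in>G. \<eta> i z) = 1" if "\<phi> z \<noteq> 0" for z
    proof -
      obtain i where i: "i \<in> A" "dist i z < d" using A by blast
      have "dist x1 z < \<bar>R\<bar>" using supp[of z] that by force
      then have "i \<in> G" using i d dist_triangle2[of x1 i z] by (auto simp: G_def R'_def)
      then show ?thesis unfolding \<eta>_def using i G d by (intro pou_sum)
    qed
    define c where "c i = (LINT z|\<mu>. \<eta> i z * \<phi> z)" for i
    have ic: "integrable \<mu> (\<lambda>z. \<eta> i z * \<phi> z)" for i
      using \<eta>m \<eta>0 pou_range(2) by (intro integral_mult_bound(1)[OF \<phi>, of _ 1]) (auto simp: \<eta>_def)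
    \<comment> \<open>Used twice: with \<open>H z = s z y\<close> for fixed \<open>y\<close> it
      expresses \<open>\<rho>\<close>, with \<open>H = F\<close> it expresses the error of the
      Riemann sum for the scalar integral.\<close>
    have decomp: "(LINT z|\<mu>. H z * \<phi> z) - (\<Sum>i\<in>G. c i * H i)
      = (LINT z|\<mu>. (\<Sum>i\<in>G. \<eta> i z * (H z - H i)) * \<phi> z)"
      if "integrable \<mu> (\<lambda>z. H z * \<phi> z)" for H :: "'a \<Rightarrow> real"
    proof -
      have "(\<Sum>i\<in>G. \<eta> i z * (H z - H i)) * \<phi> z = H z * \<phi> z - (\<Sum>i\<in>G. H i * (\<eta> i z * \<phi> z))" for z
      proof (cases "\<phi> z = 0")
        case False
        have "(\<Sum>i\<in>G. \<eta> i z * (H z - H i)) = (\<Sum>i\<in>G. \<eta> i z) * H z - (\<Sum>i\<in>G. \<eta> i z * H i)"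
          by (simp add: right_diff_distrib sum_subtractf sum_distrib_right)
        moreover have "(\<Sum>i\<in>G. H i * (\<eta> i z * \<phi> z)) = (\<Sum>i\<in>G. \<eta> i z * H i) * \<phi> z"
          unfolding sum_distrib_right by (intro sum.cong) (auto simp: mult_ac)
        ultimately show ?thesis
          using \<eta>1[OF False] by (simp add: left_diff_distrib)
      qed simp
      then have "(LINT z|\<mu>. (\<Sum>i\<in>G. \<eta> i z * (H z - H i)) * \<phi> z)
         = (LINT z|\<mu>. H z * \<phi> z - (\<Sum>i\<in>G. H i * (\<eta> i z * \<phi> z)))" by simp
      also have "\<dots> = (LINT z|\<mu>. H z * \<phi> z) - (\<Sum>i\<in>G. H i * c i)"
        using that ic by (subst Bochner_Integration.integral_diff) (auto simp: c_def)
      finally show ?thesis by (simp add: mult.commute)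
    qed
    have average: "\<bar>\<Sum>i\<in>G. \<eta> i z * u i\<bar> \<le> t" if "\<phi> z \<noteq> 0" "\<And>i. i \<in> G \<Longrightarrow> \<eta> i z \<noteq> 0 \<Longrightarrow> \<bar>u i\<bar> \<le> t"
      for z t and u :: "'a \<Rightarrow> real"
    proof -
      have "\<bar>\<Sum>i\<in>G. \<eta> i z * u i\<bar> \<le> (\<Sum>i\<in>G. \<bar>\<eta> i z * u i\<bar>)" by (rule sum_abs)
      also have "\<dots> \<le> (\<Sum>i\<in>G. \<eta> i z * t)"
      proof (rule sum_mono)
        fix i assume "i \<in> G"
        then show "\<bar>\<eta> i z * u i\<bar> \<le> \<eta> i z * t"
          using that(2)[of i] \<eta>0[of i z] by (cases "\<eta> i z = 0") (auto simp: abs_mult mult_left_mono)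
      qed
      also have "\<dots> = t" using \<eta>1[OF that(1)] by (simp flip: sum_distrib_right)
      finally show ?thesis .
    qed
    have iG: "dist x1 i \<le> R'" if "i \<in> G" for i using that by (simp add: G_def)
    have ey: "\<bar>s z y - s i y\<bar> \<le> s1" if "\<phi> z \<noteq> 0" "\<eta> i z \<noteq> 0" for z i y
      using h(2)[of z i y] suppR[OF that(1)] \<eta>near[OF that(2)] by simp
    have eF: "\<bar>F z - F i\<bar> \<le> e" if "\<phi> z \<noteq> 0" "\<eta> i z \<noteq> 0" "i \<in> G" for z i
    proof -
      have "tb x1 1 \<epsilon> \<epsilon> (B + B) (\<lambda>y. s z y - s i y)"
        using suppR[OF that(1)] iG[OF that(3)] by (intro tb_diff B) auto
      then have "tb x1 1 \<epsilon> \<epsilon> B' (\<lambda>y. s z y - s i y)" using B' by (elim tb_mono) simp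
      then have "\<bar>f (\<lambda>y. s z y - s i y)\<bar> \<le> e"
        using ey[OF that(1,2)] s1 by (intro s0) (auto intro: order_trans)
      then show ?thesis
        using dual_diff[OF f smooth_test[OF kern_smooth[OF s]] kern_smooth[OF s], of z i]
          by (simp add: F_def)
    qed
    define \<rho> where "\<rho> y = conv s \<phi> y - (\<Sum>i\<in>G. c i * s i y)" for y
    have \<rho>: "\<rho> y = (LINT z|\<mu>. (\<Sum>i\<in>G. \<eta> i z * (s z y - s i y)) * \<phi> z)" for y
    proof -
      have "\<bar>s z y\<bar> \<le> B * W \<epsilon> 1 x1 y" if "\<phi> z \<noteq> 0" for z
        using tb_size[OF B(2)] suppR[OF that] by simp
      then have "integrable \<mu> (\<lambda>z. s z y * \<phi> z)"
        using integral_mult_bound(1)[OF \<phi>, of "\<lambda>z. s z y"] m by auto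
      then show ?thesis unfolding \<rho>_def conv_def by (rule decomp)
    qed
    have \<rho>m: "(\<lambda>z. \<Sum>i\<in>G. \<eta> i z * (s z y - s i y)) \<in> borel_measurable borel" for y
      using \<eta>m m by measurable
    have "tb x1 1 \<epsilon> \<epsilon> (2 * B * I) \<rho>"
      unfolding \<rho>[abs_def] I_def
    proof (rule tb_integral[OF \<phi> \<rho>m])
      fix z assume z: "\<phi> z \<noteq> 0"
      have "tb x1 1 \<epsilon> \<epsilon> (\<Sum>i\<in>G. \<bar>\<eta> i z\<bar> * (B + B)) (\<lambda>y. \<Sum>i\<in>G. \<eta> i z * (s z y - s i y))"
        using suppR[OF z] iG by (intro tb_sum G tb_scale tb_diff B) auto
      moreover have "(\<Sum>i\<in>G. \<bar>\<eta> i z\<bar> * (B + B)) = 2 * B"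
        using \<eta>1[OF z] \<eta>0 by (simp flip: sum_distrib_right)
      ultimately show "tb x1 1 \<epsilon> \<epsilon> (2 * B) (\<lambda>y. \<Sum>i\<in>G. \<eta> i z * (s z y - s i y))" by simp
    qed
    then have "tb x1 1 \<epsilon> \<epsilon> B' \<rho>" using B' by (elim tb_mono)
    moreover have "\<bar>\<rho> y\<bar> \<le> s0" for y
    proof -
      have "\<bar>\<rho> y\<bar> \<le> s1 * I"
        unfolding \<rho> I_def using \<rho>m average ey by (intro integral_mult_bound(2)[OF \<phi>]) auto
      then show ?thesis using s1 by simp
    qed
    ultimately have f\<rho>: "\<bar>f \<rho>\<bar> \<le> e" by (rule s0)
    have ss: "smooth (\<lambda>y. c i * s i y)" for i by (intro smooth_scale kern_smooth[OF s])
    have "f (\<lambda>y. \<Sum>i\<in>G. c i * s i y) = (\<Sum>i\<in>G. c i * F i)"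
      using dual_sum[OF f G, of "\<lambda>i y. c i * s i y"] ss dual_scale[OF f smooth_test[OF
        kern_smooth[OF s]]]
      by (simp add: F_def)
    then have "f \<rho> = f (conv s \<phi>) - (\<Sum>i\<in>G. c i * F i)"
      unfolding \<rho>_def[abs_def]
      using dual_diff[OF f smooth_test[OF sm], of "\<lambda>y. \<Sum>i\<in>G. c i * s i y"] smooth_sum[OF G] ss by simp
    moreover have "\<bar>(LINT z|\<mu>. F z * \<phi> z) - (\<Sum>i\<in>G. c i * F i)\<bar> \<le> e * I"
      unfolding decomp[OF iF] I_def
      using average eF \<eta>m mF by (intro integral_mult_bound(2)[OF \<phi>]) auto
    ultimately show ?thesis using f\<rho> by (simp add: algebra_simps)
  qed
  have "\<bar>f (conv s \<phi>) - (LINT z|\<mu>. F z * \<phi> z)\<bar> \<le> 0"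
  proof (rule field_le_epsilon)
    fix e :: real assume "e > 0"
    then show "\<bar>f (conv s \<phi>) - (LINT z|\<mu>. F z * \<phi> z)\<bar> \<le> 0 + e"
      using main[of "e / (1 + I)"] I by simp
  qed
  then show "f (conv s \<phi>) = (LINT z|\<mu>. f (s z) * \<phi> z)" by (simp add: F_def)
qed

end

subsection \<open>Decomposition at the scale of the kernel\<close>

context hardy_setting
begin

text \<open>Since the columns have integral 1, \<open>conv s \<phi> y - \<phi> y\<close> is an
  integral of \<phi> z - \<phi> y, and the gain comes from \<open>W_mult_diff_le\<close>. The
  regularity bound is stated at scale \<delta> and for distances up to \<open>\<delta> / 2\<close>,
  the form \<open>tb_bump\<close> asks for.\<close>

lemma remainder_bounds:
  obtains K where "K > 0"
    "\<And>\<delta> s r x C \<phi> y. kern \<delta> s \<Longrightarrow> \<delta> \<le> r \<Longrightarrow> tb x r \<beta> \<gamma> C \<phi> \<Longrightarrow>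
       \<bar>\<phi> y - conv s \<phi> y\<bar> \<le> K * C * (\<delta> / r) powr \<beta> * W \<gamma> r x y"
    "\<And>\<delta> s r x C \<phi> y y'. kern \<delta> s \<Longrightarrow> \<delta> \<le> r \<Longrightarrow> tb x r \<beta> \<gamma> C \<phi> \<Longrightarrow> dist y y' \<le> \<delta> / 2 \<Longrightarrow>
       \<bar>(\<phi> y' - conv s \<phi> y') - (\<phi> y - conv s \<phi> y)\<bar>
         \<le> K * C * (\<delta> / r) powr \<beta> * W \<gamma> r x y * (dist y y' / \<delta>) powr \<beta>"
proof -
  have g1: "\<epsilon>2 - \<beta> > 0" using beta eps by simp
  obtain c1 where c1: "c1 > 0"
    "\<And>r x. r > 0 \<Longrightarrow> integrable \<mu> (W (\<epsilon>2 - \<beta>) r x) \<and> (LINT y|\<mu>. W (\<epsilon>2 - \<beta>) r x y) \<le> c1"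
    using integral_W[OF g1] by metis
  obtain c2 where c2: "c2 > 0"
    "\<And>r x. r > 0 \<Longrightarrow> integrable \<mu> (W \<gamma> r x) \<and> (LINT y|\<mu>. W \<gamma> r x y) \<le> c2"
    using integral_W[OF bg_pos(2)] by metis
  define K0 where "K0 = (2 + C1 * 4 powr n * 2 powr \<epsilon>2) * (c1 + c2)"
  have K0: "K0 > 0" using C1_ge c1 c2 by (auto simp: K0_def intro!: mult_pos_pos add_pos_nonneg)
  \<comment> \<open>Regularity in the second variable is a property of the row at \<open>z\<close>,
    hence centred at \<open>z\<close>; \<open>c3\<close> is the price of recentring at
    \<open>y\<close>.\<close>
  define c3 where "c3 = C1 * 2 powr (n + \<epsilon>2)"
  have c3: "c3 \<ge> 1" using C1_ge n_pos eps mult_mono[of 1 C1 1 "2 powr (n + \<epsilon>2)"]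
    by (simp add: c3_def ge_one_powr_ge_zero)
  define K where "K = 1 + c3 * C4 * K0"
  have K: "K > 0" "C4 * K0 \<le> K" "1 + C4 * c3 * K0 \<le> K"
  proof -
    have "C4 * K0 * 1 \<le> C4 * K0 * c3" using C4 K0 c3 by (intro mult_left_mono) auto
    moreover have "K = 1 + C4 * K0 * c3" by (simp add: K_def mult_ac)
    moreover have "C4 * K0 > 0" using C4 K0 by simp
    ultimately show "K > 0" "C4 * K0 \<le> K" "1 + C4 * c3 * K0 \<le> K" by (auto simp: mult_ac)
  qed
  \<comment> \<open>Applied to \<open>h\<close> a column and to \<open>h\<close> a difference of two
    columns. The latter has integral 0, so the same \<open>\<phi> y\<close> may be subtracted, and
    \<open>B\<close> then carries the factor
    \<open>(dist y y' / \<delta>) powr \<beta>\<close>.\<close>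
  have core: "integrable \<mu> (\<lambda>z. h z * (\<phi> z - \<phi> y))"
      "\<bar>LINT z|\<mu>. h z * (\<phi> z - \<phi> y)\<bar> \<le> B * K0 * C * (\<delta> / r) powr \<beta> * W \<gamma> r x y"
    if s: "0 < \<delta>" "\<delta> \<le> r" and \<phi>: "tb x r \<beta> \<gamma> C \<phi>" and m: "h \<in> borel_measurable borel"
      and h: "\<And>z. \<bar>h z\<bar> \<le> B * W \<epsilon>2 \<delta> y z" and B: "B \<ge> 0" for \<delta> r x C \<phi> y B and h :: "'a \<Rightarrow> real"
  proof -
    have r: "r > 0" using s by simp
    have C: "C \<ge> 0" using tb_const_nonneg[OF r \<phi>] .
    define Q where "Q = B * (2 + C1 * 4 powr n * 2 powr \<epsilon>2) * C * (\<delta> / r) powr \<beta> * W \<gamma> r x y"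
    have Q: "Q \<ge> 0" using B C C1_ge by (simp add: Q_def)
    have pt: "\<bar>h z * (\<phi> z - \<phi> y)\<bar> \<le> Q * (W (\<epsilon>2 - \<beta>) \<delta> y z + W \<gamma> r x z)" for z
    proof -
      have "\<bar>h z * (\<phi> z - \<phi> y)\<bar> \<le> B * (W \<epsilon>2 \<delta> y z * \<bar>\<phi> z - \<phi> y\<bar>)"
        using mult_right_mono[OF h[of z] abs_ge_zero[of "\<phi> z - \<phi> y"]] by (simp add: abs_mult mult.assoc)
      also have "\<dots> \<le> B * ((2 + C1 * 4 powr n * 2 powr \<epsilon>2) * C * (\<delta> / r) powr \<beta> * W \<gamma> r x y *
          (W (\<epsilon>2 - \<beta>) \<delta> y z + W \<gamma> r x z))"
        using beta gamma eps bg_pos le1 s \<phi> B by (intro mult_left_mono W_mult_diff_le) auto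
      finally show ?thesis by (simp add: Q_def mult_ac)
    qed
    have i: "integrable \<mu> (\<lambda>z. Q * (W (\<epsilon>2 - \<beta>) \<delta> y z + W \<gamma> r x z))"
      using c1(2)[OF s(1)] c2(2)[OF r] by auto
    have m': "\<phi> \<in> borel_measurable borel" using tb_measurable[OF r bg_pos(1) \<phi>] .
    show int: "integrable \<mu> (\<lambda>z. h z * (\<phi> z - \<phi> y))"
    proof (rule Bochner_Integration.integrable_bound[OF i])
      show "(\<lambda>z. h z * (\<phi> z - \<phi> y)) \<in> borel_measurable \<mu>" using m m' by simp
      show "AE z in \<mu>. norm (h z * (\<phi> z - \<phi> y)) \<le> norm (Q * (W (\<epsilon>2 - \<beta>) \<delta> y z + W \<gamma> r x z))"
        using pt Q by (intro AE_I2) (simp add: abs_of_nonneg)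
    qed
    have "\<bar>LINT z|\<mu>. h z * (\<phi> z - \<phi> y)\<bar> \<le> (LINT z|\<mu>. \<bar>h z * (\<phi> z - \<phi> y)\<bar>)"
      by (rule integral_abs_bound)
    also have "\<dots> \<le> (LINT z|\<mu>. Q * (W (\<epsilon>2 - \<beta>) \<delta> y z + W \<gamma> r x z))"
      by (rule integral_mono[OF integrable_abs[OF int] i pt])
    also have "\<dots> = Q * ((LINT z|\<mu>. W (\<epsilon>2 - \<beta>) \<delta> y z) + (LINT z|\<mu>. W \<gamma> r x z))"
      using c1(2)[OF s(1)] c2(2)[OF r] by simp
    also have "\<dots> \<le> Q * (c1 + c2)"
      using c1(2)[OF s(1), of y] c2(2)[OF r, of x] Q by (intro mult_left_mono add_mono) auto
    finally show "\<bar>LINT z|\<mu>. h z * (\<phi> z - \<phi> y)\<bar> \<le> B * K0 * C * (\<delta> / r) powr \<beta> * W \<gamma> r x y"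
      by (simp add: Q_def K0_def mult_ac)
  qed
  have sz: "\<bar>s z y\<bar> \<le> C4 * W \<epsilon>2 \<delta> y z" if "kern \<delta> s" for \<delta> s y z
    using tb_size[OF kernD(3)[OF that]] .
  \<comment> \<open>The integral of a non-integrable function is 0 by convention, so the value 1
    forces integrability.\<close>
  have si: "integrable \<mu> (\<lambda>z. s z y)" if "kern \<delta> s" for \<delta> s y
  proof -
    have "(LINT z|\<mu>. s z y) \<noteq> 0" using kernD(4)[OF that, of y] by simp
    then show ?thesis using not_integrable_integral_eq by blast
  qed
  have ci: "integrable \<mu> (\<lambda>z. s z v * \<phi> z)"
    if s: "kern \<delta> s" "\<delta> \<le> r" and \<phi>: "tb x r \<beta> \<gamma> C \<phi>" for \<delta> s r x C \<phi> v
  proof -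
    have "integrable \<mu> (\<lambda>z. s z v * (\<phi> z - \<phi> v) + s z v * \<phi> v)"
      using core(1)[OF kernD(1)[OF s(1)] s(2) \<phi> kern_measurable[OF s(1)] sz[OF s(1)]] C4 si[OF
        s(1)] by simp
    then show ?thesis by (simp add: algebra_simps)
  qed
  have 1: "\<bar>\<phi> y - conv s \<phi> y\<bar> \<le> K * C * (\<delta> / r) powr \<beta> * W \<gamma> r x y"
    if s: "kern \<delta> s" "\<delta> \<le> r" and \<phi>: "tb x r \<beta> \<gamma> C \<phi>" for \<delta> s r x C \<phi> y
  proof -
    have C: "C \<ge> 0" using tb_const_nonneg[OF _ \<phi>] kernD(1)[OF s(1)] s(2) by auto
    have "(LINT z|\<mu>. s z y * (\<phi> z - \<phi> y)) = conv s \<phi> y - (LINT z|\<mu>. s z y * \<phi> y)"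
      unfolding conv_def right_diff_distrib using ci[OF s \<phi>] si[OF s(1)] by simp
    then have "conv s \<phi> y - \<phi> y = (LINT z|\<mu>. s z y * (\<phi> z - \<phi> y))" using kernD(4)[OF s(1)] by simp
    then have "\<bar>\<phi> y - conv s \<phi> y\<bar> \<le> (C4 * K0) * (C * (\<delta> / r) powr \<beta> * W \<gamma> r x y)"
      using core(2)[OF kernD(1)[OF s(1)] s(2) \<phi> kern_measurable[OF s(1)] sz[OF s(1)], of y] C4
      by (simp add: abs_minus_commute mult.assoc)
    also have "\<dots> \<le> K * (C * (\<delta> / r) powr \<beta> * W \<gamma> r x y)" using K C by (intro mult_right_mono) auto
    finally show ?thesis by (simp add: mult.assoc)
  qed
  have 2: "\<bar>(\<phi> y' - conv s \<phi> y') - (\<phi> y - conv s \<phi> y)\<bar>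
         \<le> K * C * (\<delta> / r) powr \<beta> * W \<gamma> r x y * (dist y y' / \<delta>) powr \<beta>"
    if s: "kern \<delta> s" "\<delta> \<le> r" and \<phi>: "tb x r \<beta> \<gamma> C \<phi>" and d: "dist y y' \<le> \<delta> / 2" for \<delta> s r x C \<phi> y y'
  proof -
    have \<delta>: "\<delta> > 0" and r: "r > 0" using kernD(1)[OF s(1)] s(2) by auto
    have C: "C \<ge> 0" using tb_const_nonneg[OF r \<phi>] .
    define q where "q = (dist y y' / \<delta>) powr \<beta>"
    have q: "q \<ge> 0" by (simp add: q_def)
    define X where "X = C * (\<delta> / r) powr \<beta> * W \<gamma> r x y"
    have X: "X \<ge> 0" using C by (simp add: X_def)
    have hb: "\<bar>s z y' - s z y\<bar> \<le> (C4 * c3 * q) * W \<epsilon>2 \<delta> y z" for z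
    proof -
      have "dist y y' \<le> (\<delta> + dist z y) / 2" using d zero_le_dist[of z y] by argo
      from tb_reg[OF kernD(2)[OF s(1)] this]
      have "\<bar>s z y' - s z y\<bar> \<le> C4 * (dist y y' / (\<delta> + dist z y)) powr \<epsilon>1 * W \<epsilon>2 \<delta> z y" .
      also have "\<dots> \<le> C4 * q * (c3 * W \<epsilon>2 \<delta> y z)"
      proof (intro mult_mono mult_left_mono)
        have "(dist y y' / (\<delta> + dist z y)) powr \<epsilon>1 \<le> (dist y y' / \<delta>) powr \<epsilon>1"
          using \<delta> eps by (intro powr_mono2 divide_left_mono mult_pos_pos add_pos_nonneg) auto
        also have "\<dots> \<le> q" unfolding q_def using d \<delta> eps beta
          by (intro powr_mono') (auto simp: field_simps)
        finally show "(dist y y' / (\<delta> + dist z y)) powr \<epsilon>1 \<le> q" .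
        show "W \<epsilon>2 \<delta> z y \<le> c3 * W \<epsilon>2 \<delta> y z" unfolding c3_def using \<delta> eps by (intro W_sym) auto
      qed (use C4 q c3 in auto)
      finally show ?thesis by (simp add: mult_ac)
    qed
    have m: "(\<lambda>z. s z y' - s z y) \<in> borel_measurable borel" using kern_measurable[OF s(1)] by simp
    have "(LINT z|\<mu>. (s z y' - s z y) * (\<phi> z - \<phi> y)) = conv s \<phi> y' - conv s \<phi> y"
    proof -
      have "(s z y' - s z y) * (\<phi> z - \<phi> y)
          = s z y' * \<phi> z - s z y * \<phi> z - (s z y' * \<phi> y - s z y * \<phi> y)" for z
            by (simp add: algebra_simps)
      then show ?thesis
        unfolding conv_def using ci[OF s \<phi>] si[OF s(1)] kernD(4)[OF s(1)] by simp
    qed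
    then have a: "\<bar>conv s \<phi> y' - conv s \<phi> y\<bar> \<le> (C4 * c3 * q) * K0 * X"
      using core(2)[OF \<delta> s(2) \<phi> m hb] C4 c3 q by (simp add: X_def mult.assoc)
    have "\<bar>\<phi> y' - \<phi> y\<bar> \<le> C * (dist y y' / (r + dist x y)) powr \<beta> * W \<gamma> r x y"
      using d s(2) zero_le_dist[of x y] by (intro tb_reg[OF \<phi>]) argo
    also have "\<dots> \<le> C * (q * (\<delta> / r) powr \<beta>) * W \<gamma> r x y"
    proof (intro mult_right_mono mult_left_mono)
      have "(dist y y' / (r + dist x y)) powr \<beta> \<le> ((dist y y' / \<delta>) * (\<delta> / r)) powr \<beta>"
        using \<delta> r bg_pos by (intro powr_mono2) (auto intro!: divide_left_mono mult_pos_pos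
          add_pos_nonneg)
      also have "\<dots> = q * (\<delta> / r) powr \<beta>" unfolding q_def by (rule powr_mult)
      finally show "(dist y y' / (r + dist x y)) powr \<beta> \<le> q * (\<delta> / r) powr \<beta>" .
    qed (use C in auto)
    also have "\<dots> = q * X" by (simp add: X_def mult_ac)
    finally have b: "\<bar>\<phi> y' - \<phi> y\<bar> \<le> q * X" .
    have "\<bar>(\<phi> y' - conv s \<phi> y') - (\<phi> y - conv s \<phi> y)\<bar> \<le> (1 + C4 * c3 * K0) * (q * X)"
      using a b by (simp add: algebra_simps)
    also have "\<dots> \<le> K * (q * X)" using K q X by (intro mult_right_mono) auto
    finally show ?thesis by (simp add: X_def q_def mult_ac)
  qed
  show ?thesis by (rule that[OF K(1) 1 2])
qed

text \<open>The nontangential variant of the localized grand maximal function is lower semicontinuous,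
  hence measurable, and comparable with the original one.\<close>

definition nt_max :: "real \<Rightarrow> (('a \<Rightarrow> real) \<Rightarrow> real) \<Rightarrow> 'a \<Rightarrow> ennreal" where
  "nt_max \<delta> f y = Sup {ennreal \<bar>f \<phi>\<bar> | \<phi>. \<phi> \<in> test \<and>
     (\<exists>x r. 0 < r \<and> r \<le> \<delta> \<and> dist x y < r \<and> tb x r \<beta> \<gamma> 1 \<phi>)}"

lemma test_scale:
  assumes "\<phi> \<in> test"
  shows "(\<lambda>y. c * \<phi> y) \<in> test"
  unfolding test_iff
proof (intro conjI allI impI)
  show "\<exists>C. tb x1 1 \<beta> \<gamma> C (\<lambda>y. c * \<phi> y)" using assms tb_scale unfolding test_iff by blast
  fix e :: real assume e: "e > 0"
  define e' where "e' = e / (\<bar>c\<bar> + 1)"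
  have e': "e' > 0" "\<bar>c\<bar> * e' \<le> e" using e by (auto simp: e'_def field_simps)
  obtain g where g: "smooth g" "tb x1 1 \<beta> \<gamma> e' (\<lambda>y. \<phi> y - g y)"
    using assms e' unfolding test_iff by blast
  have "tb x1 1 \<beta> \<gamma> e (\<lambda>y. c * (\<phi> y - g y))"
    using tb_mono[OF tb_scale[OF g(2)] e'(2)] .
  then show "\<exists>h. smooth h \<and> tb x1 1 \<beta> \<gamma> e (\<lambda>y. c * \<phi> y - h y)"
    using smooth_scale[OF g(1), of c] by (intro exI[of _ "\<lambda>y. c * g y"]) (auto simp: right_diff_distrib)
qed

lemma nt_max_upper:
  assumes f: "f \<in> dual" and \<phi>: "\<phi> \<in> test" "tb x r \<beta> \<gamma> C \<phi>" and r: "0 < r" "r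
    \<le> \<delta>" "dist x y < r" and C: "C > 0"
  shows "ennreal \<bar>f \<phi>\<bar> \<le> ennreal C * nt_max \<delta> f y"
proof -
  define \<psi> where "\<psi> = (\<lambda>y. (1 / C) * \<phi> y)"
  have "tb x r \<beta> \<gamma> (\<bar>1 / C\<bar> * C) \<psi>" unfolding \<psi>_def by (rule tb_scale[OF \<phi>(2)])
  then have "tb x r \<beta> \<gamma> 1 \<psi>" using C by simp
  moreover have "\<psi> \<in> test" unfolding \<psi>_def by (rule test_scale[OF \<phi>(1)])
  ultimately have "ennreal \<bar>f \<psi>\<bar> \<le> nt_max \<delta> f y"
    unfolding nt_max_def using r by (intro Sup_upper) blast
  then have "ennreal C * ennreal \<bar>f \<psi>\<bar> \<le> ennreal C * nt_max \<delta> f y" by (rule mult_left_mono) simp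
  moreover have "f \<psi> = (1 / C) * f \<phi>" unfolding \<psi>_def by (rule dual_scale[OF f \<phi>(1)])
  then have "ennreal C * ennreal \<bar>f \<psi>\<bar> = ennreal \<bar>f \<phi>\<bar>"
    using C by (simp add: abs_mult flip: ennreal_mult)
  ultimately show ?thesis by simp
qed

text \<open>The condition \<open>dist x y < r\<close> is open in \<open>y\<close>: a test function
  witnessing \<open>t < nt_max \<delta> f y\<close> also does so on the ball of radius
  \<open>r - dist x y\<close> around \<open>y\<close>.\<close>

lemma nt_max_measurable [measurable]: "nt_max \<delta> f \<in> borel_measurable borel"
proof (rule borel_measurableI_greater)
  fix t
  have "open {y. t < nt_max \<delta> f y}"
    unfolding open_contains_ball
  proof
    fix y assume "y \<in> {y. t < nt_max \<delta> f y}"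
    then obtain \<phi> x r where *: "t < ennreal \<bar>f \<phi>\<bar>" "\<phi> \<in> test" "0 < r" "r
      \<le> \<delta>" "dist x y < r" "tb x r \<beta> \<gamma> 1 \<phi>"
      by (auto simp: nt_max_def less_Sup_iff)
    have "ball y (r - dist x y) \<subseteq> {y. t < nt_max \<delta> f y}"
    proof
      fix y' assume "y' \<in> ball y (r - dist x y)"
      then have "dist x y' < r" using dist_triangle[of x y' y] by simp
      then have "ennreal \<bar>f \<phi>\<bar> \<le> nt_max \<delta> f y'"
        unfolding nt_max_def using * by (intro Sup_upper) blast
      then show "y' \<in> {y. t < nt_max \<delta> f y}" using * by auto
    qed
    then show "\<exists>e>0. ball y e \<subseteq> {y. t < nt_max \<delta> f y}"
      using * by (intro exI[of _ "r - dist x y"]) simp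
  qed
  then show "{y \<in> space borel. t < nt_max \<delta> f y} \<in> sets borel" by simp
qed

text \<open>Recentring from \<open>x\<close> to \<open>y\<close> at the same scale costs
  \<open>chg_const 1 \<gamma>\<close>; the factor 2 is the way back from \<open>tb\<close> to
  \<open>test_bound\<close>.\<close>

lemma nt_max_le_grand_max_loc:
  assumes f: "f \<in> dual"
  shows "nt_max (2 powr (- l)) f y \<le> ennreal (2 * chg_const 1 \<gamma>) * grand_max_loc \<mu> x1 \<epsilon> \<beta> \<gamma> l f y"
  unfolding nt_max_def
proof (rule Sup_least, clarify)
  fix \<phi> x r
  assume *: "\<phi> \<in> test" "0 < r" "r \<le> 2 powr (- real_of_int l)" "dist x y < r" "tb x r \<beta> \<gamma> 1 \<phi>"
  define c where "c = 2 * chg_const 1 \<gamma>"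
  have c: "c > 0" using chg_const_pos[of 1 \<gamma>] by (simp add: c_def)
  define \<psi> where "\<psi> = (\<lambda>y. (1 / c) * \<phi> y)"
  have "tb y r \<beta> \<gamma> (chg_const 1 \<gamma> * 1) \<phi>"
    using * bg_pos le1 by (intro tb_change[of r r 1 x y]) auto
  then have "tb y r \<beta> \<gamma> (\<bar>1 / c\<bar> * (chg_const 1 \<gamma> * 1)) \<psi>" unfolding \<psi>_def by (rule tb_scale)
  then have tb: "test_bound \<mu> y r \<beta> \<gamma> (2 * (\<bar>1 / c\<bar> * (chg_const 1 \<gamma> * 1))) \<psi>"
    using * by (intro test_bound_of_tb)
  have "2 * (\<bar>1 / c\<bar> * (chg_const 1 \<gamma> * 1)) = 1" using c by (simp add: c_def)
  then have tb1: "test_bound \<mu> y r \<beta> \<gamma> 1 \<psi>" using tb by (simp only:)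
  have "\<psi> \<in> test" unfolding \<psi>_def by (rule test_scale[OF *(1)])
  moreover have "\<psi> \<in> Gset \<mu> y r \<beta> \<gamma>" "Gnorm \<mu> y r \<beta> \<gamma> \<psi> \<le> 1"
    using tb1 Gnorm_le by (auto simp: Gset_def)
  ultimately have "ennreal \<bar>f \<psi>\<bar> \<le> grand_max_loc \<mu> x1 \<epsilon> \<beta> \<gamma> l f y"
    unfolding grand_max_loc_def using * by (intro Sup_upper) auto
  then have "ennreal c * ennreal \<bar>f \<psi>\<bar> \<le> ennreal c * grand_max_loc \<mu> x1 \<epsilon> \<beta> \<gamma> l f y"
    by (rule mult_left_mono) simp
  moreover have "f \<psi> = (1 / c) * f \<phi>" unfolding \<psi>_def by (rule dual_scale[OF f *(1)])
  then have "ennreal c * ennreal \<bar>f \<psi>\<bar> = ennreal \<bar>f \<phi>\<bar>"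
    using c by (simp add: abs_mult flip: ennreal_mult)
  ultimately show "ennreal \<bar>f \<phi>\<bar> \<le> ennreal (2 * chg_const 1 \<gamma>) * grand_max_loc \<mu> x1 \<epsilon> \<beta> \<gamma> l f y"
    by (simp add: c_def)
qed

text \<open>A test function of scale \<delta> centred at \<open>i\<close> is admissible for
  \<open>nt_max \<delta> f\<close> at each point of \<open>ball i \<delta>\<close>, so the infimum
  bounds its pairing. Its p-th power times the volume of the ball is below an integral over that
  ball.\<close>

definition nt_inf :: "real \<Rightarrow> (('a \<Rightarrow> real) \<Rightarrow> real) \<Rightarrow> 'a \<Rightarrow> ennreal" where
  "nt_inf \<delta> f i = (INF u\<in>ball i \<delta>. nt_max \<delta> f u)"

lemma nt_inf_upper:
  assumes f: "f \<in> dual" and \<phi>: "\<phi> \<in> test" "tb i \<delta> \<beta> \<gamma> C \<phi>" and \<delta>: "\<delta> > 0" and C: "C > 0"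
  shows "ennreal \<bar>f \<phi>\<bar> \<le> ennreal C * nt_inf \<delta> f i"
proof -
  have "ennreal (\<bar>f \<phi>\<bar> / C) \<le> nt_inf \<delta> f i"
    unfolding nt_inf_def
  proof (rule INF_greatest)
    fix u assume "u \<in> ball i \<delta>"
    then have "ennreal \<bar>f \<phi>\<bar> \<le> ennreal C * nt_max \<delta> f u"
      using assms by (intro nt_max_upper) auto
    then have "ennreal (1 / C) * ennreal \<bar>f \<phi>\<bar> \<le> ennreal (1 / C) * (ennreal C * nt_max \<delta> f u)"
      by (rule mult_left_mono) simp
    also have "\<dots> = nt_max \<delta> f u" using C by (simp add: mult.assoc[symmetric] flip: ennreal_mult)
    finally show "ennreal (\<bar>f \<phi>\<bar> / C) \<le> nt_max \<delta> f u" using C by (simp flip: ennreal_mult)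
  qed
  then have "ennreal C * ennreal (\<bar>f \<phi>\<bar> / C) \<le> ennreal C * nt_inf \<delta> f i" by (rule mult_left_mono) simp
  then show ?thesis using C by (simp flip: ennreal_mult)
qed

section \<open>Truncation, and the remainder at scales above \<delta>\<close>

lemma smooth_integrable:
  assumes "smooth g"
  shows "integrable \<mu> g"
proof -
  obtain B where B: "tb x1 1 \<epsilon> \<epsilon> B g" using assms by (auto simp: smooth_def)
  have B0: "B \<ge> 0" using tb_const_nonneg[OF _ B] by simp
  obtain c where c: "c > 0" "\<And>r x. r > 0 \<Longrightarrow> integrable \<mu> (W \<epsilon> r x) \<and> (LINT y|\<mu>. W \<epsilon> r x y) \<le> c"
    using integral_W[OF eps(1)] by metis
  have i: "integrable \<mu> (\<lambda>y. B * W \<epsilon> 1 x1 y)" using c(2)[of 1 x1] by simp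
  show ?thesis
  proof (rule Bochner_Integration.integrable_bound[OF i])
    show "AE y in \<mu>. norm (g y) \<le> norm (B * W \<epsilon> 1 x1 y)"
      using tb_size[OF B] B0 by (intro AE_I2) (simp add: abs_of_nonneg)
  qed (use smooth_measurable[OF assms] in simp)
qed

lemma smooth_tb_at:
  assumes \<psi>: "smooth \<psi>" and r: "r > 0"
  obtains B where "B \<ge> 0" "tb x r \<epsilon> \<epsilon> B \<psi>"
proof -
  obtain B where B: "tb x1 1 \<epsilon> \<epsilon> B \<psi>" using \<psi> by (auto simp: smooth_def)
  obtain K where K: "K > 0" "\<And>x' y C h. dist x' y \<le> dist x1 x \<Longrightarrow> tb x' 1 \<epsilon> \<epsilon> C h \<Longrightarrow> tb y r \<epsilon> \<epsilon> (K * C) h"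
    by (rule tb_recenter[of 1 r \<epsilon> \<epsilon> "dist x1 x"]) (use r eps le1 in auto)
  have "tb x r \<epsilon> \<epsilon> (K * B) \<psi>" by (rule K(2)[OF order_refl B])
  then show ?thesis using that tb_const_nonneg[OF r] by blast
qed

text \<open>As the radius \<open>\<rho>\<close> tends to infinity, the truncation error stays
  bounded in the smooth class and tends to 0 uniformly, so \<open>interpolation\<close> makes it
  small with the exponents \<beta>, \<gamma>. The cutoff is centred at \<open>x\<close> with
  \<open>\<rho> \<ge> r\<close> so that \<open>tb_cutoff\<close> also preserves test bounds at
  \<open>x\<close> of scale \<open>r\<close>.\<close>

lemma cutoff_approx:
  assumes \<psi>: "smooth \<psi>" and e: "e > 0" and r: "r > 0"
  obtains \<rho> where "\<rho> \<ge> r" "smooth (\<lambda>y. \<psi> y * cutoff x \<rho> y)" "tb x1 1 \<beta> \<gamma> e (\<lambda>y. \<psi> y - \<psi> y * cutoff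
    x \<rho> y)"
proof -
  obtain B' where B': "B' \<ge> 0" and tb\<psi>: "tb x r \<epsilon> \<epsilon> B' \<psi>" using smooth_tb_at[OF \<psi> r] .
  obtain K' where K': "K' > 0" "\<And>x' y C h. dist x' y \<le> dist x x1 \<Longrightarrow> tb x' r \<epsilon> \<epsilon> C h
    \<Longrightarrow> tb y 1 \<epsilon> \<epsilon> (K' * C) h"
    by (rule tb_recenter[of r 1 \<epsilon> \<epsilon> "dist x x1"]) (use r eps le1 in auto)
  have cut: "tb x r \<epsilon> \<epsilon> (7 * B') (\<lambda>y. \<psi> y * cutoff x \<rho> y)" if "\<rho> \<ge> r" for \<rho>
    using that r eps le1 by (intro tb_cutoff tb\<psi>) auto
  have dif: "tb x1 1 \<epsilon> \<epsilon> (K' * (B' + 7 * B')) (\<lambda>y. \<psi> y - \<psi> y * cutoff x \<rho> y)" if "\<rho> \<ge> r" for \<rho>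
    by (rule K'(2)[OF order_refl tb_diff[OF tb\<psi> cut[OF that]]])
  obtain t where t: "t > 0" "\<And>h. tb x1 1 \<epsilon> \<epsilon> (K' * (B' + 7 * B')) h \<Longrightarrow> (\<forall>y. \<bar>h y\<bar> \<le> t) \<Longrightarrow> tb x1 1 \<beta> \<gamma> e h"
    using interpolation[of \<beta> \<epsilon> \<gamma> e "K' * (B' + 7 * B')" x1] bg_pos beta gamma e B' K' by auto
  have "((\<lambda>\<rho>. B' / V \<mu> r x * (r / \<rho>) powr \<epsilon>) \<longlongrightarrow> B' / V \<mu> r x * 0 powr \<epsilon>) at_top"
    using eps r by (intro tendsto_intros tendsto_powr' tendsto_divide_0[OF tendsto_const])
      (auto simp: filterlim_at_top_imp_at_infinity filterlim_ident intro!: eventually_mono[OF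
        eventually_ge_at_top[of 0]])
  then have "\<forall>\<^sub>F \<rho> in at_top. B' / V \<mu> r x * (r / \<rho>) powr \<epsilon> < t"
    using t eps by (intro order_tendstoD(2)) auto
  then have "\<forall>\<^sub>F \<rho> in at_top. B' / V \<mu> r x * (r / \<rho>) powr \<epsilon> < t \<and> \<rho> \<ge> r"
    by (intro eventually_conj eventually_ge_at_top)
  then obtain \<rho> where \<rho>: "B' / V \<mu> r x * (r / \<rho>) powr \<epsilon> < t" "\<rho> \<ge> r"
    unfolding eventually_at_top_linorder by blast
  have "\<bar>\<psi> y - \<psi> y * cutoff x \<rho> y\<bar> \<le> t" for y
  proof (cases "dist x y \<le> \<rho>")
    case True
    then show ?thesis using t r \<rho> by (simp add: cutoff_eq_1)
  next
    case False
    have "\<bar>\<psi> y - \<psi> y * cutoff x \<rho> y\<bar> = \<bar>\<psi> y\<bar> * (1 - cutoff x \<rho> y)"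
      using cutoff_range[of x \<rho> y]
        by (metis abs_mult abs_of_nonneg diff_ge_0_iff_ge mult.right_neutral right_diff_distrib)
    also have "\<dots> \<le> \<bar>\<psi> y\<bar> * 1" using cutoff_range[of x \<rho> y] by (intro mult_left_mono) auto
    also have "\<bar>\<psi> y\<bar> * 1 \<le> B' * W \<epsilon> r x y" using tb_size[OF tb\<psi>] by simp
    also have "W \<epsilon> r x y = W 0 r x y * (r / (r + dist x y)) powr (\<epsilon> - 0)" by (rule W_split[OF r])
    also have "\<dots> \<le> (1 / V \<mu> r x) * (r / \<rho>) powr \<epsilon>"
    proof (rule mult_mono)
      show "W 0 r x y \<le> 1 / V \<mu> r x" using r by (intro W_le_V) auto
      show "(r / (r + dist x y)) powr (\<epsilon> - 0) \<le> (r / \<rho>) powr \<epsilon>"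
        using False r \<rho> eps by (auto intro!: powr_mono2 divide_left_mono mult_pos_pos)
    qed auto
    finally have "\<bar>\<psi> y - \<psi> y * cutoff x \<rho> y\<bar> \<le> B' * ((1 / V \<mu> r x) * (r / \<rho>) powr \<epsilon>)"
      using B' by (simp add: mult_left_mono)
    then show ?thesis using \<rho> by simp
  qed
  then have "tb x1 1 \<beta> \<gamma> e (\<lambda>y. \<psi> y - \<psi> y * cutoff x \<rho> y)" using dif[OF \<rho>(2)] by (intro t) auto
  moreover have "smooth (\<lambda>y. \<psi> y * cutoff x \<rho> y)"
    by (rule smooth_of_tb[OF r _ _ cut[OF \<rho>(2)]]) auto
  ultimately show ?thesis using that \<rho> by blast
qed

lemma smooth_mult_bump:
  fixes a :: "'a \<Rightarrow> real"
  assumes \<psi>: "smooth \<psi>" and \<delta>: "\<delta> > 0" and L: "L \<ge> 0"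
    and a: "\<And>y. \<bar>a y\<bar> \<le> 1" "\<And>y. 2 * \<delta> \<le> dist c y \<Longrightarrow> a y = 0"
      "\<And>y z. \<bar>a y - a z\<bar> \<le> L * (dist y z / \<delta>)"
  shows "smooth (\<lambda>y. \<psi> y * a y)"
proof -
  obtain B where B: "B \<ge> 0" and tb\<psi>: "tb c \<delta> \<epsilon> \<epsilon> B \<psi>" using smooth_tb_at[OF \<psi> \<delta>] .
  define M where "M = B / V \<mu> \<delta> c"
  have M: "M \<ge> 0" using B by (simp add: M_def)
  have "tb c \<delta> \<epsilon> \<epsilon> (32 * C1 * 9 powr n * 8 powr \<epsilon> * (1 + L) * M * V \<mu> \<delta> c) (\<lambda>y. \<psi> y * a y)"
  proof (rule tb_bump)
    show "\<bar>\<psi> y\<bar> \<le> M" for y unfolding M_def using \<delta> eps by (intro tb_bounded[OF _ _ tb\<psi>]) auto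
    fix y z :: 'a assume d: "dist y z \<le> \<delta> / 2"
    then have "dist y z \<le> (\<delta> + dist c y) / 2" using zero_le_dist[of c y] by argo
    from tb_reg[OF tb\<psi> this]
    have "\<bar>\<psi> z - \<psi> y\<bar> \<le> B * (dist y z / (\<delta> + dist c y)) powr \<epsilon> * W \<epsilon> \<delta> c y" .
    also have "\<dots> \<le> B * (dist y z / \<delta>) powr \<epsilon> * (1 / V \<mu> \<delta> c)"
      using B \<delta> eps by (intro mult_mono mult_left_mono powr_mono2 W_le_V divide_left_mono
        mult_pos_pos add_pos_nonneg) auto
    finally show "\<bar>\<psi> z - \<psi> y\<bar> \<le> M * (dist y z / \<delta>) powr \<epsilon>" by (simp add: M_def)
  qed (use \<delta> eps le1 L a M in auto)
  then show ?thesis by (rule smooth_of_tb[OF \<delta>, rotated 2]) auto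
qed

text \<open>The bounded support of \<open>g\<close> allows \<open>dual_conv\<close>, which makes the
  remainder equal to \<open>f \<psi>\<close>. After truncation with error at most \<open>e\<close>,
  the partition of unity gives pieces \<open>h i\<close>. On the support of the piece at
  \<open>i\<close>, \<open>\<psi>\<close> has size about
  \<open>(\<delta> / r) powr \<beta> * W \<gamma> r x i\<close>, and \<open>tb_bump\<close> supplies
  the further factor \<open>V \<mu> \<delta> i\<close>.\<close>

lemma large_scale_bound:
  obtains K where "K > 0"
    "\<And>\<delta> s f A r x C g e R. f \<in> dual \<Longrightarrow> kern \<delta> s \<Longrightarrow> separated \<delta> A \<Longrightarrow> (\<And>y. \<exists>i\<in>A. dist i y < \<delta>) \<Longrightarrow>
       \<delta> \<le> r \<Longrightarrow> tb x r \<beta> \<gamma> C g \<Longrightarrow> smooth g \<Longrightarrow> (\<And>y. R \<le> dist x1 y \<Longrightarrow> g y = 0) \<Longrightarrow> e > 0 \<Longrightarrow> C > 0 \<Longrightarrow>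
       \<exists>F. finite F \<and> F \<subseteq> A \<and> ennreal \<bar>remainder f s g\<bar>
         \<le> ennreal e + (\<Sum>i\<in>F. ennreal (K * C * (\<delta> / r) powr \<beta> * V \<mu> \<delta> i * W \<gamma> r x i) * nt_inf \<delta> f i)"
proof -
  obtain K1 where K1: "K1 > 0"
    "\<And>\<delta> s r x C \<phi> y. kern \<delta> s \<Longrightarrow> \<delta> \<le> r \<Longrightarrow> tb x r \<beta> \<gamma> C \<phi> \<Longrightarrow>
       \<bar>\<phi> y - conv s \<phi> y\<bar> \<le> K1 * C * (\<delta> / r) powr \<beta> * W \<gamma> r x y"
    "\<And>\<delta> s r x C \<phi> y y'. kern \<delta> s \<Longrightarrow> \<delta> \<le> r \<Longrightarrow> tb x r \<beta> \<gamma> C \<phi> \<Longrightarrow> dist y y' \<le> \<delta> / 2 \<Longrightarrow>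
       \<bar>(\<phi> y' - conv s \<phi> y') - (\<phi> y - conv s \<phi> y)\<bar>
         \<le> K1 * C * (\<delta> / r) powr \<beta> * W \<gamma> r x y * (dist y y' / \<delta>) powr \<beta>"
    using remainder_bounds by blast
  \<comment> \<open>For \<open>dist i y < 3 * \<delta>\<close> and \<open>\<delta> \<le> r\<close>,
    \<open>r + dist x i\<close> is at most \<open>4 * (r + dist x y)\<close>.\<close>
  define K2 where "K2 = C1 * 4 powr (n + \<gamma>)"
  define K3 where "K3 = 32 * C1 * 9 powr n * 8 powr \<gamma> * (1 + (1 + pou_lip))"
  define K where "K = K3 * K1 * K2"
  have K2: "K2 > 0" and K3: "K3 > 0" using C1_ge pou_lip_pos by (auto simp: K2_def K3_def)
  then have K: "K > 0" using K1(1) by (simp add: K_def)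
  have main: "\<exists>F. finite F \<and> F \<subseteq> A \<and> ennreal \<bar>remainder f s g\<bar>
         \<le> ennreal e + (\<Sum>i\<in>F. ennreal (K * C * (\<delta> / r) powr \<beta> * V \<mu> \<delta> i * W \<gamma> r x i) * nt_inf \<delta> f i)"
    if f: "f \<in> dual" and s: "kern \<delta> s" and A: "separated \<delta> A" "\<And>y. \<exists>i\<in>A. dist i y < \<delta>"
      and r: "\<delta> \<le> r" and g: "tb x r \<beta> \<gamma> C g" "smooth g" and supp: "\<And>y. R \<le> dist x1 y \<Longrightarrow> g y = 0"
      and e: "e > 0" and C: "C > 0" for \<delta> s f A r x C g e R
  proof -
    have \<delta>: "\<delta> > 0" "r > 0" using kernD(1)[OF s] r by auto
    have ig: "integrable \<mu> g" by (rule smooth_integrable[OF g(2)])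
    define \<psi> where "\<psi> y = g y - conv s g y" for y
    have sconv: "smooth (conv s g)" by (rule dual_conv(1)[OF f s ig supp])
    have s\<psi>: "smooth \<psi>" unfolding \<psi>_def[abs_def] by (rule smooth_diff[OF g(2) sconv])
    have f\<psi>: "f \<psi> = f g - (LINT z|\<mu>. f (s z) * g z)"
      unfolding \<psi>_def[abs_def] using dual_diff[OF f smooth_test[OF g(2)] sconv] dual_conv(3)[OF f s
        ig supp] by simp
    obtain B where B: "B > 0" "\<And>\<phi> C. \<phi> \<in> test \<Longrightarrow> tb x1 1 \<beta> \<gamma> C \<phi> \<Longrightarrow> \<bar>f \<phi>\<bar> \<le> B * C"
      using dual_bound[OF f] by metis
    obtain \<rho> where \<rho>: "\<rho> \<ge> r" "smooth (\<lambda>y. \<psi> y * cutoff x \<rho> y)" "tb x1 1 \<beta> \<gamma> (e / B) (\<lambda>y. \<psi> y - \<psi> y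
      * cutoff x \<rho> y)"
      using cutoff_approx[OF s\<psi> _ \<delta>(2), of "e / B"] e B by auto
    define F where "F = A \<inter> ball x (2 * \<rho> + \<delta>)"
    have F: "finite F" "F \<subseteq> A" unfolding F_def using separated_bounded_finite[OF A(1) \<delta>(1)] by auto
    \<comment> \<open>Cutoff and partition function form one bump factor, with Lipschitz constant
      \<open>1 + pou_lip\<close> at scale \<delta>: the cutoff contributes 1 because
      \<open>\<rho> \<ge> \<delta>\<close>. This is the \<open>L\<close> in
      \<open>K3\<close>.\<close>
    define a where "a i y = cutoff x \<rho> y * pou F \<delta> i y" for i y
    define h where "h i y = \<psi> y * a i y" for i y
    have a: "\<bar>a i y\<bar> \<le> 1" "2 * \<delta> \<le> dist i y \<Longrightarrow> a i y = 0" "\<bar>a i y - a i z\<bar>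
      \<le> (1 + pou_lip) * (dist y z / \<delta>)" for i y z
    proof -
      note c = cutoff_range[of x \<rho>] and q = pou_range[of F \<delta> i]
      show "\<bar>a i y\<bar> \<le> 1" unfolding a_def using c[of y] q[of y] by (simp add: abs_mult mult_le_one)
      show "2 * \<delta> \<le> dist i y \<Longrightarrow> a i y = 0" using pou_eq_0[OF \<delta>(1), of i y F] by (simp add: a_def)
      have "a i y - a i z = (cutoff x \<rho> y - cutoff x \<rho> z) * pou F \<delta> i y + cutoff x \<rho> z * (pou F \<delta> i
        y - pou F \<delta> i z)"
        by (simp add: a_def algebra_simps)
      then have "\<bar>a i y - a i z\<bar>
        \<le> \<bar>cutoff x \<rho> y - cutoff x \<rho> z\<bar> * \<bar>pou F \<delta> i y\<bar> + \<bar>cutoff x \<rho> z\<bar> * \<bar>pou F \<delta> i y - pou F \<delta> i z\<bar>"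
        by (metis abs_mult abs_triangle_ineq)
      also have "\<dots> \<le> dist y z / \<delta> * 1 + 1 * (pou_lip * (dist y z / \<delta>))"
      proof (intro add_mono mult_mono)
        have "\<bar>cutoff x \<rho> y - cutoff x \<rho> z\<bar> \<le> dist y z / \<rho>" using \<rho> \<delta> by (intro cutoff_lipschitz) auto
        also have "\<dots> \<le> dist y z / \<delta>" using \<rho> r \<delta> by (intro divide_left_mono) auto
        finally show "\<bar>cutoff x \<rho> y - cutoff x \<rho> z\<bar> \<le> dist y z / \<delta>" .
        show "\<bar>pou F \<delta> i y - pou F \<delta> i z\<bar> \<le> pou_lip * (dist y z / \<delta>)"
          by (rule pou_lipschitz[OF A(1) \<delta>(1) F])
      qed (use c q \<delta> in auto)
      finally show "\<bar>a i y - a i z\<bar> \<le> (1 + pou_lip) * (dist y z / \<delta>)"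
        by (simp add: algebra_simps add_divide_distrib)
    qed
    have sh: "smooth (h i)" for i
      unfolding h_def[abs_def] using s\<psi> \<delta>(1) pou_lip_pos a
        by (intro smooth_mult_bump[of \<psi> \<delta> "1 + pou_lip" _ i]) auto
    have sum: "(\<lambda>y. \<psi> y * cutoff x \<rho> y) = (\<lambda>y. \<Sum>i\<in>F. h i y)"
    proof
      fix y
      show "\<psi> y * cutoff x \<rho> y = (\<Sum>i\<in>F. h i y)"
      proof (cases "2 * \<rho> \<le> dist x y")
        case True
        then have "cutoff x \<rho> y = 0" using \<rho>(1) \<delta> by (intro cutoff_eq_0) auto
        then show ?thesis by (simp add: h_def a_def)
      next
        case False
        obtain i where i: "i \<in> A" "dist i y < \<delta>" using A by blast
        have "i \<in> F" using i False dist_triangle2[of x i y] by (auto simp: F_def)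
        then have "(\<Sum>j\<in>F. pou F \<delta> j y) = 1" using pou_sum[OF F(1) \<delta>(1) _ i(2)] by blast
        then show ?thesis by (simp add: h_def a_def mult.assoc[symmetric] flip: sum_distrib_left)
      qed
    qed
    have piece: "ennreal \<bar>f (h i)\<bar>
      \<le> ennreal (K * C * (\<delta> / r) powr \<beta> * V \<mu> \<delta> i * W \<gamma> r x i) * nt_inf \<delta> f i" for i
    proof -
      define X where "X = K1 * C * (\<delta> / r) powr \<beta>"
      define M where "M = X * (K2 * W \<gamma> r x i)"
      have X: "X > 0" using K1 C \<delta> by (simp add: X_def)
      have M: "M > 0" using X K2 W_pos[OF \<delta>(2)] by (simp add: M_def)
      have WM: "X * W \<gamma> r x y \<le> M" if "dist i y < 3 * \<delta>" for y
      proof -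
        have "dist x i \<le> dist x y + dist i y" by (rule dist_triangle2)
        then have *: "r + dist x i \<le> 4 * (r + dist x y)" using that r \<delta> zero_le_dist[of x y] by argo
        have "W \<gamma> r x y \<le> K2 * W \<gamma> r x i"
          unfolding K2_def using * \<delta> bg_pos by (intro W_compare) auto
        then show ?thesis unfolding M_def using X by (intro mult_left_mono) auto
      qed
      have "tb i \<delta> \<beta> \<gamma> (32 * C1 * 9 powr n * 8 powr \<gamma> * (1 + (1 + pou_lip)) * M * V \<mu> \<delta> i) (h i)"
        unfolding h_def[abs_def]
      proof (rule tb_bump[OF \<delta>(1)])
        fix y assume y: "dist i y < 3 * \<delta>"
        have "\<bar>\<psi> y\<bar> \<le> X * W \<gamma> r x y" using K1(2)[OF s r g(1), of y] by (simp add: X_def \<psi>_def)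
        then show "\<bar>\<psi> y\<bar> \<le> M" using WM[OF y] by simp
        fix z assume d: "dist y z \<le> \<delta> / 2"
        have "\<bar>\<psi> z - \<psi> y\<bar> \<le> X * W \<gamma> r x y * (dist y z / \<delta>) powr \<beta>"
          using K1(3)[OF s r g(1) d] by (simp add: X_def \<psi>_def)
        also have "\<dots> \<le> M * (dist y z / \<delta>) powr \<beta>" by (intro mult_right_mono WM[OF y]) simp
        finally show "\<bar>\<psi> z - \<psi> y\<bar> \<le> M * (dist y z / \<delta>) powr \<beta>" .
      qed (use bg_pos le1 M pou_lip_pos a \<delta> in auto)
      then have "tb i \<delta> \<beta> \<gamma> (K3 * M * V \<mu> \<delta> i) (h i)" by (simp only: K3_def)
      moreover have "K3 * M * V \<mu> \<delta> i = K * C * (\<delta> / r) powr \<beta> * V \<mu> \<delta> i * W \<gamma> r x i"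
        by (simp add: M_def X_def K_def mult_ac)
      moreover have "K3 * M * V \<mu> \<delta> i > 0" using K3 M V_pos[OF \<delta>(1)] by simp
      ultimately show ?thesis using nt_inf_upper[OF f smooth_test[OF sh] _ \<delta>(1)] by metis
    qed
    have fsum: "f (\<lambda>y. \<psi> y * cutoff x \<rho> y) = (\<Sum>i\<in>F. f (h i))"
      unfolding sum using dual_sum[OF f F(1), of h] sh by simp
    have "\<bar>f (\<lambda>y. \<psi> y - \<psi> y * cutoff x \<rho> y)\<bar> \<le> B * (e / B)"
      using smooth_diff[OF s\<psi> \<rho>(2)] by (intro B(2)[OF _ \<rho>(3)] smooth_test)
    then have "\<bar>f \<psi> - (\<Sum>i\<in>F. f (h i))\<bar> \<le> e"
      using dual_diff[OF f smooth_test[OF s\<psi>] \<rho>(2)] fsum B by simp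
    then have "\<bar>f \<psi>\<bar> \<le> e + (\<Sum>i\<in>F. \<bar>f (h i)\<bar>)" using sum_abs[of "\<lambda>i. f (h i)" F] by linarith
    then have "ennreal \<bar>f \<psi>\<bar> \<le> ennreal (e + (\<Sum>i\<in>F. \<bar>f (h i)\<bar>))" by (rule ennreal_leI)
    also have "\<dots> = ennreal e + (\<Sum>i\<in>F. ennreal \<bar>f (h i)\<bar>)" using e by (simp add: sum_nonneg)
    also have "\<dots> \<le> ennreal e + (\<Sum>i\<in>F. ennreal (K * C * (\<delta> / r) powr \<beta> * V \<mu> \<delta> i * W \<gamma> r x i) *
      nt_inf \<delta> f i)"
      by (intro add_left_mono sum_mono piece)
    finally show ?thesis using F f\<psi> by auto
  qed
  show ?thesis by (rule that[OF K main])
qed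

end

section \<open>Powers of extended nonnegative reals, and sums over countable nets\<close>

lemma enn_powr_ennreal: "0 \<le> a \<Longrightarrow> enn_powr (ennreal a) q = ennreal (a powr q)"
  by (simp add: enn_powr_def)

lemma enn_powr_top [simp]: "enn_powr top q = top"
  by (simp add: enn_powr_def)

lemma enn_powr_mono:
  assumes "0 < q" "a \<le> b"
  shows "enn_powr a q \<le> enn_powr b q"
proof (cases b)
  case (real t)
  then obtain u where "a = ennreal u" "0 \<le> u" "u \<le> t"
    using assms by (cases a) (auto simp: top_unique)
  then show ?thesis using real assms by (auto simp: enn_powr_ennreal intro!: ennreal_leI powr_mono2)
qed simp

lemma enn_powr_mult:
  assumes "0 < c"
  shows "enn_powr (ennreal c * a) q = ennreal (c powr q) * enn_powr a q"
proof (cases a)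
  case (real t)
  then show ?thesis using assms by (simp add: enn_powr_ennreal powr_mult flip: ennreal_mult)
next
  case top
  then show ?thesis using assms by (simp add: ennreal_mult_top)
qed

lemma enn_powr_inverse:
  assumes "0 < q"
  shows "enn_powr (enn_powr a q) (1 / q) = a" "enn_powr (enn_powr a (1 / q)) q = a"
  using assms by (cases a; simp add: enn_powr_ennreal powr_powr)+

lemma enn_powr_add:
  assumes "0 < q" "q \<le> 1"
  shows "enn_powr (a + b) q \<le> enn_powr a q + enn_powr b q"
proof (cases "a = top \<or> b = top")
  case True
  then show ?thesis by auto
next
  case False
  then obtain s t where "a = ennreal s" "0 \<le> s" "b = ennreal t" "0 \<le> t"
    by (metis ennreal_cases)
  then show ?thesis
    using powr_add_le[of s t q] assms by (simp add: enn_powr_ennreal flip: ennreal_plus)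
qed

lemma enn_powr_sum:
  assumes "finite F" "0 < q" "q \<le> 1"
  shows "enn_powr (\<Sum>i\<in>F. a i) q \<le> (\<Sum>i\<in>F. enn_powr (a i) q)"
  using assms(1)
proof (induction F rule: finite_induct)
  case empty
  then show ?case using enn_powr_ennreal[of 0 q] by simp
next
  case (insert i F)
  then have "enn_powr (a i + sum a F) q \<le> enn_powr (a i) q + enn_powr (sum a F) q"
    using assms by (intro enn_powr_add)
  also have "\<dots> \<le> enn_powr (a i) q + (\<Sum>i\<in>F. enn_powr (a i) q)" using insert by (intro add_left_mono)
  finally show ?case using insert by simp
qed

lemma enn_powr_measurable [measurable]:
  assumes [measurable]: "f \<in> borel_measurable M"
  shows "(\<lambda>x. enn_powr (f x) q) \<in> borel_measurable M"
  unfolding enn_powr_def by measurable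

text \<open>For finite \<open>a\<close>, write \<open>a\<close> as \<open>a powr q\<close> times
  \<open>(a powr q) powr (1 / q - 1)\<close> and bound the second factor by \<open>t\<close>. This
  passes from summable q-th powers to summable terms.\<close>

lemma le_enn_powr:
  assumes "0 < q" "q \<le> 1" "enn_powr a q \<le> ennreal t" "0 \<le> t"
  shows "a \<le> ennreal (t powr (1 / q - 1)) * enn_powr a q"
proof (cases a)
  case (real u)
  then have u: "u powr q \<le> t" using assms by (simp add: enn_powr_ennreal ennreal_le_iff)
  have "u = (u powr q) powr (1 / q - 1) * u powr q"
    using real assms by (simp add: powr_powr right_diff_distrib flip: powr_add)
  also have "\<dots> \<le> t powr (1 / q - 1) * u powr q"
    using u assms by (intro mult_right_mono powr_mono2) (auto simp: field_simps)
  finally show ?thesis using real by (simp add: enn_powr_ennreal ennreal_leI flip: ennreal_mult)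
next
  case top
  then show ?thesis using assms by (simp add: top_unique)
qed

lemma borel_measurable_nn_integral_count_space:
  fixes f :: "'i \<Rightarrow> 'b \<Rightarrow> ennreal"
  assumes "countable I" "\<And>i. i \<in> I \<Longrightarrow> f i \<in> borel_measurable M"
  shows "(\<lambda>x. \<integral>\<^sup>+i. f i x \<partial>count_space I) \<in> borel_measurable M"
proof -
  interpret sigma_finite_measure "count_space I"
    using assms(1) by (rule sigma_finite_measure_count_space_countable)
  have "case_prod f \<in> borel_measurable (count_space I \<Otimes>\<^sub>M M)"
    using assms by (intro measurable_pair_measure_countable1) auto
  from measurable_compose[OF measurable_pair_swap' this]
  have "(\<lambda>(x, i). f i x) \<in> borel_measurable (M \<Otimes>\<^sub>M count_space I)" by (simp add: case_prod_beta')
  then show ?thesis by (rule borel_measurable_nn_integral)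
qed

lemma sum_le_nn_integral_count_space:
  fixes f :: "'i \<Rightarrow> ennreal"
  assumes "finite F" "F \<subseteq> I"
  shows "(\<Sum>i\<in>F. f i) \<le> (\<integral>\<^sup>+i. f i \<partial>count_space I)"
proof -
  have "(\<Sum>i\<in>F. f i) = (\<integral>\<^sup>+i. f i \<partial>count_space F)" using assms
    by (simp add: nn_integral_count_space_finite)
  also have "\<dots> = (\<integral>\<^sup>+i. f i * indicator F i \<partial>count_space UNIV)"
    by (rule nn_integral_count_space_indicator) simp
  also have "\<dots> \<le> (\<integral>\<^sup>+i. f i * indicator I i \<partial>count_space UNIV)"
    using assms by (intro nn_integral_mono) (auto split: split_indicator)
  also have "\<dots> = (\<integral>\<^sup>+i. f i \<partial>count_space I)" by (rule nn_integral_count_space_indicator[symmetric]) simp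
  finally show ?thesis .
qed

section \<open>The remainder at scales up to \<delta>, and one pointwise bound for all
  scales\<close>

context hardy_setting
begin

text \<open>If \<open>x\<close> is at distance at least \<open>2 * \<delta>\<close> from
  \<open>i\<close>, the kernel of the smaller scale \<open>r\<close> is pointwise dominated on the
  ball by its value at scale \<delta>. Otherwise
  \<open>V \<mu> \<delta> i * W \<gamma> \<delta> x i\<close> is bounded below, and the total mass
  of the kernel suffices.\<close>

lemma ball_mass_W:
  obtains K where "K > 0" "\<And>\<delta> r x i. 0 < r \<Longrightarrow> r \<le> \<delta> \<Longrightarrow>
    (\<integral>\<^sup>+z. ennreal (W \<gamma> r x z) * indicator (ball i \<delta>) z \<partial>\<mu>) \<le> ennreal (K * V \<mu> \<delta> i * W \<gamma> \<delta> x i)"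
proof -
  obtain c where c: "c > 0" "\<And>r x. r > 0 \<Longrightarrow> integrable \<mu> (W \<gamma> r x) \<and> (LINT y|\<mu>. W \<gamma> r x y) \<le> c"
    using integral_W[OF bg_pos(2)] by metis
  define K1 where "K1 = C1 * 3 powr (n + \<gamma>)"
  define K2 where "K2 = c * (C1 * 5 powr n * 3 powr \<gamma>)"
  have K: "K1 > 0" "K2 > 0" using C1_ge c by (auto simp: K1_def K2_def)
  have main: "(\<integral>\<^sup>+z. ennreal (W \<gamma> r x z) * indicator (ball i \<delta>) z \<partial>\<mu>)
      \<le> ennreal ((K1 + K2) * V \<mu> \<delta> i * W \<gamma> \<delta> x i)" if r: "0 < r" "r \<le> \<delta>" for \<delta> r x i
  proof -
    define X where "X = V \<mu> \<delta> i * W \<gamma> \<delta> x i"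
    have X: "X \<ge> 0" by (simp add: X_def)
    have "(\<integral>\<^sup>+z. ennreal (W \<gamma> r x z) * indicator (ball i \<delta>) z \<partial>\<mu>) \<le> ennreal ((K1 + K2) * X)"
    proof (cases "2 * \<delta> \<le> dist x i")
      case True
      have "W \<gamma> r x z \<le> K1 * W \<gamma> \<delta> x i" if z: "dist i z < \<delta>" for z
        unfolding K1_def
      proof (rule W_compare)
        have t: "dist x i \<le> dist x z + dist i z" by (rule dist_triangle2)
        then have *: "\<delta> + dist x i \<le> 3 * (r + dist x z)" using z r True by argo
        then show "dist x x + (\<delta> + dist x i) \<le> 3 * (r + dist x z)" by simp
        have "r * (\<delta> + dist x i) \<le> \<delta> * (3 * (r + dist x z))" using r * by (intro mult_mono) auto
        then show "r * (\<delta> + dist x i) \<le> 3 * \<delta> * (r + dist x z)" by (simp only: mult_ac)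
      qed (use r bg_pos in auto)
      then have "(\<integral>\<^sup>+z. ennreal (W \<gamma> r x z) * indicator (ball i \<delta>) z \<partial>\<mu>)
          \<le> (\<integral>\<^sup>+z. ennreal (K1 * W \<gamma> \<delta> x i) * indicator (ball i \<delta>) z \<partial>\<mu>)"
        by (intro nn_integral_mono) (auto split: split_indicator intro: ennreal_leI)
      also have "\<dots> = ennreal (K1 * W \<gamma> \<delta> x i * V \<mu> \<delta> i)"
        using r K by (simp add: nn_integral_cmult_indicator emeasure_ball flip: ennreal_mult)
      also have "\<dots> \<le> ennreal ((K1 + K2) * X)"
        using K X by (intro ennreal_leI) (simp add: X_def algebra_simps)
      finally show ?thesis .
    next
      case False
      have "1 \<le> (C1 * 5 powr n * 3 powr \<gamma>) * X"
      proof -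
        define T where "T = \<delta> + dist x i"
        have T: "T > 0" "T \<le> 3 * \<delta>" using False r rd_pos[of \<delta> x i] by (auto simp: T_def)
        have "V \<mu> T x \<le> C1 * 5 powr n * V \<mu> \<delta> i" using False r T by (intro V_shift) auto
        then have 1: "1 \<le> C1 * 5 powr n * V \<mu> \<delta> i * (1 / V \<mu> T x)"
          using V_pos[OF T(1), of x] by (simp add: field_simps)
        have "1 \<le> 3 * (\<delta> / T)" using T by (simp add: field_simps)
        then have "1 \<le> (3 * (\<delta> / T)) powr \<gamma>" using bg_pos by (simp add: ge_one_powr_ge_zero)
        also have "\<dots> = 3 powr \<gamma> * (\<delta> / T) powr \<gamma>" by (rule powr_mult)
        finally have "1 * 1 \<le> (C1 * 5 powr n * V \<mu> \<delta> i * (1 / V \<mu> T x)) * (3 powr \<gamma> * (\<delta> / T) powr \<gamma>)"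
          using 1 by (intro mult_mono) auto
        then show ?thesis by (simp add: X_def W_def T_def mult_ac)
      qed
      then have "c * 1 \<le> c * ((C1 * 5 powr n * 3 powr \<gamma>) * X)" using c by (intro mult_left_mono) auto
      moreover have "(K1 + K2) * X = K1 * X + c * ((C1 * 5 powr n * 3 powr \<gamma>) * X)"
        by (simp add: K2_def algebra_simps)
      moreover have "0 \<le> K1 * X" using K X by simp
      ultimately have cX: "c \<le> (K1 + K2) * X" by linarith
      have "(\<integral>\<^sup>+z. ennreal (W \<gamma> r x z) * indicator (ball i \<delta>) z \<partial>\<mu>) \<le> (\<integral>\<^sup>+z. ennreal (W \<gamma> r x z) \<partial>\<mu>)"
        by (intro nn_integral_mono) (auto split: split_indicator)
      also have "\<dots> = ennreal (LINT y|\<mu>. W \<gamma> r x y)" using c(2)[OF r(1), of x]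
        by (intro nn_integral_eq_integral) auto
      also have "\<dots> \<le> ennreal ((K1 + K2) * X)" using c(2)[OF r(1), of x] cX by (intro ennreal_leI) auto
      finally show ?thesis .
    qed
    then show ?thesis by (simp add: X_def mult.assoc)
  qed
  have "K1 + K2 > 0" using K by simp
  then show ?thesis by (rule that[OF _ main])
qed

lemma W_ball_measurable [measurable]:
  "(\<lambda>z. ennreal (W g r x z) * indicator (ball i \<delta>) z) \<in> borel_measurable borel"
proof -
  have [measurable]: "ball i \<delta> \<in> sets borel" by simp
  show ?thesis by measurable
qed

lemma indicator_ball_measurable [measurable]: "(indicator (ball i \<delta>) :: 'a \<Rightarrow> ennreal) \<in>
  borel_measurable borel"
  by (intro borel_measurable_indicator) simp

lemma kern_nt_inf:
  assumes f: "f \<in> dual" and s: "kern \<delta> s" and z: "dist i z < \<delta>"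
  shows "ennreal \<bar>f (s z)\<bar> \<le> ennreal (chg_const 1 \<gamma> * C4) * nt_inf \<delta> f i"
proof (rule nt_inf_upper[OF f smooth_test[OF kern_smooth[OF s]]])
  show \<delta>: "\<delta> > 0" using kernD[OF s] by simp
  have "tb z \<delta> \<beta> \<gamma> C4 (s z)" using beta gamma eps \<delta> by (intro tb_antimono_exp[OF \<delta> kernD(2)[OF s]]) auto
  then show "tb i \<delta> \<beta> \<gamma> (chg_const 1 \<gamma> * C4) (s z)"
    using z \<delta> bg_pos le1 by (intro tb_change[of \<delta> \<delta> 1 z i]) (auto simp: dist_commute)
  show "0 < chg_const 1 \<gamma> * C4" using chg_const_pos[of 1 \<gamma>] C4 by simp
qed

text \<open>Here no cancellation is available, and the two terms are estimated separately:
  \<open>f g\<close> is admissible for \<open>nt_max\<close> at \<open>x\<close>, and the integral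
  is spread over the net balls meeting the support of \<open>g\<close>, on each of which
  \<open>kern_nt_inf\<close> bounds \<open>f (s z)\<close>.\<close>

lemma small_scale_bound:
  obtains K where "K > 0"
    "\<And>\<delta> s f A r x C g R. f \<in> dual \<Longrightarrow> kern \<delta> s \<Longrightarrow> separated \<delta> A \<Longrightarrow> (\<And>y. \<exists>i\<in>A. dist i y < \<delta>) \<Longrightarrow>
       0 < r \<Longrightarrow> r \<le> \<delta> \<Longrightarrow> tb x r \<beta> \<gamma> C g \<Longrightarrow> smooth g \<Longrightarrow> (\<And>y. R \<le> dist x1 y \<Longrightarrow> g y = 0) \<Longrightarrow> C > 0 \<Longrightarrow>
       \<exists>F. finite F \<and> F \<subseteq> A \<and> ennreal \<bar>remainder f s g\<bar>
         \<le> ennreal C * nt_max \<delta> f x + (\<Sum>i\<in>F. ennreal (K * C * V \<mu> \<delta> i * W \<gamma> \<delta> x i) * nt_inf \<delta> f i)"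
proof -
  obtain K1 where K1: "K1 > 0" "\<And>\<delta> r x i. 0 < r \<Longrightarrow> r \<le> \<delta> \<Longrightarrow>
    (\<integral>\<^sup>+z. ennreal (W \<gamma> r x z) * indicator (ball i \<delta>) z \<partial>\<mu>) \<le> ennreal (K1 * V \<mu> \<delta> i * W \<gamma> \<delta> x i)"
    using ball_mass_W by metis
  define K2 where "K2 = chg_const 1 \<gamma> * C4"
  have K2: "K2 > 0" using chg_const_pos[of 1 \<gamma>] C4 by (simp add: K2_def)
  define K where "K = K2 * K1"
  have K: "K > 0" using K1 K2 by (simp add: K_def)
  have main: "\<exists>F. finite F \<and> F \<subseteq> A \<and> ennreal \<bar>remainder f s g\<bar>
         \<le> ennreal C * nt_max \<delta> f x + (\<Sum>i\<in>F. ennreal (K * C * V \<mu> \<delta> i * W \<gamma> \<delta> x i) * nt_inf \<delta> f i)"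
    if f: "f \<in> dual" and s: "kern \<delta> s" and A: "separated \<delta> A" "\<And>y. \<exists>i\<in>A. dist i y < \<delta>"
      and r: "0 < r" "r \<le> \<delta>" and g: "tb x r \<beta> \<gamma> C g" "smooth g" and supp: "\<And>y. R \<le> dist x1 y \<Longrightarrow> g y = 0"
      and C: "C > 0" for \<delta> s f A r x C g R
  proof -
    have \<delta>: "\<delta> > 0" using r by simp
    define F where "F = A \<inter> ball x1 (R + \<delta>)"
    have F: "finite F" "F \<subseteq> A" unfolding F_def using separated_bounded_finite[OF A(1) \<delta>] by auto
    have fg: "ennreal \<bar>f g\<bar> \<le> ennreal C * nt_max \<delta> f x"
      using r C by (intro nt_max_upper[OF f smooth_test[OF g(2)] g(1)]) auto
    define b where "b i = ennreal (K2 * C) * nt_inf \<delta> f i" for i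
    have pt: "ennreal \<bar>f (s z) * g z\<bar>
      \<le> (\<Sum>i\<in>F. b i * (ennreal (W \<gamma> r x z) * indicator (ball i \<delta>) z))" for z
    proof (cases "g z = 0")
      case True
      then show ?thesis by simp
    next
      case False
      obtain i where i: "i \<in> A" "dist i z < \<delta>" using A by blast
      have "dist x1 z < R" using supp[of z] False by force
      then have iF: "i \<in> F" using i dist_triangle2[of x1 i z] by (auto simp: F_def)
      have "ennreal \<bar>f (s z) * g z\<bar> = ennreal \<bar>f (s z)\<bar> * ennreal \<bar>g z\<bar>"
        by (simp add: abs_mult ennreal_mult)
      also have "\<dots> \<le> (ennreal K2 * nt_inf \<delta> f i) * ennreal (C * W \<gamma> r x z)"
        unfolding K2_def using tb_size[OF g(1)]
          by (intro mult_mono kern_nt_inf[OF f s i(2)] ennreal_leI) auto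
      also have "\<dots> = b i * (ennreal (W \<gamma> r x z) * indicator (ball i \<delta>) z)"
        using i K2 C by (simp add: b_def ennreal_mult mult_ac)
      also have "\<dots> \<le> (\<Sum>i\<in>F. b i * (ennreal (W \<gamma> r x z) * indicator (ball i \<delta>) z))"
        using F iF by (intro member_le_sum) auto
      finally show ?thesis .
    qed
    have "ennreal \<bar>LINT z|\<mu>. f (s z) * g z\<bar> \<le> (\<integral>\<^sup>+z. ennreal \<bar>f (s z) * g z\<bar> \<partial>\<mu>)"
      using integral_norm_bound_ennreal[OF dual_conv(2)[OF f s smooth_integrable[OF g(2)] supp]] by simp
    also have "\<dots> \<le> (\<integral>\<^sup>+z. (\<Sum>i\<in>F. b i * (ennreal (W \<gamma> r x z) * indicator (ball i \<delta>) z)) \<partial>\<mu>)"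
      by (intro nn_integral_mono pt)
    also have "\<dots> = (\<Sum>i\<in>F. b i * (\<integral>\<^sup>+z. ennreal (W \<gamma> r x z) * indicator (ball i \<delta>) z \<partial>\<mu>))"
      by (subst nn_integral_sum) (auto intro!: sum.cong nn_integral_cmult W_ball_measurable
        borel_measurable_times_ennreal indicator_ball_measurable)
    also have "\<dots> \<le> (\<Sum>i\<in>F. b i * ennreal (K1 * V \<mu> \<delta> i * W \<gamma> \<delta> x i))"
      by (intro sum_mono mult_left_mono K1(2) r) simp
    also have "\<dots> = (\<Sum>i\<in>F. ennreal (K * C * V \<mu> \<delta> i * W \<gamma> \<delta> x i) * nt_inf \<delta> f i)"
      using K1 K2 C by (intro sum.cong) (auto simp: b_def K_def ennreal_mult mult_ac)
    finally have I: "ennreal \<bar>LINT z|\<mu>. f (s z) * g z\<bar>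
        \<le> (\<Sum>i\<in>F. ennreal (K * C * V \<mu> \<delta> i * W \<gamma> \<delta> x i) * nt_inf \<delta> f i)" .
    have "ennreal \<bar>remainder f s g\<bar> \<le> ennreal (\<bar>f g\<bar> + \<bar>LINT z|\<mu>. f (s z) * g z\<bar>)"
      by (intro ennreal_leI) simp
    also have "\<dots> = ennreal \<bar>f g\<bar> + ennreal \<bar>LINT z|\<mu>. f (s z) * g z\<bar>" by simp
    also have "\<dots> \<le> ennreal C * nt_max \<delta> f x + (\<Sum>i\<in>F. ennreal (K * C * V \<mu> \<delta> i * W \<gamma> \<delta> x i) * nt_inf
      \<delta> f i)"
      by (intro add_mono fg I)
    finally show ?thesis using F by blast
  qed
  show ?thesis by (rule that[OF K main])
qed

text \<open>Weight of the net point \<open>i\<close> for test functions at \<open>x\<close> of scale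
  about \<open>2 ^ j * \<delta>\<close>; the power of 2 is
  \<open>(\<delta> / r) powr \<beta>\<close> for \<open>r = 2 ^ j * \<delta>\<close>. The kernel is
  centred at \<open>i\<close>, so that it can be integrated in \<open>x\<close>.\<close>

definition wt :: "real \<Rightarrow> nat \<Rightarrow> 'a \<Rightarrow> 'a \<Rightarrow> real" where
  "wt \<delta> j i x = 2 powr (- (real j * \<beta>)) * V \<mu> \<delta> i * W \<gamma> (2 ^ j * \<delta>) i x"

abbreviation net_sum :: "real \<Rightarrow> (('a \<Rightarrow> real) \<Rightarrow> real) \<Rightarrow> 'a set \<Rightarrow> nat \<Rightarrow> 'a \<Rightarrow> ennreal" where
  "net_sum \<delta> f F j x \<equiv> (\<Sum>i\<in>F. ennreal (wt \<delta> j i x) * nt_inf \<delta> f i)"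

text \<open>For \<open>r > \<delta>\<close>, rounding \<open>r\<close> down to
  \<open>2 ^ j * \<delta>\<close> changes the kernels by a bounded factor;
  \<open>r \<le> \<delta>\<close> goes with \<open>j = 0\<close>. The bound then depends on the test
  function only through \<open>C\<close>, \<open>e\<close>, \<open>j\<close> and the finite set
  \<open>F\<close>, which summation over all scales and the whole net removes.\<close>

lemma pointwise_bound:
  obtains K where "K > 0"
    "\<And>\<delta> s f A r x C g e R. f \<in> dual \<Longrightarrow> kern \<delta> s \<Longrightarrow> separated \<delta> A \<Longrightarrow> (\<And>y. \<exists>i\<in>A. dist i y < \<delta>) \<Longrightarrow>
       0 < r \<Longrightarrow> tb x r \<beta> \<gamma> C g \<Longrightarrow> smooth g \<Longrightarrow> (\<And>y. R \<le> dist x1 y \<Longrightarrow> g y = 0) \<Longrightarrow> e > 0 \<Longrightarrow> C > 0 \<Longrightarrow>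
       \<exists>F j. finite F \<and> F \<subseteq> A \<and> ennreal \<bar>remainder f s g\<bar>
         \<le> ennreal e + ennreal (K * C) * (nt_max \<delta> f x + net_sum \<delta> f F j x)"
proof (rule large_scale_bound, rule small_scale_bound, goal_cases)
  case (1 K1 K2)
  note K1 = 1(2,3) and K2 = 1(4,5)
  define c where "c = C1 * 2 powr (n + \<gamma>)"
  have c: "c > 0" using C1_ge by (simp add: c_def)
  define K where "K = 1 + K1 * c + K2 * c"
  have K: "K > 0" "K1 * c \<le> K" "K2 * c \<le> K" "1 \<le> K" using K1(1) K2(1) c
    by (auto simp: K_def add_pos_nonneg)
  have sum_le: "(\<Sum>i\<in>F. ennreal (u i) * nt_inf \<delta> f i)
      \<le> ennreal (K * C) * net_sum \<delta> f F j x"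
    if C: "C > 0" and u: "\<And>i. u i \<le> K * C * wt \<delta> j i x" for u F C j \<delta> f x
    unfolding sum_distrib_left
  proof (rule sum_mono)
    fix i
    have "ennreal (u i) * nt_inf \<delta> f i \<le> ennreal (K * C * wt \<delta> j i x) * nt_inf \<delta> f i"
      by (intro mult_right_mono ennreal_leI u) simp
    then show "ennreal (u i) * nt_inf \<delta> f i \<le> ennreal (K * C) * (ennreal (wt \<delta> j i x) * nt_inf \<delta> f i)"
      using K C by (simp add: ennreal_mult wt_def mult.assoc)
  qed
  have main: "\<exists>F j. finite F \<and> F \<subseteq> A \<and> ennreal \<bar>remainder f s g\<bar>
         \<le> ennreal e + ennreal (K * C) * (nt_max \<delta> f x + net_sum \<delta> f F j x)"
    if f: "f \<in> dual" and s: "kern \<delta> s" and A: "separated \<delta> A" "\<And>y. \<exists>i\<in>A. dist i y < \<delta>"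
      and r: "0 < r" and g: "tb x r \<beta> \<gamma> C g" "smooth g" and supp: "\<And>y. R \<le> dist x1 y \<Longrightarrow> g y = 0"
      and e: "e > 0" and C: "C > 0" for \<delta> s f A r x C g e R
  proof (cases "r \<le> \<delta>")
    case True
    have \<delta>: "\<delta> > 0" using r True by simp
    obtain F where F: "finite F" "F \<subseteq> A" and b: "ennreal \<bar>remainder f s g\<bar>
         \<le> ennreal C * nt_max \<delta> f x + (\<Sum>i\<in>F. ennreal (K2 * C * V \<mu> \<delta> i * W \<gamma> \<delta> x i) * nt_inf \<delta> f i)"
      using K2(2)[OF f s A r True g supp C] by blast
    have *: "K2 * C * V \<mu> \<delta> i * W \<gamma> \<delta> x i \<le> K * C * wt \<delta> 0 i x" for i
    proof -
      have "W \<gamma> \<delta> x i \<le> c * W \<gamma> \<delta> i x" unfolding c_def using \<delta> bg_pos by (intro W_sym) auto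
      then have "K2 * C * V \<mu> \<delta> i * W \<gamma> \<delta> x i \<le> K2 * C * V \<mu> \<delta> i * (c * W \<gamma> \<delta> i x)"
        using K2(1) C by (intro mult_left_mono) auto
      also have "\<dots> = (K2 * c) * (C * wt \<delta> 0 i x)" by (simp add: wt_def)
      also have "\<dots> \<le> K * (C * wt \<delta> 0 i x)" using K C by (intro mult_right_mono) (auto simp: wt_def)
      finally show ?thesis by simp
    qed
    have "C \<le> K * C" using K C by (simp add: mult_le_cancel_right1)
    then have "ennreal C * nt_max \<delta> f x \<le> ennreal (K * C) * nt_max \<delta> f x"
      by (intro mult_right_mono ennreal_leI) auto
    from order_trans[OF b add_mono[OF this sum_le[OF C *]]]
    have "ennreal \<bar>remainder f s g\<bar> \<le> ennreal (K * C) * (nt_max \<delta> f x + net_sum \<delta> f F 0 x)"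
      by (simp add: distrib_left)
    also have "\<dots> \<le> ennreal e + \<dots>" by simp
    finally show ?thesis using F by blast
  next
    case False
    have \<delta>: "\<delta> > 0" using kernD[OF s] by simp
    then obtain j where j: "2 ^ j \<le> r / \<delta>" "r / \<delta> < 2 ^ Suc j"
      using dyadic_bracket[of "r / \<delta>"] False by (auto simp: field_simps)
    define R' where "R' = 2 ^ j * \<delta>"
    have R': "R' > 0" "R' \<le> r" "r \<le> 2 * R'" using j \<delta> by (auto simp: R'_def field_simps)
    obtain F where F: "finite F" "F \<subseteq> A" and b: "ennreal \<bar>remainder f s g\<bar>
         \<le> ennreal e + (\<Sum>i\<in>F. ennreal (K1 * C * (\<delta> / r) powr \<beta> * V \<mu> \<delta> i * W \<gamma> r x i) * nt_inf \<delta> f i)"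
      using K1(2)[OF f s A(1) A(2) _ g(1) g(2) supp e C] False by force
    have *: "K1 * C * (\<delta> / r) powr \<beta> * V \<mu> \<delta> i * W \<gamma> r x i \<le> K * C * wt \<delta> j i x" for i
    proof -
      have "(\<delta> / r) powr \<beta> \<le> (1 / 2 ^ j) powr \<beta>"
        using j \<delta> r bg_pos by (intro powr_mono2) (auto simp: field_simps)
      also have "(1 / 2 ^ j) powr \<beta> = 2 powr (- (real j * \<beta>))"
      proof -
        have "1 / 2 ^ j = (2::real) powr (- real j)"
          by (simp add: powr_minus powr_realpow divide_inverse)
        then show ?thesis by (simp only: powr_powr) simp
      qed
      finally have 1: "(\<delta> / r) powr \<beta> \<le> 2 powr (- (real j * \<beta>))" .
      have 2: "W \<gamma> r x i \<le> c * W \<gamma> R' i x"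
        unfolding c_def
      proof (rule W_compare)
        show "dist x i + (R' + dist i x) \<le> 2 * (r + dist x i)" using R' r by (simp add: dist_commute)
        have "r * (R' + dist i x) \<le> (2 * R') * (r + dist x i)" using R' r
          by (intro mult_mono) (auto simp: dist_commute)
        then show "r * (R' + dist i x) \<le> 2 * R' * (r + dist x i)" by simp
      qed (use r R' bg_pos in auto)
      have "K1 * C * (\<delta> / r) powr \<beta> * V \<mu> \<delta> i * W \<gamma> r x i
          \<le> K1 * C * 2 powr (- (real j * \<beta>)) * V \<mu> \<delta> i * (c * W \<gamma> R' i x)"
        using K1(1) C 1 2 by (intro mult_mono mult_left_mono) auto
      also have "\<dots> = (K1 * c) * (C * wt \<delta> j i x)" by (simp add: wt_def R'_def)
      also have "\<dots> \<le> K * (C * wt \<delta> j i x)" using K C by (intro mult_right_mono) (auto simp: wt_def)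
      finally show ?thesis by simp
    qed
    from order_trans[OF b add_left_mono[OF sum_le[OF C *]]]
    have "ennreal \<bar>remainder f s g\<bar> \<le> ennreal e + ennreal (K * C) * net_sum \<delta> f F j x" .
    also have "\<dots> \<le> ennreal e + ennreal (K * C) * (nt_max \<delta> f x + net_sum \<delta> f F j x)"
      by (intro add_left_mono mult_left_mono) auto
    finally show ?thesis using F by blast
  qed
  show ?case by (rule that[OF K(1) main])
qed

end

subsection \<open>Integration of the pointwise bound\<close>

context hardy_setting
begin

text \<open>The powers sit inside the sums, so this dominates the p-th power of
  \<open>net_sum \<delta> f F j x\<close> for every finite \<open>F \<subseteq> A\<close> and every
  \<open>j\<close>, hence uniformly in the test function.\<close>

definition wsum :: "real \<Rightarrow> (('a \<Rightarrow> real) \<Rightarrow> real) \<Rightarrow> 'a set \<Rightarrow> 'a \<Rightarrow> ennreal" where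
  "wsum \<delta> f A x = (\<integral>\<^sup>+i. (\<Sum>j. enn_powr (ennreal (wt \<delta> j i x) * nt_inf \<delta> f i) p) \<partial>count_space A)"

abbreviation nt_integral :: "real \<Rightarrow> (('a \<Rightarrow> real) \<Rightarrow> real) \<Rightarrow> ennreal" where
  "nt_integral \<delta> f \<equiv> (\<integral>\<^sup>+x. enn_powr (nt_max \<delta> f x) p \<partial>\<mu>)"

lemma wt_pos: "\<delta> > 0 \<Longrightarrow> wt \<delta> j i x > 0"
  unfolding wt_def by (intro mult_pos_pos V_pos W_pos) auto

lemma wt_measurable [measurable]: "wt \<delta> j i \<in> borel_measurable borel"
  unfolding wt_def[abs_def] by measurable

lemma wsum_measurable:
  assumes "countable A"
  shows "wsum \<delta> f A \<in> borel_measurable borel"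
  unfolding wsum_def[abs_def] using assms by (intro borel_measurable_nn_integral_count_space) measurable

lemma enn_powr_sum_le_wsum:
  assumes "finite F" "F \<subseteq> A"
  shows "enn_powr (nt_max \<delta> f x + net_sum \<delta> f F j x) p
    \<le> enn_powr (nt_max \<delta> f x) p + wsum \<delta> f A x"
proof -
  define t where "t j i = enn_powr (ennreal (wt \<delta> j i x) * nt_inf \<delta> f i) p" for j i
  have "enn_powr (net_sum \<delta> f F j x) p \<le> (\<Sum>i\<in>F. t j i)"
    unfolding t_def using assms p by (intro enn_powr_sum)
  also have "\<dots> \<le> (\<Sum>i\<in>F. \<Sum>j. t j i)"
    using sum_le_suminf[of "\<lambda>j. t j _" "{j}"] by (intro sum_mono) auto
  also have "\<dots> \<le> (\<integral>\<^sup>+i. (\<Sum>j. t j i) \<partial>count_space A)"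
    using assms by (rule sum_le_nn_integral_count_space)
  finally have "enn_powr (net_sum \<delta> f F j x) p \<le> wsum \<delta> f A x"
    by (simp add: wsum_def t_def)
  then have "enn_powr (nt_max \<delta> f x) p + enn_powr (net_sum \<delta> f F j x) p
      \<le> enn_powr (nt_max \<delta> f x) p + wsum \<delta> f A x" by (rule add_left_mono)
  then show ?thesis using enn_powr_add[OF p] order_trans by blast
qed

lemma exponents_pos: "n * (1 - p) < \<beta> * p" "n * (1 - p) < \<gamma> * p"
proof -
  have eq: "n * (1 / p - 1) * p = n * (1 - p)" using p by (simp add: field_simps)
  show "n * (1 - p) < \<beta> * p" "n * (1 - p) < \<gamma> * p"
    using mult_strict_right_mono[OF beta(1) p(1)] mult_strict_right_mono[OF gamma(1) p(1)]
      unfolding eq .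
qed

text \<open>Volume times infimum is the integral of the constant infimum over the ball, where it is
  at most \<open>nt_max\<close>. A point lies in at most \<open>C1 * 5 powr n\<close> of the balls
  (\<open>separated_ball\<close> with k = 1).\<close>

lemma sum_nt_inf_le:
  assumes A: "separated \<delta> A" and \<delta>: "\<delta> > 0"
  shows "(\<integral>\<^sup>+i. ennreal (V \<mu> \<delta> i) * enn_powr (nt_inf \<delta> f i) p \<partial>count_space A)
    \<le> ennreal (C1 * 5 powr n) * nt_integral \<delta> f"
proof -
  have A_countable: "countable A" by (rule separated_countable[OF A \<delta>])
  have "(\<integral>\<^sup>+i. ennreal (V \<mu> \<delta> i) * enn_powr (nt_inf \<delta> f i) p \<partial>count_space A)
      = (\<integral>\<^sup>+i. (\<integral>\<^sup>+x. enn_powr (nt_inf \<delta> f i) p * indicator (ball i \<delta>) x \<partial>\<mu>) \<partial>count_space A)"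
    using \<delta> by (intro nn_integral_cong, subst nn_integral_cmult_indicator) (simp_all add:
      emeasure_ball mult.commute)
  also have "\<dots> = (\<integral>\<^sup>+x. (\<integral>\<^sup>+i. enn_powr (nt_inf \<delta> f i) p * indicator (ball i \<delta>) x \<partial>count_space A) \<partial>\<mu>)"
    using A_countable by (intro nn_integral_count_space_nn_integral[symmetric]) 
      (auto intro!: borel_measurable_times_ennreal indicator_ball_measurable)
  also have "\<dots> \<le> (\<integral>\<^sup>+x. ennreal (C1 * 5 powr n) * enn_powr (nt_max \<delta> f x) p \<partial>\<mu>)"
  proof (rule nn_integral_mono)
    fix x
    have "(\<integral>\<^sup>+i. enn_powr (nt_inf \<delta> f i) p * indicator (ball i \<delta>) x \<partial>count_space A)
        \<le> (\<integral>\<^sup>+i. enn_powr (nt_max \<delta> f x) p * indicator (A \<inter> ball x \<delta>) i \<partial>count_space A)"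
    proof (rule nn_integral_mono)
      fix i assume "i \<in> space (count_space A)"
      then show "enn_powr (nt_inf \<delta> f i) p * indicator (ball i \<delta>) x
          \<le> enn_powr (nt_max \<delta> f x) p * indicator (A \<inter> ball x \<delta>) i"
        using p by (auto split: split_indicator simp: dist_commute nt_inf_def intro!: enn_powr_mono
          INF_lower)
    qed
    also have "\<dots> = enn_powr (nt_max \<delta> f x) p * emeasure (count_space A) (A \<inter> ball x \<delta>)"
      by (intro nn_integral_cmult_indicator) simp
    also have "\<dots> \<le> enn_powr (nt_max \<delta> f x) p * ennreal (C1 * 5 powr n)"
    proof (rule mult_left_mono)
      have "emeasure (count_space A) (A \<inter> ball x \<delta>) = of_nat (card (A \<inter> ball x \<delta>))"
        using separated_ball(1)[OF A \<delta>, of 1 x] by (intro emeasure_count_space_finite) auto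
      also have "\<dots> \<le> ennreal (C1 * 5 powr n)"
        using separated_ball(2)[OF A \<delta>, of 1 x] by (simp add: ennreal_of_nat_eq_real_of_nat ennreal_leI)
      finally show "emeasure (count_space A) (A \<inter> ball x \<delta>) \<le> ennreal (C1 * 5 powr n)" .
    qed simp
    finally show "(\<integral>\<^sup>+i. enn_powr (nt_inf \<delta> f i) p * indicator (ball i \<delta>) x \<partial>count_space A)
        \<le> ennreal (C1 * 5 powr n) * enn_powr (nt_max \<delta> f x) p"
      by (simp only: mult.commute)
  qed
  also have "\<dots> = ennreal (C1 * 5 powr n) * nt_integral \<delta> f"
    by (intro nn_integral_cmult) simp
  finally show ?thesis .
qed

text \<open>Integrating the kernel to the power \<open>p\<close> gives the volume of radius
  \<open>2 ^ j * \<delta>\<close> to the power 1 - p, at most a constant times 2^(j n (1 - p)) times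
  that of radius \<delta>. With the weight to the power \<open>p\<close>, this is a constant times
  \<open>V \<mu> \<delta> i * q ^ j\<close>. The sum over \<open>j\<close> is geometric, and the sum
  over \<open>i\<close> is \<open>sum_nt_inf_le\<close>.\<close>

lemma nn_integral_wsum:
  obtains K where "K > 0" "\<And>\<delta> f A. separated \<delta> A \<Longrightarrow> \<delta> > 0 \<Longrightarrow>
    (\<integral>\<^sup>+x. wsum \<delta> f A x \<partial>\<mu>) \<le> ennreal K * nt_integral \<delta> f"
proof -
  obtain C where C: "C > 0" "\<And>r x. r > 0 \<Longrightarrow>
      (\<integral>\<^sup>+ y. ennreal (W \<gamma> r x y powr p) \<partial>\<mu>) \<le> ennreal (C * V \<mu> r x powr (1 - p))"
    using nn_integral_W_powr[OF p exponents_pos(2)] by metis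
  define q where "q = 2 powr (n * (1 - p) - \<beta> * p)"
  have q: "0 < q" "q < 1" using exponents_pos(1) powr_less_mono[of "n * (1 - p) - \<beta> * p" 0 2]
    by (auto simp: q_def)
  define K0 where "K0 = C * C1 powr (1 - p)"
  have K0: "K0 > 0" using C C1_ge by (simp add: K0_def)
  define K where "K = K0 / (1 - q) * (C1 * 5 powr n)"
  have K: "K > 0" using K0 q C1_ge by (simp add: K_def)
  have main: "(\<integral>\<^sup>+x. wsum \<delta> f A x \<partial>\<mu>) \<le> ennreal K * nt_integral \<delta> f"
    if A: "separated \<delta> A" and \<delta>: "\<delta> > 0" for \<delta> f A
  proof -
    have cA: "countable A" by (rule separated_countable[OF A \<delta>])
    define m where "m i = enn_powr (nt_inf \<delta> f i) p" for i
    have each: "(\<integral>\<^sup>+x. enn_powr (ennreal (wt \<delta> j i x) * nt_inf \<delta> f i) p \<partial>\<mu>)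
      \<le> ennreal (K0 * V \<mu> \<delta> i * q ^ j) * m i" for i j
    proof -
      define v where "v = V \<mu> \<delta> i"
      have v: "v > 0" unfolding v_def by (rule V_pos[OF \<delta>])
      define R where "R = 2 ^ j * \<delta>"
      have R: "R > 0" using \<delta> by (simp add: R_def)
      define c where "c = (2 powr (- (real j * \<beta>)) * v) powr p"
      have c: "c > 0" using v by (simp add: c_def)
      have wtp: "wt \<delta> j i x powr p = c * W \<gamma> R i x powr p" for x
        unfolding wt_def c_def v_def R_def by (rule powr_mult)
      have "(\<integral>\<^sup>+x. enn_powr (ennreal (wt \<delta> j i x) * nt_inf \<delta> f i) p \<partial>\<mu>)
        = (\<integral>\<^sup>+x. ennreal (wt \<delta> j i x powr p) * m i \<partial>\<mu>)"
        unfolding m_def using wt_pos[OF \<delta>] by (simp add: enn_powr_mult)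
      also have "\<dots> = (\<integral>\<^sup>+x. ennreal (wt \<delta> j i x powr p) \<partial>\<mu>) * m i" by (intro nn_integral_multc) simp
      also have "(\<integral>\<^sup>+x. ennreal (wt \<delta> j i x powr p) \<partial>\<mu>)
        = ennreal c * (\<integral>\<^sup>+x. ennreal (W \<gamma> R i x powr p) \<partial>\<mu>)"
        unfolding wtp using c by (simp add: ennreal_mult nn_integral_cmult)
      also have "\<dots> \<le> ennreal c * ennreal (C * V \<mu> R i powr (1 - p))"
        by (intro mult_left_mono C(2) R) simp
      also have "\<dots> = ennreal (c * (C * V \<mu> R i powr (1 - p)))" using c C by (simp add: ennreal_mult)
      also have "\<dots> \<le> ennreal (K0 * v * q ^ j)"
      proof (rule ennreal_leI)
        have j: "(2::real) ^ j = 2 powr real j" by (simp add: powr_realpow)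
        have "V \<mu> R i \<le> C1 * (2 ^ j) powr n * v"
          unfolding v_def R_def using \<delta> by (intro V_shift) auto
        then have "V \<mu> R i powr (1 - p) \<le> (C1 * (2 ^ j) powr n * v) powr (1 - p)"
          using p by (intro powr_mono2) auto
        also have "\<dots> = C1 powr (1 - p) * 2 powr (real j * n * (1 - p)) * v powr (1 - p)"
          by (simp only: powr_mult powr_powr j)
        finally have "c * (C * V \<mu> R i powr (1 - p))
          \<le> c * (C * (C1 powr (1 - p) * 2 powr (real j * n * (1 - p)) * v powr (1 - p)))"
          using c C by (intro mult_left_mono) auto
        moreover have "c = 2 powr (- (real j * \<beta>) * p) * v powr p" unfolding c_def
          by (simp only: powr_mult powr_powr)
        ultimately have "c * (C * V \<mu> R i powr (1 - p))
            \<le> 2 powr (- (real j * \<beta>) * p) * v powr p * (C * (C1 powr (1 - p) * 2 powr (real j * n *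
              (1 - p)) * v powr (1 - p)))"
          by (simp only:)
        also have "2 powr (- (real j * \<beta>) * p) * v powr p * (C * (C1 powr (1 - p) * 2 powr (real j
          * n * (1 - p)) * v powr (1 - p)))
            = K0 * (v powr p * v powr (1 - p)) * (2 powr (- (real j * \<beta>) * p) * 2 powr (real j * n
              * (1 - p)))"
          by (simp add: K0_def)
        also have "v powr p * v powr (1 - p) = v" using v by (simp flip: powr_add)
        also have "2 powr (- (real j * \<beta>) * p) * 2 powr (real j * n * (1 - p)) = q ^ j"
        proof -
          have "2 powr (- (real j * \<beta>) * p) * 2 powr (real j * n * (1 - p))
            = 2 powr ((n * (1 - p) - \<beta> * p) * real j)"
            by (simp add: algebra_simps flip: powr_add)
          also have "\<dots> = q powr real j" by (simp only: q_def powr_powr)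
          also have "\<dots> = q ^ j" using q by (simp add: powr_realpow)
          finally show ?thesis .
        qed
        finally show "c * (C * V \<mu> R i powr (1 - p)) \<le> K0 * v * q ^ j" .
      qed
      finally show ?thesis by (simp add: v_def mult_right_mono)
    qed
    have inner: "(\<integral>\<^sup>+x. (\<Sum>j. enn_powr (ennreal (wt \<delta> j i x) * nt_inf \<delta> f i) p) \<partial>\<mu>)
        \<le> ennreal (K0 / (1 - q)) * (ennreal (V \<mu> \<delta> i) * m i)" for i
    proof -
      have "(\<integral>\<^sup>+x. (\<Sum>j. enn_powr (ennreal (wt \<delta> j i x) * nt_inf \<delta> f i) p) \<partial>\<mu>)
          = (\<Sum>j. \<integral>\<^sup>+x. enn_powr (ennreal (wt \<delta> j i x) * nt_inf \<delta> f i) p \<partial>\<mu>)"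
        by (intro nn_integral_suminf) simp
      also have "\<dots> \<le> (\<Sum>j. ennreal (K0 * V \<mu> \<delta> i * q ^ j) * m i)" by (intro suminf_le each) auto
      also have "\<dots> = (\<Sum>j. ennreal (K0 * V \<mu> \<delta> i * q ^ j)) * m i" by (rule ennreal_suminf_multc)
      also have "(\<Sum>j. ennreal (K0 * V \<mu> \<delta> i * q ^ j)) = ennreal (\<Sum>j. K0 * V \<mu> \<delta> i * q ^ j)"
        using q K0 by (intro suminf_ennreal2 summable_mult summable_geometric mult_nonneg_nonneg) auto
      also have "(\<Sum>j. K0 * V \<mu> \<delta> i * q ^ j) = K0 / (1 - q) * V \<mu> \<delta> i"
        using q by (subst suminf_mult) (auto simp: suminf_geometric summable_geometric)
      also have "ennreal (K0 / (1 - q) * V \<mu> \<delta> i) * m i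
        = ennreal (K0 / (1 - q)) * (ennreal (V \<mu> \<delta> i) * m i)"
        using K0 q by (subst ennreal_mult) (auto simp: mult.assoc)
      finally show ?thesis .
    qed
    have "(\<integral>\<^sup>+x. wsum \<delta> f A x \<partial>\<mu>)
        = (\<integral>\<^sup>+i. (\<integral>\<^sup>+x. (\<Sum>j. enn_powr (ennreal (wt \<delta> j i x) * nt_inf \<delta> f i) p) \<partial>\<mu>) \<partial>count_space A)"
      unfolding wsum_def using cA by (intro nn_integral_count_space_nn_integral) auto
    also have "\<dots> \<le> (\<integral>\<^sup>+i. ennreal (K0 / (1 - q)) * (ennreal (V \<mu> \<delta> i) * m i) \<partial>count_space A)"
      by (intro nn_integral_mono inner)
    also have "\<dots> = ennreal (K0 / (1 - q)) * (\<integral>\<^sup>+i. ennreal (V \<mu> \<delta> i) * m i \<partial>count_space A)"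
      by (intro nn_integral_cmult) simp
    also have "\<dots> \<le> ennreal (K0 / (1 - q)) * (ennreal (C1 * 5 powr n) * nt_integral \<delta> f)"
      unfolding m_def by (intro mult_left_mono sum_nt_inf_le[OF A \<delta>]) simp
    also have "\<dots> = ennreal K * nt_integral \<delta> f"
    proof -
      have "ennreal K = ennreal (K0 / (1 - q)) * ennreal (C1 * 5 powr n)"
        unfolding K_def using K0 q C1_ge by (intro ennreal_mult) auto
      then show ?thesis by (simp only: mult.assoc)
    qed
    finally show ?thesis .
  qed
  show ?thesis by (rule that[OF K main])
qed

text \<open>Without this, the integral in the definition of \<^const>\<open>minus_S\<close> could have the junk value \<open>0\<close>:
  the boundedness of \<open>f\<close> alone does not make \<open>S\<^sub>l f\<close> integrable against test functions.\<close>

lemma weighted_integrable: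
  assumes f: "f \<in> dual" and s: "kern \<delta> s" and A: "separated \<delta> A" "\<And>y. \<exists>i\<in>A. dist i y < \<delta>"
    and fin: "(\<integral>\<^sup>+x. wsum \<delta> f A x \<partial>\<mu>) < \<infinity>"
  shows "integrable \<mu> (\<lambda>z. f (s z) * W \<gamma> 1 x1 z)"
proof -
  have \<delta>: "\<delta> > 0" using kernD[OF s] by simp
  have cA: "countable A" by (rule separated_countable[OF A(1) \<delta>])
  \<comment> \<open>A function with finite integral cannot be infinite everywhere, because \<mu> is
    not zero. Finiteness at a single point \<open>x\<close> is enough: kernels centred at
    \<open>x\<close> and \<open>x1\<close> are comparable.\<close>
  obtain x where x: "wsum \<delta> f A x < \<infinity>"
  proof (rule ccontr)
    assume "\<not> thesis"
    then have "wsum \<delta> f A x = \<infinity>" for x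
      using that[of x] by (metis infinity_ennreal_def less_top)
    then have "(\<integral>\<^sup>+x. wsum \<delta> f A x \<partial>\<mu>) = \<infinity> * emeasure \<mu> (space \<mu>)" by simp
    moreover have "emeasure \<mu> (space \<mu>) \<noteq> 0"
      using ball_pos[OF \<delta>, of x1] emeasure_mono[of "ball x1 \<delta>" UNIV \<mu>] by (auto simp: sets_eq)
    ultimately show False using fin by (simp add: ennreal_top_mult)
  qed
  define t where "t = enn2real (wsum \<delta> f A x)"
  have t: "wsum \<delta> f A x = ennreal t" "t \<ge> 0" using x by (auto simp: t_def)
  \<comment> \<open>The terms with \<open>j = 0\<close>. Up to a constant, \<open>a i\<close> bounds
    the integral of \<open>\<bar>f (s z)\<bar> * W \<gamma> \<delta> x z\<close> over
    \<open>ball i \<delta>\<close>.\<close>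
  define a where "a i = ennreal (wt \<delta> 0 i x) * nt_inf \<delta> f i" for i
  have msum0: "(\<integral>\<^sup>+i. enn_powr (a i) p \<partial>count_space A) \<le> ennreal t"
    unfolding t(1)[symmetric] wsum_def a_def
    using sum_le_suminf[of "\<lambda>j. enn_powr (ennreal (wt \<delta> j _ x) * nt_inf \<delta> f _) p" "{0}"]
    by (intro nn_integral_mono) auto
  \<comment> \<open>Only the p-th powers are known to be summable. As \<open>p \<le> 1\<close>,
    \<open>le_enn_powr\<close> passes to the terms themselves.\<close>
  have suma: "(\<integral>\<^sup>+i. a i \<partial>count_space A) < \<infinity>"
  proof -
    have "a i \<le> ennreal (t powr (1 / p - 1)) * enn_powr (a i) p" if "i \<in> A" for i
    proof (rule le_enn_powr[OF p _ t(2)])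
      show "enn_powr (a i) p \<le> ennreal t"
        using sum_le_nn_integral_count_space[of "{i}" A "\<lambda>i. enn_powr (a i) p"] msum0 that by auto
    qed
    then have "(\<integral>\<^sup>+i. a i \<partial>count_space A)
      \<le> (\<integral>\<^sup>+i. ennreal (t powr (1 / p - 1)) * enn_powr (a i) p \<partial>count_space A)"
      by (intro nn_integral_mono) simp
    also have "\<dots> = ennreal (t powr (1 / p - 1)) * (\<integral>\<^sup>+i. enn_powr (a i) p \<partial>count_space A)"
      by (intro nn_integral_cmult) simp
    also have "\<dots> \<le> ennreal (t powr (1 / p - 1)) * ennreal t" by (intro mult_left_mono msum0) simp
    also have "\<dots> < \<infinity>" by (simp add: ennreal_mult_less_top)
    finally show ?thesis .
  qed
  obtain K1 where K1: "K1 > 0" "\<And>\<delta> r x i. 0 < r \<Longrightarrow> r \<le> \<delta> \<Longrightarrow>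
    (\<integral>\<^sup>+z. ennreal (W \<gamma> r x z) * indicator (ball i \<delta>) z \<partial>\<mu>) \<le> ennreal (K1 * V \<mu> \<delta> i * W \<gamma> \<delta> x i)"
    using ball_mass_W by metis
  define K2 where "K2 = chg_const 1 \<gamma> * C4"
  have K2: "K2 > 0" using chg_const_pos[of 1 \<gamma>] C4 by (simp add: K2_def)
  define c where "c = C1 * 2 powr (n + \<gamma>)"
  have c: "c > 0" using C1_ge by (simp add: c_def)
  define b where "b i = ennreal K2 * nt_inf \<delta> f i" for i
  define h where "h z = ennreal \<bar>f (s z)\<bar> * ennreal (W \<gamma> \<delta> x z)" for z
  have "(\<integral>\<^sup>+z. h z \<partial>\<mu>)
      \<le> (\<integral>\<^sup>+z. (\<integral>\<^sup>+i. b i * (ennreal (W \<gamma> \<delta> x z) * indicator (ball i \<delta>) z) \<partial>count_space A) \<partial>\<mu>)"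
  proof (rule nn_integral_mono)
    fix z
    obtain i where i: "i \<in> A" "dist i z < \<delta>" using A by blast
    have "h z \<le> b i * ennreal (W \<gamma> \<delta> x z)"
      unfolding h_def b_def K2_def by (intro mult_right_mono kern_nt_inf[OF f s i(2)]) simp
    also have "\<dots> = (\<Sum>i\<in>{i}. b i * (ennreal (W \<gamma> \<delta> x z) * indicator (ball i \<delta>) z))" using i by simp
    also have "\<dots> \<le> (\<integral>\<^sup>+i. b i * (ennreal (W \<gamma> \<delta> x z) * indicator (ball i \<delta>) z) \<partial>count_space A)"
      using i by (intro sum_le_nn_integral_count_space) auto
    finally show "h z \<le> (\<integral>\<^sup>+i. b i * (ennreal (W \<gamma> \<delta> x z) * indicator (ball i \<delta>) z) \<partial>count_space A)" .
  qed
  also have "\<dots> = (\<integral>\<^sup>+i. (\<integral>\<^sup>+z. b i * (ennreal (W \<gamma> \<delta> x z) * indicator (ball i \<delta>) z) \<partial>\<mu>) \<partial>count_space A)"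
    using cA by (intro nn_integral_count_space_nn_integral)
      (auto intro!: borel_measurable_times_ennreal indicator_ball_measurable)
  also have "\<dots> \<le> (\<integral>\<^sup>+i. ennreal (K2 * K1 * c) * a i \<partial>count_space A)"
  proof (rule nn_integral_mono)
    fix i
    have "(\<integral>\<^sup>+z. b i * (ennreal (W \<gamma> \<delta> x z) * indicator (ball i \<delta>) z) \<partial>\<mu>)
        = b i * (\<integral>\<^sup>+z. ennreal (W \<gamma> \<delta> x z) * indicator (ball i \<delta>) z \<partial>\<mu>)"
      by (intro nn_integral_cmult) simp
    also have "\<dots> \<le> b i * ennreal (K1 * V \<mu> \<delta> i * W \<gamma> \<delta> x i)"
      by (intro mult_left_mono K1(2) \<delta>) auto
    also have "\<dots> \<le> b i * ennreal (K1 * c * wt \<delta> 0 i x)"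
    proof (intro mult_left_mono ennreal_leI)
      have "W \<gamma> \<delta> x i \<le> c * W \<gamma> \<delta> i x" unfolding c_def using \<delta> bg_pos by (intro W_sym) auto
      then have "K1 * V \<mu> \<delta> i * W \<gamma> \<delta> x i \<le> K1 * V \<mu> \<delta> i * (c * W \<gamma> \<delta> i x)"
        using K1(1) by (intro mult_left_mono) auto
      then show "K1 * V \<mu> \<delta> i * W \<gamma> \<delta> x i \<le> K1 * c * wt \<delta> 0 i x" by (simp add: wt_def mult_ac)
    qed simp
    also have "\<dots> = ennreal (K2 * K1 * c) * a i"
      using K1 K2 c wt_pos[OF \<delta>, of 0 i x] by (simp add: b_def a_def ennreal_mult mult_ac)
    finally show "(\<integral>\<^sup>+z. b i * (ennreal (W \<gamma> \<delta> x z) * indicator (ball i \<delta>) z) \<partial>\<mu>)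
      \<le> ennreal (K2 * K1 * c) * a i" .
  qed
  also have "\<dots> = ennreal (K2 * K1 * c) * (\<integral>\<^sup>+i. a i \<partial>count_space A)" by (intro nn_integral_cmult) simp
  also have "\<dots> < \<infinity>" using suma by (simp add: ennreal_mult_less_top)
  finally have h: "(\<integral>\<^sup>+z. h z \<partial>\<mu>) < \<infinity>" .
  obtain K where K: "K > 0" "\<And>y. W \<gamma> 1 x1 y \<le> K * W \<gamma> \<delta> x y"
    using W_recenter[of 1 \<delta> \<gamma> x1 x] \<delta> bg_pos by auto
  have m: "(\<lambda>z. f (s z)) \<in> borel_measurable borel"
    by (rule borel_measurable_continuous_onI[OF dual_kern_continuous[OF f s]])
  show ?thesis
  proof (rule integrableI_bounded)
    show "(\<lambda>z. f (s z) * W \<gamma> 1 x1 z) \<in> borel_measurable \<mu>" using m by simp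
    have "(\<integral>\<^sup>+z. ennreal (norm (f (s z) * W \<gamma> 1 x1 z)) \<partial>\<mu>) \<le> (\<integral>\<^sup>+z. ennreal K * h z \<partial>\<mu>)"
    proof (rule nn_integral_mono)
      fix z
      have "norm (f (s z) * W \<gamma> 1 x1 z) \<le> \<bar>f (s z)\<bar> * (K * W \<gamma> \<delta> x z)"
        using K(2)[of z] by (simp add: abs_mult mult_left_mono)
      then have "ennreal (norm (f (s z) * W \<gamma> 1 x1 z)) \<le> ennreal (\<bar>f (s z)\<bar> * (K * W \<gamma> \<delta> x z))"
        by (rule ennreal_leI)
      also have "\<dots> = ennreal K * h z" using K(1) by (simp add: h_def ennreal_mult mult_ac)
      finally show "ennreal (norm (f (s z) * W \<gamma> 1 x1 z)) \<le> ennreal K * h z" .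
    qed
    also have "\<dots> = ennreal K * (\<integral>\<^sup>+z. h z \<partial>\<mu>)" unfolding h_def using m by (intro nn_integral_cmult) simp
    also have "\<dots> < \<infinity>" using h by (simp add: ennreal_mult_less_top)
    finally show "(\<integral>\<^sup>+z. ennreal (norm (f (s z) * W \<gamma> 1 x1 z)) \<partial>\<mu>) < \<infinity>" .
  qed
qed

section \<open>Approximation of general test functions, and the integrated estimate for one
  kernel\<close>

text \<open>The approximation must be close in the norm at \<open>x1\<close>, where \<open>f\<close>
  is continuous, and must keep the bound at \<open>x\<close> of scale \<open>r\<close> with a
  constant independent of both. In 14 = 7 * 2, the 2 is kept by taking \<open>e'\<close> small
  relative to the recentring constant \<open>K\<close>, and the 7 comes from
  \<open>tb_cutoff\<close>.\<close>

lemma test_approx: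
  assumes \<phi>: "\<phi> \<in> test" "tb x r \<beta> \<gamma> C \<phi>" and r: "r > 0" and C: "C > 0" and e: "e > 0"
  obtains g R where "smooth g" "\<And>y. R \<le> dist x1 y \<Longrightarrow> g y = 0" "tb x r \<beta> \<gamma> (14 * C) g"
    "tb x1 1 \<beta> \<gamma> e (\<lambda>y. \<phi> y - g y)"
proof -
  obtain K where K: "K > 0" "\<And>x' y C h. dist x' y \<le> dist x1 x \<Longrightarrow> tb x' 1 \<beta> \<gamma> C h \<Longrightarrow> tb y r \<beta> \<gamma> (K * C) h"
    by (rule tb_recenter[of 1 r \<beta> \<gamma> "dist x1 x"]) (use r bg_pos le1 in auto)
  define e' where "e' = min (e / 2) (C / K)"
  have e': "e' > 0" "K * e' \<le> C" "e' \<le> e / 2" using e C K by (auto simp: e'_def min_def field_simps)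
  obtain g0 where g0: "smooth g0" "tb x1 1 \<beta> \<gamma> e' (\<lambda>y. \<phi> y - g0 y)" using \<phi>(1) e'(1)
    unfolding test_iff by blast
  have "tb x r \<beta> \<gamma> (C + K * e') (\<lambda>y. \<phi> y - (\<phi> y - g0 y))"
    by (rule tb_diff[OF \<phi>(2) K(2)[OF order_refl g0(2)]])
  then have tbg0: "tb x r \<beta> \<gamma> (2 * C) g0" using tb_mono[of x r \<beta> \<gamma> "C + K * e'" g0 "2 * C"] e' by simp
  obtain \<rho> where \<rho>: "\<rho> \<ge> r" "smooth (\<lambda>y. g0 y * cutoff x \<rho> y)"
    "tb x1 1 \<beta> \<gamma> (e / 2) (\<lambda>y. g0 y - g0 y * cutoff x \<rho> y)"
    using cutoff_approx[OF g0(1) _ r, of "e / 2"] e by auto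
  define g where "g y = g0 y * cutoff x \<rho> y" for y
  show ?thesis
  proof (rule that)
    show "smooth g" using \<rho>(2) by (simp add: g_def[abs_def])
    show "g y = 0" if "2 * \<rho> + dist x1 x \<le> dist x1 y" for y
      using that dist_triangle[of x1 y x] \<rho>(1) r by (simp add: g_def cutoff_eq_0)
    show "tb x r \<beta> \<gamma> (14 * C) g"
      using tb_cutoff[OF r \<rho>(1) bg_pos(1) le1(2) tbg0] by (simp add: g_def[abs_def])
    have "tb x1 1 \<beta> \<gamma> (e' + e / 2) (\<lambda>y. (\<phi> y - g0 y) + (g0 y - g0 y * cutoff x \<rho> y))"
      by (rule tb_add[OF g0(2) \<rho>(3)])
    then have "tb x1 1 \<beta> \<gamma> (e' + e / 2) (\<lambda>y. \<phi> y - g y)" by (simp add: g_def)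
    then show "tb x1 1 \<beta> \<gamma> e (\<lambda>y. \<phi> y - g y)" by (rule tb_mono) (use e' in simp)
  qed
qed

lemma nn_integral_grand_max_le:
  obtains K where "K > 0" "\<And>\<delta> s f. f \<in> dual \<Longrightarrow> kern \<delta> s \<Longrightarrow>
    (\<integral>\<^sup>+x. enn_powr (grand_max \<mu> x1 \<epsilon> \<beta> \<gamma> (remainder f s) x) p \<partial>\<mu>)
      \<le> ennreal K * nt_integral \<delta> f"
proof (rule pointwise_bound, rule nn_integral_wsum, goal_cases)
  case (1 K1 K2)
  note K1 = 1(2,3) and K2 = 1(4,5)
  \<comment> \<open>14 from \<open>test_approx\<close>, \<open>C1 * 2 powr n\<close> from passing to
    \<open>tb\<close>, and 2 because a norm at most 1 is an infimum, which only guarantees the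
    constants above 1.\<close>
  define c where "c = 14 * (C1 * 2 powr n * 2)"
  have c: "c > 0" using C1_ge by (simp add: c_def)
  define K3 where "K3 = K1 * c"
  have K3: "K3 > 0" using K1(1) c by (simp add: K3_def)
  define K where "K = K3 powr p * (1 + K2)"
  have K: "K > 0" using K3 K2(1) by (simp add: K_def add_pos_pos)
  have main: "(\<integral>\<^sup>+x. enn_powr (grand_max \<mu> x1 \<epsilon> \<beta> \<gamma> (remainder f s) x) p \<partial>\<mu>)
      \<le> ennreal K * nt_integral \<delta> f"
    if f: "f \<in> dual" and s: "kern \<delta> s" for \<delta> s f
  proof (cases "nt_integral \<delta> f = \<infinity>")
    case True
    then show ?thesis using K by (simp add: ennreal_mult_top)
  next
    case False
    have \<delta>: "\<delta> > 0" using kernD[OF s] by simp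
    obtain A :: "'a set" where A: "separated \<delta> A" "\<And>y. \<exists>x\<in>A. dist x y < \<delta>"
      using maximal_separated_exists[OF \<delta>] by metis
    have cA: "countable A" by (rule separated_countable[OF A(1) \<delta>])
    have "ennreal K2 * nt_integral \<delta> f < \<infinity>"
      using False by (simp add: ennreal_mult_less_top less_top)
    then have fin: "(\<integral>\<^sup>+x. wsum \<delta> f A x \<partial>\<mu>) < \<infinity>" using K2(2)[OF A(1) \<delta>, of f]
      by (rule le_less_trans[rotated])
    define h where "h z = f (s z) * W \<gamma> 1 x1 z" for z
    have ih: "integrable \<mu> h" unfolding h_def[abs_def] by (rule weighted_integrable[OF f s A fin])
    define J where "J = (LINT z|\<mu>. \<bar>h z\<bar>)"
    have J: "J \<ge> 0" by (simp add: J_def)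
    have m: "(\<lambda>z. f (s z)) \<in> borel_measurable borel"
      by (rule borel_measurable_continuous_onI[OF dual_kern_continuous[OF f s]])
    \<comment> \<open>Integrability of \<open>h\<close> makes pairing with
      \<open>\<lambda>z. f (s z)\<close> continuous in the norm at \<open>x1\<close>, so the whole
      remainder, and not only \<open>f\<close>, passes to limits of test functions.\<close>
    have int: "integrable \<mu> (\<lambda>z. f (s z) * \<phi> z)" "\<bar>LINT z|\<mu>. f (s z) * \<phi> z\<bar> \<le> B * J"
      if \<phi>: "tb x1 1 \<beta> \<gamma> B \<phi>" for \<phi> B
    proof -
      have B: "B \<ge> 0" using tb_const_nonneg[OF _ \<phi>] by simp
      have le: "\<bar>f (s z) * \<phi> z\<bar> \<le> B * \<bar>h z\<bar>" for z
        using mult_left_mono[OF tb_size[OF \<phi>, of z] abs_ge_zero[of "f (s z)"]]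
          by (simp add: h_def abs_mult mult_ac)
      have i: "integrable \<mu> (\<lambda>z. B * \<bar>h z\<bar>)" using ih by simp
      show 1: "integrable \<mu> (\<lambda>z. f (s z) * \<phi> z)"
      proof (rule Bochner_Integration.integrable_bound[OF i])
        show "(\<lambda>z. f (s z) * \<phi> z) \<in> borel_measurable \<mu>"
          using m tb_measurable[OF _ bg_pos(1) \<phi>] by simp
        show "AE z in \<mu>. norm (f (s z) * \<phi> z) \<le> norm (B * \<bar>h z\<bar>)"
          using le B by (intro AE_I2) (simp only: real_norm_def abs_of_nonneg mult_nonneg_nonneg
            abs_ge_zero)
      qed
      have "\<bar>LINT z|\<mu>. f (s z) * \<phi> z\<bar> \<le> (LINT z|\<mu>. \<bar>f (s z) * \<phi> z\<bar>)" by (rule integral_abs_bound)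
      also have "\<dots> \<le> (LINT z|\<mu>. B * \<bar>h z\<bar>)" by (rule integral_mono[OF integrable_abs[OF 1] i le])
      finally show "\<bar>LINT z|\<mu>. f (s z) * \<phi> z\<bar> \<le> B * J" by (simp add: J_def)
    qed
    obtain B where B: "B > 0" "\<And>\<phi> C. \<phi> \<in> test \<Longrightarrow> tb x1 1 \<beta> \<gamma> C \<phi> \<Longrightarrow> \<bar>f \<phi>\<bar> \<le> B * C"
      using dual_bound[OF f] by metis
    \<comment> \<open>\<open>H\<close> involves neither \<phi> nor its scale, so a bound by
      \<open>H x\<close> survives the supremum in \<open>grand_max\<close>.\<close>
    define H where "H x = enn_powr (nt_max \<delta> f x) p + wsum \<delta> f A x" for x
    have bound: "ennreal \<bar>remainder f s \<phi>\<bar> \<le> ennreal K3 * enn_powr (H x) (1 / p)"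
      if \<phi>: "\<phi> \<in> test" and r: "r > 0" and gs: "\<phi> \<in> Gset \<mu> x r \<beta> \<gamma>" "Gnorm \<mu> x r \<beta> \<gamma> \<phi> \<le> 1" for \<phi> x r
    proof (rule ennreal_le_epsilon)
      fix e :: real assume e: "0 < e"
      have "test_bound \<mu> x r \<beta> \<gamma> 2 \<phi>" using gs by (intro test_bound_of_Gnorm_less) auto
      then have tb\<phi>: "tb x r \<beta> \<gamma> (C1 * 2 powr n * 2) \<phi>" by (rule tb_of_test_bound[OF r])
      \<comment> \<open>Replacing \<phi> by \<open>g\<close> costs \<open>B * e'\<close> in
        \<open>f\<close> and \<open>J * e'\<close> in the integral, together \<open>e / 2\<close>.
        The other half goes to \<open>pointwise_bound\<close>.\<close>
      define e' where "e' = e / 2 / (B + J)"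
      have "B + J > 0" using B(1) J by simp
      then have e': "e' > 0" "(B + J) * e' = e / 2" using e unfolding e'_def
        by (simp, metis less_irrefl nonzero_mult_div_cancel_left times_divide_eq_right)
      have c': "C1 * 2 powr n * 2 > 0" using C1_ge by simp
      obtain g R where g: "smooth g" "\<And>y. R \<le> dist x1 y \<Longrightarrow> g y = 0" "tb x r \<beta> \<gamma> c g"
          "tb x1 1 \<beta> \<gamma> e' (\<lambda>y. \<phi> y - g y)"
        using test_approx[OF \<phi> tb\<phi> r c' e'(1)] unfolding c_def by metis
      obtain F j where F: "finite F" "F \<subseteq> A" and b: "ennreal \<bar>remainder f s g\<bar>
         \<le> ennreal (e / 2) + ennreal (K1 * c) * (nt_max \<delta> f x + net_sum \<delta> f F j x)"
        using K1(2)[OF f s A(1) A(2) r g(3) g(1) _ _ c, of R "e / 2"] g(2) e by auto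
      obtain Bg where Bg: "tb x1 1 \<beta> \<gamma> Bg g" using smooth_tb[OF g(1)] .
      obtain B\<phi> where B\<phi>: "tb x1 1 \<beta> \<gamma> B\<phi> \<phi>" using \<phi> unfolding test_iff by blast
      have "\<bar>f \<phi> - f g\<bar> \<le> B * e'"
        using B(2)[OF test_diff_smooth[OF \<phi> g(1)] g(4)] dual_diff[OF f \<phi> g(1)] by simp
      moreover have "\<bar>(LINT z|\<mu>. f (s z) * \<phi> z) - (LINT z|\<mu>. f (s z) * g z)\<bar> \<le> e' * J"
        using int(2)[OF g(4)] int(1)[OF Bg] int(1)[OF B\<phi>] by (simp add: right_diff_distrib)
      ultimately have "\<bar>remainder f s \<phi>\<bar> \<le> e / 2 + \<bar>remainder f s g\<bar>"
        using e'(2) by (simp add: algebra_simps)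
      then have "ennreal \<bar>remainder f s \<phi>\<bar>
          \<le> ennreal (e / 2 + \<bar>remainder f s g\<bar>)" by (rule ennreal_leI)
      also have "\<dots> = ennreal (e / 2) + ennreal \<bar>remainder f s g\<bar>" using e by simp
      also have "\<dots> \<le> ennreal (e / 2) + (ennreal (e / 2)
          + ennreal K3 * (nt_max \<delta> f x + net_sum \<delta> f F j x))"
        using b unfolding K3_def by (intro add_left_mono)
      also have "\<dots> \<le> ennreal (e / 2) + (ennreal (e / 2) + ennreal K3 * enn_powr (H x) (1 / p))"
      proof (intro add_left_mono mult_left_mono)
        define X where "X = nt_max \<delta> f x + net_sum \<delta> f F j x"
        have "enn_powr (enn_powr X p) (1 / p) \<le> enn_powr (H x) (1 / p)"
          using p F unfolding X_def H_def by (intro enn_powr_mono enn_powr_sum_le_wsum) auto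
        then show "X \<le> enn_powr (H x) (1 / p)" using enn_powr_inverse(1)[OF p(1)] by simp
      qed simp
      also have "\<dots> = (ennreal (e / 2) + ennreal (e / 2)) + ennreal K3 * enn_powr (H x) (1 / p)"
        by (simp add: add.assoc)
      also have "ennreal (e / 2) + ennreal (e / 2) = ennreal e" using e by (simp flip: ennreal_plus)
      finally show "ennreal \<bar>remainder f s \<phi>\<bar> \<le> ennreal K3 * enn_powr (H x) (1 / p) + ennreal e"
        by (simp add: add.commute)
    qed
    \<comment> \<open>The majorant is measurable. Monotonicity of the integral asks no measurability
      of \<open>grand_max\<close>; the additivity used next does ask it of the majorant.\<close>
    have pt: "enn_powr (grand_max \<mu> x1 \<epsilon> \<beta> \<gamma> (remainder f s) x) p \<le> ennreal (K3 powr p) * H x" for x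
    proof -
      have "grand_max \<mu> x1 \<epsilon> \<beta> \<gamma> (remainder f s) x \<le> ennreal K3 * enn_powr (H x) (1 / p)"
        unfolding grand_max_def by (rule Sup_least) (use bound in blast)
      then have "enn_powr (grand_max \<mu> x1 \<epsilon> \<beta> \<gamma> (remainder f s) x) p
          \<le> enn_powr (ennreal K3 * enn_powr (H x) (1 / p)) p" using p by (intro enn_powr_mono)
      also have "\<dots> = ennreal (K3 powr p) * H x"
        using enn_powr_mult[OF K3] enn_powr_inverse(2)[OF p(1)] by simp
      finally show ?thesis .
    qed
    have "(\<integral>\<^sup>+x. enn_powr (grand_max \<mu> x1 \<epsilon> \<beta> \<gamma> (remainder f s) x) p \<partial>\<mu>)
        \<le> (\<integral>\<^sup>+x. ennreal (K3 powr p) * H x \<partial>\<mu>)" by (intro nn_integral_mono pt)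
    also have "\<dots> = ennreal (K3 powr p) * (nt_integral \<delta> f + (\<integral>\<^sup>+x. wsum \<delta> f A x \<partial>\<mu>))"
      unfolding H_def using wsum_measurable[OF cA]
        by (subst nn_integral_cmult) (auto simp: nn_integral_add)
    also have "\<dots> \<le> ennreal (K3 powr p) * (nt_integral \<delta> f + ennreal K2 * nt_integral \<delta> f)"
      by (intro mult_left_mono add_left_mono K2(2)[OF A(1) \<delta>]) simp
    also have "\<dots> = ennreal K * nt_integral \<delta> f"
      using K2(1) by (simp add: K_def ennreal_mult distrib_right distrib_left mult.assoc)
    finally show ?thesis .
  qed
  show ?case by (rule 1(1)[OF K main])
qed

end

section \<open>From an approximation of the identity to kernels with \<delta> = 2^(-l)\<close>

lemma AOTI_kernel_bounds:
  assumes "AOTI \<mu> \<epsilon>1 \<epsilon>2 \<epsilon>3 S"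
  obtains C4 where "C4 > 0"
    "\<And>k x. test_bound \<mu> x (2 powr (- real_of_int k)) \<epsilon>1 \<epsilon>2 C4 (S k x)"
    "\<And>k x x' y. dist x x' \<le> (2 powr (- real_of_int k) + dist x y) / 2 \<Longrightarrow>
        \<bar>S k x y - S k x' y\<bar> \<le> C4 * (dist x x' / (2 powr (- real_of_int k) + dist x y)) powr \<epsilon>1
          * (1 / (V \<mu> (2 powr (- real_of_int k)) x + Vxy \<mu> x y))
          * (2 powr (- real_of_int k) / (2 powr (- real_of_int k) + dist x y)) powr \<epsilon>2"
    "\<And>k y. (LINT z|\<mu>. S k z y) = 1"
  using assms unfolding AOTI_def of_int_minus
proof (elim conjE exE, goal_cases)
  case (1 C4)
  show ?case
  proof (rule 1(1)[of C4])
    show "C4 > 0" by fact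
    \<comment> \<open>Conditions (i) and (iii) together say that the row at \<open>x\<close> is a
      test function centred at \<open>x\<close>. Condition (ii) cannot be put this way for columns
      yet, because its volumes are centred at \<open>x\<close> and not at \<open>y\<close>.\<close>
    show "test_bound \<mu> x (2 powr (- real_of_int k)) \<epsilon>1 \<epsilon>2 C4 (S k x)" for k x
      unfolding test_bound_def using 1 by (simp add: abs_minus_commute)
  qed (use 1 in auto)
qed

theorem theorem3p3:
  fixes \<mu> :: "'a::metric_space measure"
    and n \<epsilon>1 \<epsilon>2 \<epsilon>3 \<epsilon> p \<beta> \<gamma> :: real
    and S :: "int \<Rightarrow> 'a \<Rightarrow> 'a \<Rightarrow> real"
    and x1 :: 'a
  assumes RD: "RD_space \<mu> n"
    and infinite: "emeasure \<mu> (space \<mu>) = \<infinity>"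
    and eps1: "0 < \<epsilon>1" "\<epsilon>1 \<le> 1" and eps2: "0 < \<epsilon>2" and eps3: "0 < \<epsilon>3"
    and eps: "0 < \<epsilon>" "\<epsilon> < min \<epsilon>1 \<epsilon>2"
    and S: "AOTI \<mu> \<epsilon>1 \<epsilon>2 \<epsilon>3 S"
    and p: "n / (n + \<epsilon>) < p" "p \<le> 1"
    and beta: "n * (1 / p - 1) < \<beta>" "\<beta> < \<epsilon>"
    and gamma: "n * (1 / p - 1) < \<gamma>" "\<gamma> < \<epsilon>"
  shows "\<exists>C>0. \<forall>l::int. \<forall>f \<in> G0_dual \<mu> x1 \<epsilon> \<beta> \<gamma>.
           Hp_norm \<mu> x1 \<epsilon> \<beta> \<gamma> p (minus_S \<mu> S l f)
             \<le> ennreal C * Lp_norm \<mu> p (grand_max_loc \<mu> x1 \<epsilon> \<beta> \<gamma> l f)"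
proof -
  have hom: "admissible_measure \<mu>" "n > 0"
    using RD by (auto simp: RD_space_def homogeneous_type_def)
  obtain C1 where C1: "C1 \<ge> 1" "\<And>x t r. t \<ge> 1 \<Longrightarrow> r > 0 \<Longrightarrow>
      measure \<mu> (ball x (t * r)) \<le> C1 * t powr n * measure \<mu> (ball x r)"
    using RD unfolding RD_space_def homogeneous_type_def by blast
  interpret doubling_space \<mu> n C1
    by unfold_locales (use hom C1 in \<open>auto simp: admissible_measure_def\<close>)
  define \<delta> where "\<delta> k = 2 powr (- real_of_int k)" for k
  have \<delta>: "\<delta> k > 0" for k by (simp add: \<delta>_def)
  obtain C4 where ker: "C4 > 0"
    "\<And>k x. test_bound \<mu> x (\<delta> k) \<epsilon>1 \<epsilon>2 C4 (S k x)"
    "\<And>k x x' y. dist x x' \<le> (\<delta> k + dist x y) / 2 \<Longrightarrow>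
        \<bar>S k x y - S k x' y\<bar> \<le> C4 * (dist x x' / (\<delta> k + dist x y)) powr \<epsilon>1
          * (1 / (V \<mu> (\<delta> k) x + Vxy \<mu> x y)) * (\<delta> k / (\<delta> k + dist x y)) powr \<epsilon>2"
    "\<And>k y. (LINT z|\<mu>. S k z y) = 1"
    using AOTI_kernel_bounds[OF S, folded \<delta>_def] by metis
  define c1 where "c1 = C1 * 2 powr n"
  define c2 where "c2 = C1 * 2 powr (n + \<epsilon>2)"
  have c: "c1 > 0" "c2 > 0" using C1 by (auto simp: c1_def c2_def)
  \<comment> \<open>One constant for rows and columns: \<open>c1\<close> passes from the kernel of
    the AOTI to \<open>W\<close>, and columns pay \<open>c2\<close> for swapping the centre.\<close>
  define C5 where "C5 = c1 * C4 * (1 + c2)"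
  have C5: "C5 > 0" "c1 * C4 \<le> C5" "c1 * C4 * c2 \<le> C5" using c ker(1)
    by (auto simp: C5_def distrib_left add_pos_pos)
  have p0: "p > 0"
  proof -
    have "n / (n + \<epsilon>) > 0" using hom eps by simp
    then show ?thesis using p by linarith
  qed
  interpret hardy_setting \<mu> n C1 \<epsilon>1 \<epsilon>2 \<epsilon> \<beta> \<gamma> p C5 x1
    by unfold_locales (use eps1 eps p0 p beta gamma C5 in auto)
  have kern: "kern (\<delta> k) (S k)" for k
    unfolding kern_def
  proof (intro conjI allI \<delta> ker(4))
    fix x
    from tb_mono[OF tb_of_test_bound[OF \<delta> ker(2)]] show "tb x (\<delta> k) \<epsilon>1 \<epsilon>2 C5 (S k x)"
      using C5(2) by (simp add: c1_def)
  next
    fix y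
    have W: "C4 * (1 / (V \<mu> (\<delta> k) x + Vxy \<mu> x y) * (\<delta> k / (\<delta> k + dist x y)) powr \<epsilon>2)
      \<le> C5 * W \<epsilon>2 (\<delta> k) y x" for x
    proof -
      have "1 / (V \<mu> (\<delta> k) x + Vxy \<mu> x y) * (\<delta> k / (\<delta> k + dist x y)) powr \<epsilon>2 \<le> c1 * W \<epsilon>2 (\<delta> k) x y"
        unfolding c1_def by (rule kernel_le_W[OF \<delta>])
      also have "\<dots> \<le> c1 * (c2 * W \<epsilon>2 (\<delta> k) y x)"
        unfolding c2_def using c eps2 by (intro mult_left_mono W_sym \<delta>) auto
      finally have "C4 * (1 / (V \<mu> (\<delta> k) x + Vxy \<mu> x y) * (\<delta> k / (\<delta> k + dist x y)) powr \<epsilon>2)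
          \<le> C4 * (c1 * (c2 * W \<epsilon>2 (\<delta> k) y x))" using ker(1) by (intro mult_left_mono) auto
      also have "\<dots> = (c1 * C4 * c2) * W \<epsilon>2 (\<delta> k) y x" by simp
      also have "\<dots> \<le> C5 * W \<epsilon>2 (\<delta> k) y x" by (intro mult_right_mono C5) simp
      finally show ?thesis .
    qed
    show "tb y (\<delta> k) \<epsilon>1 \<epsilon>2 C5 (\<lambda>x. S k x y)"
    proof (rule tbI)
      show "\<bar>S k x y\<bar> \<le> C5 * W \<epsilon>2 (\<delta> k) y x" for x
      proof -
        have "\<bar>S k x y\<bar> \<le> C4 * (1 / (V \<mu> (\<delta> k) x + Vxy \<mu> x y)) * (\<delta> k / (\<delta> k + dist x y)) powr \<epsilon>2"
          using ker(2)[of x k] unfolding test_bound_def by blast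
        then show ?thesis using W[of x] by (simp add: mult.assoc)
      qed
      fix x x' assume d: "dist x x' \<le> (\<delta> k + dist y x) / 2"
      define t where "t = (dist x x' / (\<delta> k + dist y x)) powr \<epsilon>1"
      have "\<bar>S k x' y - S k x y\<bar>
        \<le> t * (C4 * (1 / (V \<mu> (\<delta> k) x + Vxy \<mu> x y) * (\<delta> k / (\<delta> k + dist x y)) powr \<epsilon>2))"
        using ker(3)[of x x' k y] d by (simp add: t_def dist_commute[of y] abs_minus_commute mult_ac)
      also have "\<dots> \<le> t * (C5 * W \<epsilon>2 (\<delta> k) y x)" by (intro mult_left_mono W) (simp add: t_def)
      finally show "\<bar>S k x' y - S k x y\<bar> \<le> C5 * (dist x x' / (\<delta> k + dist y x)) powr \<epsilon>1 * W \<epsilon>2 (\<delta> k) y x"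
        by (simp add: t_def mult_ac)
    qed
  qed
  show ?thesis
  proof (rule nn_integral_grand_max_le, goal_cases)
    case (1 K)
    define c where "c = 2 * chg_const 1 \<gamma>"
    have c: "c > 0" using chg_const_pos[of 1 \<gamma>] by (simp add: c_def)
    \<comment> \<open>\<open>K\<close> is the constant for the remainder and \<open>c\<close> that
      between \<open>nt_max\<close> and \<open>grand_max_loc\<close>, raised to the power
      \<open>p\<close> under the integral. Neither involves \<open>l\<close>, since the estimates
      were uniform in \<delta>.\<close>
    define C where "C = (K * c powr p) powr (1 / p)"
    have C: "C > 0" using 1(1) c by (simp add: C_def)
    have "Hp_norm \<mu> x1 \<epsilon> \<beta> \<gamma> p (minus_S \<mu> S l f)
      \<le> ennreal C * Lp_norm \<mu> p (grand_max_loc \<mu> x1 \<epsilon> \<beta> \<gamma> l f)"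
      if f: "f \<in> G0_dual \<mu> x1 \<epsilon> \<beta> \<gamma>" for l f
    proof -
      define X where "X = (\<integral>\<^sup>+x. enn_powr (nt_max (\<delta> l) f x) p \<partial>\<mu>)"
      define Y where "Y = (\<integral>\<^sup>+x. enn_powr (grand_max_loc \<mu> x1 \<epsilon> \<beta> \<gamma> l f x) p \<partial>\<mu>)"
      \<comment> \<open>\<^const>\<open>grand_max_loc\<close> need not be measurable, so constants are moved only through \<^const>\<open>nt_max\<close>.\<close>
      have "ennreal (1 / c powr p) * X
        = (\<integral>\<^sup>+x. ennreal (1 / c powr p) * enn_powr (nt_max (\<delta> l) f x) p \<partial>\<mu>)"
        unfolding X_def by (intro nn_integral_cmult[symmetric]) simp
      also have "\<dots> \<le> Y"
        unfolding Y_def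
      proof (rule nn_integral_mono)
        fix x
        have "enn_powr (nt_max (\<delta> l) f x) p \<le> enn_powr (ennreal c * grand_max_loc \<mu> x1 \<epsilon> \<beta> \<gamma> l f x) p"
          using p0 nt_max_le_grand_max_loc[OF f, of l x]
            by (intro enn_powr_mono) (auto simp: c_def \<delta>_def)
        also have "\<dots> = ennreal (c powr p) * enn_powr (grand_max_loc \<mu> x1 \<epsilon> \<beta> \<gamma> l f x) p"
          by (rule enn_powr_mult[OF c])
        finally have "ennreal (1 / c powr p) * enn_powr (nt_max (\<delta> l) f x) p
            \<le> ennreal (1 / c powr p) * (ennreal (c powr p) * enn_powr (grand_max_loc \<mu> x1 \<epsilon> \<beta> \<gamma> l f
              x) p)"
          by (rule mult_left_mono) simp
        also have "\<dots> = enn_powr (grand_max_loc \<mu> x1 \<epsilon> \<beta> \<gamma> l f x) p"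
          using c by (simp add: mult.assoc[symmetric] flip: ennreal_mult)
        finally show "ennreal (1 / c powr p) * enn_powr (nt_max (\<delta> l) f x) p
          \<le> enn_powr (grand_max_loc \<mu> x1 \<epsilon> \<beta> \<gamma> l f x) p" .
      qed
      finally have "ennreal (c powr p) * (ennreal (1 / c powr p) * X) \<le> ennreal (c powr p) * Y"
        by (rule mult_left_mono) simp
      then have XY: "X \<le> ennreal (c powr p) * Y"
        using c by (simp add: mult.assoc[symmetric] flip: ennreal_mult)
      have "minus_S \<mu> S l f = (\<lambda>\<phi>. f \<phi> - (LINT z|\<mu>. f (S l z) * \<phi> z))"
        by (simp add: minus_S_def S_apply_def)
      then have "(\<integral>\<^sup>+x. enn_powr (grand_max \<mu> x1 \<epsilon> \<beta> \<gamma> (minus_S \<mu> S l f) x) p \<partial>\<mu>) \<le> ennreal K * X"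
        using 1(2)[OF f kern] by (simp add: X_def)
      also have "\<dots> \<le> ennreal K * (ennreal (c powr p) * Y)" by (intro mult_left_mono XY) simp
      also have "\<dots> = ennreal (K * c powr p) * Y" using 1(1) by (simp add: ennreal_mult mult.assoc)
      finally have "Hp_norm \<mu> x1 \<epsilon> \<beta> \<gamma> p (minus_S \<mu> S l f)
        \<le> enn_powr (ennreal (K * c powr p) * Y) (1 / p)"
        unfolding Hp_norm_def Lp_norm_def using p0 by (intro enn_powr_mono) auto
      also have "\<dots> = ennreal C * Lp_norm \<mu> p (grand_max_loc \<mu> x1 \<epsilon> \<beta> \<gamma> l f)"
        unfolding C_def Lp_norm_def Y_def using 1(1) c by (intro enn_powr_mult) simp
      finally show ?thesis .
    qed
    then show ?case using C by blast
  qed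
qed

end
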